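(* Let $1<p\le q<\infty$, and let $\sigma$ and $\omega$ be positive Borel measures on $(X,\rho)$ with the property that $\sigma(B)<\infty$ and $\omega(B)<\infty$ for all balls $B$. Let $T$ be a potential type operator. Then $$\|T\|_{L^p_\sigma\to L^q_\omega}\approx [\sigma,\omega]_{S_{p,q}}+[\omega,\sigma]^*_{S_{q',p'}},$$ i.e. each side is bounded by a constant times the other, and the constants of equivalence only depend on the geometric structure of $X$ (that is, on $A_0,A_1,\delta$), and on $p$ and $q$. Here $$[\sigma,\omega]_{S_{p,q}}:=\sup_Q \sigma(Q)^{-1/p}\,\big\|\chi_Q T(\chi_Q\,d\sigma)\big\|_{L^q_\omega}\qquad\text{and}\qquad [\omega,\sigma]^*_{S_{q',p'}}:=\sup_Q \omega(Q)^{-1/q'}\,\big\|\chi_Q T^*(\chi_Q\,d\omega)\big\|_{L^{p'}_\sigma}$$ are the testing conditions, where the suprema are over all dyadic cubes $Q\in\bigcup_{t=1}^L\mathscr{D}^t$, and $\infty\cdot 0$ is interpreted as $0$.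
   Context: Space. $(X,\rho)$ is a quasi-metric space: $\rho$ satisfies the axioms of a metric except that the triangle inequality is weakened to $\rho(x,y)\le A_0(\rho(x,z)+\rho(z,y))$ with a constant $A_0\ge 1$. Balls are $B(x,r)=\{y\in X:\rho(y,x)<r\}$, and all balls are measurable. $X$ is geometrically doubling: there is a positive integer $A_1$ such that every ball $B(x,r)$ can be covered by at most $A_1$ balls $B(x_i,r/2)$. Adjacent dyadic systems. Fix $\delta\in(0,1)$ with $96A_0^6\delta\le 1$, a point $x_0\in X$, and a finite collection $\mathscr{D}^t$, $t=1,\dots,L$, with $L=L(A_0,A_1,\delta)<\infty$, having the following properties (such collections are known to exist). Each $\mathscr{D}^t$ is a countable family of Borel sets $Q^k_\alpha$, $k\in\mathbb{Z}$, $\alpha\in\mathscr{A}_k$ (dyadic cubes of generation $k$, identified by the index pair $(k,\alpha)$), with center points $z^k_\alpha$, such that: for every $k$, $X=\bigcup_\alpha Q^k_\alpha$ (disjoint union); if $\ell\ge k$ then either $Q^\ell_\beta\subseteq Q^k_\alpha$ or $Q^k_\alpha\cap Q^\ell_\beta=\varnothing$; $B(z^k_\alpha,c_1\delta^k)\subseteq Q^k_\alpha\subseteq B(z^k_\alpha,C_1\delta^k)=:B(Q^k_\alpha)$ with $c_1=(12A_0^4)^{-1}$, $C_1=4A_0^2$; if $\ell\ge k$ and $Q^\ell_\beta\subseteq Q^k_\alpha$ then $B(Q^\ell_\beta)\subseteq B(Q^k_\alpha)$; for every $k$ there is $\alpha$ with $x_0=z^k_\alpha$. Collectively: for every ball $B(x,r)$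 with $\delta^{k+2}<r\le\delta^{k+1}$ there exist $t$ and $Q^k_\alpha\in\mathscr{D}^t$ with $B(x,r)\subseteq Q^k_\alpha$ and $\operatorname{diam}Q^k_\alpha\le Cr$, where $C=8A_0^3\delta^{-2}$. Potential type operator. $T(f\,d\sigma)(x)=\int_X K(x,y)f(y)\,d\sigma(y)$, where $K:X\times X\to[0,\infty]$ satisfies: for every $k_2>1$ there exists $k_1>1$ such that $K(x,y)\le k_1K(x',y)$ whenever $\rho(x',y)\le k_2\rho(x,y)$, and $K(x,y)\le k_1K(x,y')$ whenever $\rho(x,y')\le k_2\rho(x,y)$. Its formal adjoint is $T^*(g\,d\omega)(y)=\int_X K(x,y)g(x)\,d\omega(x)$. It is tacitly assumed that $K(x,y)<\infty$ for $x\ne y$, that $K(\cdot,y)$ and $K(x,\cdot)$ are measurable for fixed $x,y$, and that the integrals defining $T$ and $T^*$ give measurable functions. Notation. $1/p+1/p'=1$, $1/q+1/q'=1$. $\|T\|_{L^p_\sigma\to L^q_\omega}\in[0,\infty]$ is the smallest constant $C$ with $\left(\int_X T(f\,d\sigma)^q\,d\omega\right)^{1/q}\le C\left(\int_X f^p\,d\sigma\right)^{1/p}$ for all nonnegative $f\in L^p_\sigma$.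
   Formalization: The constants may also depend on the kernel's correspondence k_2 -> k_1, without which the claim fails (finite sets {1..N} are counterexamples); spaces are carried by subsets of one fixed type, and the reals suffice, since X has at most continuum many points. *)

theory Defs
  imports "HOL-Analysis.Analysis"
begin

text \<open>
  The space is a carrier set X inside a type, not a whole type, so that a theorem can quantify
  over all spaces after the constants have been chosen. A geometrically doubling quasi-metric
  space is separable, hence has at most the cardinality of the continuum and can be realised on
  a subset of \<^typ>\<open>real\<close>; constants that serve all carriers X in \<^typ>\<open>real\<close> therefore serve all spaces.
\<close>

definition qball :: "'a set \<Rightarrow> ('a \<Rightarrow> 'a \<Rightarrow> real) \<Rightarrow> 'a \<Rightarrow> real \<Rightarrow> 'a set" where
  "qball X \<rho> x r = {y \<in> X. \<rho> y x < r}"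

text \<open>Balls of a quasi-metric need not be open; a set is open if it contains a ball around each
  of its points.\<close>

definition qopen :: "'a set \<Rightarrow> ('a \<Rightarrow> 'a \<Rightarrow> real) \<Rightarrow> 'a set \<Rightarrow> bool" where
  "qopen X \<rho> U \<longleftrightarrow> U \<subseteq> X \<and> (\<forall>x\<in>U. \<exists>r>0. qball X \<rho> x r \<subseteq> U)"

definition qborel :: "'a set \<Rightarrow> ('a \<Rightarrow> 'a \<Rightarrow> real) \<Rightarrow> 'a measure" where
  "qborel X \<rho> = sigma X {U. qopen X \<rho> U}"

definition qdiam :: "('a \<Rightarrow> 'a \<Rightarrow> real) \<Rightarrow> 'a set \<Rightarrow> ennreal" where
  "qdiam \<rho> S = (SUP x\<in>S. SUP y\<in>S. ennreal (\<rho> x y))"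

locale quasi_metric_space =
  fixes X :: "'a set" and \<rho> :: "'a \<Rightarrow> 'a \<Rightarrow> real" and A\<^sub>0 :: real
  assumes A0_ge_1: "1 \<le> A\<^sub>0"
    and nonneg: "\<lbrakk>x \<in> X; y \<in> X\<rbrakk> \<Longrightarrow> 0 \<le> \<rho> x y"
    and zero_iff: "\<lbrakk>x \<in> X; y \<in> X\<rbrakk> \<Longrightarrow> \<rho> x y = 0 \<longleftrightarrow> x = y"
    and commute: "\<lbrakk>x \<in> X; y \<in> X\<rbrakk> \<Longrightarrow> \<rho> x y = \<rho> y x"
    and quasi_triangle: "\<lbrakk>x \<in> X; y \<in> X; z \<in> X\<rbrakk> \<Longrightarrow> \<rho> x y \<le> A\<^sub>0 * (\<rho> x z + \<rho> z y)"

locale doubling_space = quasi_metric_space X \<rho> A\<^sub>0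
  for X :: "'a set" and \<rho> :: "'a \<Rightarrow> 'a \<Rightarrow> real" and A\<^sub>0 :: real +
  fixes A\<^sub>1 :: nat
  assumes A1_pos: "1 \<le> A\<^sub>1"
    and ball_measurable: "\<lbrakk>x \<in> X; 0 < r\<rbrakk> \<Longrightarrow> qball X \<rho> x r \<in> sets (qborel X \<rho>)"
    and geometrically_doubling:
      "\<lbrakk>x \<in> X; 0 < r\<rbrakk> \<Longrightarrow>
        \<exists>F\<subseteq>X. finite F \<and> card F \<le> A\<^sub>1 \<and> qball X \<rho> x r \<subseteq> (\<Union>y\<in>F. qball X \<rho> y (r / 2))"

text \<open>A cube is identified by the index pair \<open>(k, \<alpha>)\<close> with \<open>\<alpha> \<in> I k\<close>; different pairs may give the
  same set. As each generation is countable, natural numbers serve as indices \<open>\<alpha>\<close>.\<close>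

locale dyadic_system =
  fixes X :: "'a set" and \<rho> :: "'a \<Rightarrow> 'a \<Rightarrow> real" and A\<^sub>0 \<delta> :: real and x\<^sub>0 :: 'a
    and I :: "int \<Rightarrow> nat set" and Q :: "int \<Rightarrow> nat \<Rightarrow> 'a set" and z :: "int \<Rightarrow> nat \<Rightarrow> 'a"
  assumes cube_borel: "\<alpha> \<in> I k \<Longrightarrow> Q k \<alpha> \<in> sets (qborel X \<rho>)"
    and center: "\<alpha> \<in> I k \<Longrightarrow> z k \<alpha> \<in> X"
    and cover: "X = (\<Union>\<alpha>\<in>I k. Q k \<alpha>)"
    and disjoint: "disjoint_family_on (Q k) (I k)"
    and nested: "\<lbrakk>k \<le> l; \<alpha> \<in> I k; \<beta> \<in> I l\<rbrakk> \<Longrightarrow> Q l \<beta> \<subseteq> Q k \<alpha> \<or> Q k \<alpha> \<inter> Q l \<beta> = {}"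
    and inner_ball: "\<alpha> \<in> I k \<Longrightarrow> qball X \<rho> (z k \<alpha>) (1 / (12 * A\<^sub>0 ^ 4) * \<delta> powi k) \<subseteq> Q k \<alpha>"
    and outer_ball: "\<alpha> \<in> I k \<Longrightarrow> Q k \<alpha> \<subseteq> qball X \<rho> (z k \<alpha>) (4 * A\<^sub>0 ^ 2 * \<delta> powi k)"
    and nested_ball: "\<lbrakk>k \<le> l; \<alpha> \<in> I k; \<beta> \<in> I l; Q l \<beta> \<subseteq> Q k \<alpha>\<rbrakk> \<Longrightarrow>
        qball X \<rho> (z l \<beta>) (4 * A\<^sub>0 ^ 2 * \<delta> powi l) \<subseteq> qball X \<rho> (z k \<alpha>) (4 * A\<^sub>0 ^ 2 * \<delta> powi k)"
    and base_point: "\<exists>\<alpha>\<in>I k. z k \<alpha> = x\<^sub>0"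

locale adjacent_dyadic_systems =
  fixes X :: "'a set" and \<rho> :: "'a \<Rightarrow> 'a \<Rightarrow> real" and A\<^sub>0 \<delta> :: real and x\<^sub>0 :: 'a and L :: nat
    and I :: "nat \<Rightarrow> int \<Rightarrow> nat set" and Q :: "nat \<Rightarrow> int \<Rightarrow> nat \<Rightarrow> 'a set"
    and z :: "nat \<Rightarrow> int \<Rightarrow> nat \<Rightarrow> 'a"
  assumes system: "t \<in> {1..L} \<Longrightarrow> dyadic_system X \<rho> A\<^sub>0 \<delta> x\<^sub>0 (I t) (Q t) (z t)"
    and ball_in_cube: "\<lbrakk>x \<in> X; \<delta> powi (k + 2) < r; r \<le> \<delta> powi (k + 1)\<rbrakk> \<Longrightarrow>
        \<exists>t\<in>{1..L}. \<exists>\<alpha>\<in>I t k.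
          qball X \<rho> x r \<subseteq> Q t k \<alpha> \<and> qdiam \<rho> (Q t k \<alpha>) \<le> ennreal (8 * A\<^sub>0 ^ 3 / \<delta> ^ 2 * r)"

definition dyadic_cubes ::
  "nat \<Rightarrow> (nat \<Rightarrow> int \<Rightarrow> nat set) \<Rightarrow> (nat \<Rightarrow> int \<Rightarrow> nat \<Rightarrow> 'a set) \<Rightarrow> 'a set set" where
  "dyadic_cubes L I Q = {Q t k \<alpha> | t k \<alpha>. t \<in> {1..L} \<and> \<alpha> \<in> I t k}"

definition locally_finite_borel_measure ::
  "'a set \<Rightarrow> ('a \<Rightarrow> 'a \<Rightarrow> real) \<Rightarrow> 'a measure \<Rightarrow> bool" where
  "locally_finite_borel_measure X \<rho> \<mu> \<longleftrightarrow>
     space \<mu> = X \<and> sets \<mu> = sets (qborel X \<rho>) \<and>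
     (\<forall>x\<in>X. \<forall>r>0. emeasure \<mu> (qball X \<rho> x r) < \<infinity>)"

text \<open>The function \<open>\<kappa>\<close> records the dependence of \<open>k\<^sub>1 = \<kappa> k\<^sub>2\<close> on \<open>k\<^sub>2\<close> in the
  definition of a potential type kernel.\<close>

locale potential_kernel =
  fixes X :: "'a set" and \<rho> :: "'a \<Rightarrow> 'a \<Rightarrow> real" and \<kappa> :: "real \<Rightarrow> real"
    and K :: "'a \<Rightarrow> 'a \<Rightarrow> ennreal"
  assumes kappa_gt_1: "1 < k\<^sub>2 \<Longrightarrow> 1 < \<kappa> k\<^sub>2"
    and kernel_left: "\<lbrakk>1 < k\<^sub>2; x \<in> X; x' \<in> X; y \<in> X; \<rho> x' y \<le> k\<^sub>2 * \<rho> x y\<rbrakk> \<Longrightarrow>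
        K x y \<le> ennreal (\<kappa> k\<^sub>2) * K x' y"
    and kernel_right: "\<lbrakk>1 < k\<^sub>2; x \<in> X; y \<in> X; y' \<in> X; \<rho> x y' \<le> k\<^sub>2 * \<rho> x y\<rbrakk> \<Longrightarrow>
        K x y \<le> ennreal (\<kappa> k\<^sub>2) * K x y'"
    and kernel_finite: "\<lbrakk>x \<in> X; y \<in> X; x \<noteq> y\<rbrakk> \<Longrightarrow> K x y < \<infinity>"
    and measurable_left: "y \<in> X \<Longrightarrow> (\<lambda>x. K x y) \<in> borel_measurable (qborel X \<rho>)"
    and measurable_right: "x \<in> X \<Longrightarrow> (\<lambda>y. K x y) \<in> borel_measurable (qborel X \<rho>)"

definition potential_op ::
  "('a \<Rightarrow> 'a \<Rightarrow> ennreal) \<Rightarrow> 'a measure \<Rightarrow> ('a \<Rightarrow> ennreal) \<Rightarrow> 'a \<Rightarrow> ennreal" where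
  "potential_op K \<sigma> f x = (\<integral>\<^sup>+ y. K x y * f y \<partial>\<sigma>)"

definition adjoint_op ::
  "('a \<Rightarrow> 'a \<Rightarrow> ennreal) \<Rightarrow> 'a measure \<Rightarrow> ('a \<Rightarrow> ennreal) \<Rightarrow> 'a \<Rightarrow> ennreal" where
  "adjoint_op K \<omega> g y = (\<integral>\<^sup>+ x. K x y * g x \<partial>\<omega>)"

locale potential_operator = potential_kernel X \<rho> \<kappa> K
  for X :: "'a set" and \<rho> :: "'a \<Rightarrow> 'a \<Rightarrow> real" and \<kappa> :: "real \<Rightarrow> real"
    and K :: "'a \<Rightarrow> 'a \<Rightarrow> ennreal" +
  fixes \<sigma> \<omega> :: "'a measure"
  assumes op_measurable: "f \<in> borel_measurable (qborel X \<rho>) \<Longrightarrow>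
      potential_op K \<sigma> f \<in> borel_measurable (qborel X \<rho>)"
    and adjoint_measurable: "g \<in> borel_measurable (qborel X \<rho>) \<Longrightarrow>
      adjoint_op K \<omega> g \<in> borel_measurable (qborel X \<rho>)"

text \<open>Powers of extended nonnegative reals; only used for exponents \<open>a > 0\<close>.\<close>

definition epowr :: "ennreal \<Rightarrow> real \<Rightarrow> ennreal" where
  "epowr x a = (if x = \<infinity> then \<infinity> else ennreal (enn2real x powr a))"

definition Lp_norm :: "real \<Rightarrow> 'a measure \<Rightarrow> ('a \<Rightarrow> ennreal) \<Rightarrow> ennreal" where
  "Lp_norm p \<mu> f = epowr (\<integral>\<^sup>+ x. epowr (f x) p \<partial>\<mu>) (1 / p)"

definition op_norm ::
  "real \<Rightarrow> 'a measure \<Rightarrow> real \<Rightarrow> 'a measure \<Rightarrow> (('a \<Rightarrow> ennreal) \<Rightarrow> 'a \<Rightarrow> ennreal) \<Rightarrow> ennreal" where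
  "op_norm p \<sigma> q \<omega> S =
     Inf {C. \<forall>f\<in>borel_measurable \<sigma>. Lp_norm p \<sigma> f < \<infinity> \<longrightarrow> Lp_norm q \<omega> (S f) \<le> C * Lp_norm p \<sigma> f}"

text \<open>In \<^typ>\<open>ennreal\<close>, \<open>inverse 0 = \<infinity>\<close> and \<open>\<infinity> * 0 = 0\<close>, which is the convention wanted for cubes
  of measure zero.\<close>

definition testing_const ::
  "'a set set \<Rightarrow> real \<Rightarrow> 'a measure \<Rightarrow> real \<Rightarrow> 'a measure \<Rightarrow>
    (('a \<Rightarrow> ennreal) \<Rightarrow> 'a \<Rightarrow> ennreal) \<Rightarrow> ennreal" where
  "testing_const \<D> p \<sigma> q \<omega> S =
     (SUP R\<in>\<D>. inverse (epowr (emeasure \<sigma> R) (1 / p)) *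
        Lp_norm q \<omega> (\<lambda>x. indicator R x * S (indicator R) x))"

end

theory Submission
  imports Defs
begin

text \<open>
  \<open>K\<close> is dominated off the diagonal by finitely many dyadic kernels \<open>sup {min (u i x)
  (v i y) | x \<in> Q i \<and> y \<in> Q i} \<le> K x y\<close>, where \<open>u i x\<close> is the
  infimum of \<open>K\<close> over the product of a small cube around \<open>x\<close> with \<open>Q
  i\<close>, and \<open>v i y\<close> the infimum over \<open>Q i\<close> times a small cube around
  \<open>y\<close>. (An infimum over \<open>Q i \<times> Q i\<close> could be too small, as \<open>K x
  y\<close> and \<open>K y x\<close> need not be comparable.) The bilinear form of such a kernel is split
  according to whether the average of \<open>f\<close> or that of \<open>g\<close> is the larger one on
  \<open>Q i\<close> (in the scale-invariant normalisation of \<open>L\<^sup>p\<close> and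
  \<open>L\<^sup>q\<^sup>'\<close>). In the first case only \<open>u\<close> is kept, and a stopping-time
  argument on the averages of \<open>f\<close> reduces the form to the testing condition for
  \<open>T\<close>; the second case is dual. The diagonal matters only at the countably many atoms, where
  testing on small cubes suffices. For the converse, duality is legitimate although \<open>K\<close> need
  not be jointly measurable, because the dyadic kernels are.
\<close>

section \<open>Powers of extended nonnegative reals\<close>

text \<open>Two opposite demands fix the size of the small cube in \<open>u i x\<close>. Its points
  must keep a distance from \<open>y\<close> comparable to \<open>\<rho> x y\<close>, so it has to
  be small. On the other hand the stopping argument replaces \<open>g\<close> by its mean on the
  next stopping cubes, so \<open>u i\<close> must be constant on every cube strictly finer than
  \<open>Q i\<close>, and such a cube has to fit inside the small one. Since
  \<open>\<rho> x y\<close> may be as small as half of \<delta>^(k+2) in a cube of generation k, the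
  small cube is taken three generations down; the second demand is then met by treating the residue
  classes of generations modulo 3 separately. The condition p \<le> q enters through q / p \<ge> 1:
  terms that are bounded and summable stay summable when raised to the power q / p. This is needed
  for the stopping cubes and for the atoms. The diagonal has to be separated because the kernel
  conditions bound \<open>K x x\<close> from above only by itself: for x = y the condition on \<rho>
  forces x' = y. Off-diagonal values therefore give no control of \<open>K x x\<close>, which may be
  infinite.\<close>

lemma epowr_0 [simp]: "epowr 0 a = 0"
  by (simp add: epowr_def)

lemma epowr_top [simp]: "epowr top a = top"
  by (simp add: epowr_def)

lemma epowr_ennreal: "0 \<le> x \<Longrightarrow> epowr (ennreal x) a = ennreal (x powr a)"
  by (simp add: epowr_def)

lemma epowr_one [simp]: "epowr 1 a = 1"
  by (simp add: epowr_def)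

lemma epowr_1 [simp]: "epowr x 1 = x"
  by (cases x) (auto simp: epowr_ennreal)

lemma epowr_eq_top_iff [simp]: "epowr x a = top \<longleftrightarrow> x = top"
  by (simp add: epowr_def)

lemma epowr_eq_0_iff [simp]: "epowr x a = 0 \<longleftrightarrow> x = 0"
  by (cases x) (auto simp: epowr_ennreal)

lemma epowr_mono: "0 \<le> a \<Longrightarrow> x \<le> y \<Longrightarrow> epowr x a \<le> epowr y a"
  by (cases x; cases y) (auto simp: epowr_ennreal ennreal_leI powr_mono2 top_unique)

lemma epowr_mult: "epowr (x * y) a = epowr x a * epowr y a"
proof (cases "x = top \<or> y = top")
  case True
  then show ?thesis
    by (auto simp: ennreal_mult_eq_top_iff ennreal_top_mult ennreal_mult_top)
next
  case False
  then obtain u v where "x = ennreal u" "y = ennreal v" "0 \<le> u" "0 \<le> v"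
    by (metis ennreal_cases infinity_ennreal_def)
  then show ?thesis
    by (simp add: epowr_ennreal powr_mult flip: ennreal_mult)
qed

lemma epowr_epowr: "epowr (epowr x a) b = epowr x (a * b)"
  by (cases x) (auto simp: epowr_ennreal powr_powr)

lemma epowr_add: "epowr x (a + b) = epowr x a * epowr x b"
  by (cases x) (auto simp: epowr_ennreal powr_add ennreal_mult)

text \<open>The powers \<open>a\<close> and \<open>1 / a\<close> are inverse increasing maps, hence
  form a Galois connection; this is what lets powers pass suprema.\<close>

lemma epowr_le_iff: "0 < a \<Longrightarrow> epowr x a \<le> y \<longleftrightarrow> x \<le> epowr y (1 / a)"
  using epowr_mono[of "1/a" "epowr x a" y] epowr_mono[of a x "epowr y (1/a)"]
  by (auto simp: epowr_epowr)

lemma measurable_epowr [measurable]: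
  "f \<in> borel_measurable M \<Longrightarrow> (\<lambda>x. epowr (f x) a) \<in> borel_measurable M"
proof -
  assume [measurable]: "f \<in> borel_measurable M"
  have "{x \<in> space M. f x = \<infinity>} \<in> sets M" by measurable
  moreover have "(\<lambda>x. ennreal (enn2real (f x) powr a)) \<in> borel_measurable M"
    by (intro measurable_compose[OF _ measurable_ennreal] powr_real_measurable) auto
  ultimately show ?thesis
    unfolding epowr_def by (intro measurable_If) auto
qed

lemma epowr_SUP:
  assumes "0 < a" "incseq f"
  shows "epowr (SUP n. f n) a = (SUP n::nat. epowr (f n) a)"
proof (rule antisym)
  have "f n \<le> epowr (SUP n. epowr (f n) a) (1 / a)" for n
    using assms(1) epowr_le_iff by (metis SUP_upper UNIV_I)
  then show "epowr (SUP n. f n) a \<le> (SUP n. epowr (f n) a)"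
    using assms(1) by (subst epowr_le_iff) (auto intro!: SUP_least)
  show "(SUP n. epowr (f n) a) \<le> epowr (SUP n. f n) a"
    using assms(1) by (intro SUP_least epowr_mono SUP_upper) auto
qed

text \<open>Serves to bound a function in L^r on a set of finite measure by an integrable one,
  without Hoelder's inequality.\<close>

lemma le_1_plus_epowr: "1 \<le> r \<Longrightarrow> (x::ennreal) \<le> 1 + epowr x r"
proof (cases "x \<le> 1")
  case True
  then show ?thesis by (simp add: add_increasing2)
next
  case False
  assume "1 \<le> r"
  have "x \<le> epowr x r"
  proof (cases x)
    case (real u)
    then have "1 < u" using False by (metis ennreal_leI ennreal_1 not_le)
    then show ?thesis using real \<open>1 \<le> r\<close> powr_mono[of 1 r u] by (simp add: epowr_ennreal ennreal_leI)
  qed simp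
  then show ?thesis by (simp add: add_increasing)
qed

lemma conjugate_exponent_gt_1:
  fixes q q' :: real
  assumes "1 < q" "1/q + 1/q' = 1"
  shows "1 < q'"
proof -
  have "q' \<noteq> 0" using assms by auto
  then have "q' = q / (q - 1)" using assms by (auto simp: field_simps)
  then show ?thesis using assms by auto
qed

text \<open>Without the weights 1/q and 1/q' a distinction of cases suffices: a^q dominates if b
  \<le> a^(q-1), and b^q' dominates otherwise, because q - 1 and q' - 1 are reciprocal.\<close>

lemma young_real:
  fixes a b q q' :: real
  assumes "1 < q" "1/q + 1/q' = 1" "0 \<le> a" "0 \<le> b"
  shows "a * b \<le> a powr q + b powr q'"
proof (cases "b \<le> a powr (q - 1)")
  case True
  have "a * b \<le> a * a powr (q - 1)"
    using True assms by (intro mult_left_mono) auto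
  also have "\<dots> = a powr q"
    using assms by (simp add: powr_mult_base)
  finally show ?thesis by (smt (verit) powr_ge_zero)
next
  case False
  have e: "1 < q'"
    using conjugate_exponent_gt_1[OF assms(1,2)] .
  moreover have "(q - 1) * (q' - 1) = 1"
    using assms e by (auto simp: field_simps)
  ultimately have e: "(q - 1) * (q' - 1) = 1" "1 < q'" by auto
  have "a = (a powr (q - 1)) powr (q' - 1)"
    using assms e by (simp add: powr_powr)
  also have "\<dots> \<le> b powr (q' - 1)"
    using False e by (intro powr_mono2) auto
  finally have "a * b \<le> b powr (q' - 1) * b"
    using assms by (intro mult_right_mono) auto
  also have "\<dots> = b powr q'"
    using assms powr_mult_base[of b "q' - 1"] by (simp add: mult.commute)
  finally show ?thesis by (smt (verit) powr_ge_zero)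
qed

lemma young_ennreal:
  fixes x y :: ennreal
  assumes "1 < q" "1/q + 1/q' = 1"
  shows "x * y \<le> epowr x q + epowr y q'"
proof (cases "x = top \<or> y = top")
  case True
  then show ?thesis by auto
next
  case False
  then obtain u v where "x = ennreal u" "y = ennreal v" "0 \<le> u" "0 \<le> v"
    by (metis ennreal_cases infinity_ennreal_def)
  then show ?thesis
    using young_real[OF assms, of u v]
    by (simp add: epowr_ennreal flip: ennreal_mult ennreal_plus)
qed

text \<open>When indices are added in order of level, each new one contributes the excess of its
  value over the supremum of the earlier ones; monotonicity along the chain makes the truncated
  subtraction exact. This turns the supremum defining the kernel into a sum of layers.\<close>

lemma SUP_telescope:
  fixes a :: "'i \<Rightarrow> ennreal" and l :: "'i \<Rightarrow> int"
  assumes "finite J" "inj_on l J" "\<And>i j. i \<in> J \<Longrightarrow> j \<in> J \<Longrightarrow> l i < l j \<Longrightarrow> a i \<le> a j"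
  shows "(\<Sum>i\<in>J. a i - (SUP j\<in>{j\<in>J. l j < l i}. a j)) = (SUP i\<in>J. a i)"
  using assms
proof (induction J rule: finite_ranking_induct[where f = l])
  case empty
  then show ?case by (simp add: bot_ennreal)
next
  case (insert x S)
  show ?case
  proof (cases "x \<in> S")
    case True
    then show ?thesis using insert by (simp add: insert_absorb)
  next
    case False
    have lt: "l y < l x" if "y \<in> S" for y
      using insert.hyps(2)[OF that] insert.prems(1) False that by (auto simp: inj_on_def less_le)
    have s1: "{j \<in> insert x S. l j < l x} = S" using lt by auto
    have s2: "{j \<in> insert x S. l j < l i} = {j \<in> S. l j < l i}" if "i \<in> S" for i
      using lt[OF that] by auto
    have "(\<Sum>i\<in>insert x S. a i - (SUP j\<in>{j\<in>insert x S. l j < l i}. a j))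
        = (a x - (SUP j\<in>S. a j)) + (\<Sum>i\<in>S. a i - (SUP j\<in>{j\<in>S. l j < l i}. a j))"
      unfolding sum.insert[OF insert.hyps(1) False] s1 by (simp only: s2 cong: sum.cong)
    also have "\<dots> = (a x - (SUP j\<in>S. a j)) + (SUP j\<in>S. a j)"
      using insert by (simp add: inj_on_def)
    also have "\<dots> = a x"
      using lt insert.prems by (intro diff_add_cancel_ennreal SUP_least) auto
    also have "\<dots> = (SUP i\<in>insert x S. a i)"
      using lt insert.prems
      by (intro antisym SUP_least SUP_upper2[of x]) (auto simp: less_imp_le)
    finally show ?thesis .
  qed
qed

text \<open>Distinct integer exponents give at most a full geometric series: in the induction all
  exponents but the largest are at most \<open>n x - 1\<close>.\<close>

lemma sum_powers_of_two_le:
  fixes n :: "'i \<Rightarrow> int"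
  assumes "finite J" "inj_on n J" "\<And>i. i \<in> J \<Longrightarrow> n i \<le> m"
  shows "(\<Sum>i\<in>J. 2 powr real_of_int (n i)) \<le> 2 * 2 powr real_of_int m"
  using assms
proof (induction J arbitrary: m rule: finite_ranking_induct[where f = n])
  case empty
  then show ?case by simp
next
  case (insert x S)
  show ?case
  proof (cases "x \<in> S")
    case True
    then show ?thesis using insert by (simp add: insert_absorb)
  next
    case False
    have "n y \<le> n x - 1" if "y \<in> S" for y
    proof -
      have "n y \<noteq> n x"
        using insert.prems(1) False that by (auto simp: inj_on_def)
      then show ?thesis using insert.hyps(2)[OF that] by simp
    qed
    then have "(\<Sum>i\<in>S. 2 powr real_of_int (n i)) \<le> 2 * 2 powr real_of_int (n x - 1)"
      using insert by (intro insert.IH) (auto simp: inj_on_def)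
    also have "\<dots> = 2 powr real_of_int (n x)"
      by (simp add: powr_diff)
    finally have "(\<Sum>i\<in>insert x S. 2 powr real_of_int (n i)) \<le> 2 * 2 powr real_of_int (n x)"
      using False insert.hyps by simp
    also have "\<dots> \<le> 2 * 2 powr real_of_int m"
      using insert.prems(2)[of x] by simp
    finally show ?thesis .
  qed
qed

section \<open>Stopping cubes for dyadic forms\<close>

text \<open>If x \<le> m/4, the first summand absorbs the product; otherwise m < 4x and the second
  one does. The factor 1/4 is chosen so that, after the factor 2 from summing powers of two, half of
  the sum to be estimated can be absorbed.\<close>

lemma mult_le_cut:
  fixes x m :: real
  assumes "1 < p" "0 \<le> x" "0 < m"
  shows "x * m powr (p - 1) \<le> (1/4) * m powr p + 4 powr (p - 1) * x powr p"
proof (cases "x \<le> m / 4")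
  case True
  have "x * m powr (p - 1) \<le> (m / 4) * m powr (p - 1)"
    using True by (intro mult_right_mono) auto
  also have "\<dots> = (1/4) * m powr p"
    using assms powr_mult_base[of m "p - 1"] by simp
  also have "\<dots> \<le> (1/4) * m powr p + 4 powr (p - 1) * x powr p"
    by simp
  finally show ?thesis .
next
  case False
  then have "x * m powr (p - 1) \<le> x * (4 * x) powr (p - 1)"
    using assms by (intro mult_left_mono powr_mono2) auto
  also have "\<dots> = 4 powr (p - 1) * x powr p"
  proof -
    have "x * (4 * x) powr (p - 1) = 4 powr (p - 1) * (x * x powr (p - 1))"
      using assms by (subst powr_mult) (simp_all only: mult.assoc mult.left_commute)
    also have "x * x powr (p - 1) = x powr p"
      using powr_mult_base[OF assms(2), of "p - 1"] by simp
    finally show ?thesis .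
  qed
  also have "\<dots> \<le> (1/4) * m powr p + 4 powr (p - 1) * x powr p"
    by simp
  finally show ?thesis .
qed

text \<open>The form with kernel \<open>H x y = sup {a i x | x \<in> Q i \<and> y \<in> Q i}\<close>, where \<open>a i\<close> grows as the cubes shrink and
  is constant on the strictly finer cubes. The functions are normalised in \<open>L\<^sup>p\<close> and \<open>L\<^sup>q\<^sup>'\<close>. A cube is
  an index \<open>i\<close> of generation \<open>l i\<close>, as different cubes may coincide as sets.\<close>

locale dyadic_form =
  fixes \<sigma> \<omega> :: "'a measure" and \<A> :: "'i set" and Q :: "'i \<Rightarrow> 'a set" and l :: "'i \<Rightarrow> int"
    and a :: "'i \<Rightarrow> 'a \<Rightarrow> ennreal" and p q q' :: real and f g :: "'a \<Rightarrow> ennreal"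
  assumes fin: "finite \<A>"
    and Q_sigma: "i \<in> \<A> \<Longrightarrow> Q i \<in> sets \<sigma>" and Q_omega: "i \<in> \<A> \<Longrightarrow> Q i \<in> sets \<omega>"
    and sigma_finite: "i \<in> \<A> \<Longrightarrow> emeasure \<sigma> (Q i) \<noteq> top"
    and omega_finite: "i \<in> \<A> \<Longrightarrow> emeasure \<omega> (Q i) \<noteq> top"
    and same_level: "\<lbrakk>i \<in> \<A>; j \<in> \<A>; l i = l j; x \<in> Q i; x \<in> Q j\<rbrakk> \<Longrightarrow> i = j"
    and nested: "\<lbrakk>i \<in> \<A>; j \<in> \<A>; l i \<le> l j; x \<in> Q i; x \<in> Q j\<rbrakk> \<Longrightarrow> Q j \<subseteq> Q i"
    and a_measurable [measurable]: "i \<in> \<A> \<Longrightarrow> a i \<in> borel_measurable \<omega>"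
    and a_mono: "\<lbrakk>i \<in> \<A>; j \<in> \<A>; l i < l j; x \<in> Q i; x \<in> Q j\<rbrakk> \<Longrightarrow> a i x \<le> a j x"
    and a_const: "\<lbrakk>i \<in> \<A>; j \<in> \<A>; l i < l j; x \<in> Q j; y \<in> Q j\<rbrakk> \<Longrightarrow> a i x = a i y"
    and p_gt_1: "1 < p" and p_le_q: "p \<le> q" and conj: "1/q + 1/q' = 1"
    and f_measurable [measurable]: "f \<in> borel_measurable \<sigma>"
    and g_measurable [measurable]: "g \<in> borel_measurable \<omega>"
    and f_norm: "(\<integral>\<^sup>+x. epowr (f x) p \<partial>\<sigma>) \<le> 1"
    and g_norm: "(\<integral>\<^sup>+x. epowr (g x) q' \<partial>\<omega>) \<le> 1"
begin

section \<open>The form as a sum of layers\<close>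

definition H :: "'a \<Rightarrow> 'a \<Rightarrow> ennreal" where
  "H x y = (SUP i\<in>{i\<in>\<A>. x \<in> Q i \<and> y \<in> Q i}. a i x)"

text \<open>The increment that cube \<open>i\<close> adds at x to all coarser cubes containing x, so
  that \<open>H\<close> becomes linear in the cubes.\<close>

definition lam :: "'i \<Rightarrow> 'a \<Rightarrow> ennreal" where
  "lam i x = a i x - (SUP j\<in>{j\<in>\<A>. x \<in> Q j \<and> l j < l i}. a j x)"

definition Fi :: "'i \<Rightarrow> real" where
  "Fi i = enn2real (\<integral>\<^sup>+y. f y * indicator (Q i) y \<partial>\<sigma>)"

definition Gi :: "'i \<Rightarrow> real" where
  "Gi i = enn2real (\<integral>\<^sup>+y. g y * indicator (Q i) y \<partial>\<omega>)"

abbreviation s :: "'i \<Rightarrow> real" where "s i \<equiv> measure \<sigma> (Q i)"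
abbreviation w :: "'i \<Rightarrow> real" where "w i \<equiv> measure \<omega> (Q i)"

lemma s_ennreal: "i \<in> \<A> \<Longrightarrow> emeasure \<sigma> (Q i) = ennreal (s i)"
  using sigma_finite by (simp add: emeasure_eq_ennreal_measure)

lemma w_ennreal: "i \<in> \<A> \<Longrightarrow> emeasure \<omega> (Q i) = ennreal (w i)"
  using omega_finite by (simp add: emeasure_eq_ennreal_measure)

lemma q_gt_1: "1 < q" and q'_gt_1: "1 < q'"
  using p_gt_1 p_le_q conjugate_exponent_gt_1[of q q'] conj by auto

lemma Fi_ennreal:
  assumes "i \<in> \<A>"
  shows "(\<integral>\<^sup>+y. f y * indicator (Q i) y \<partial>\<sigma>) = ennreal (Fi i)"
proof -
  note [measurable] = Q_sigma[OF assms]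
  have "(\<integral>\<^sup>+y. f y * indicator (Q i) y \<partial>\<sigma>) \<le> (\<integral>\<^sup>+y. indicator (Q i) y + epowr (f y) p \<partial>\<sigma>)"
    using p_gt_1 le_1_plus_epowr[of p] by (intro nn_integral_mono) (auto split: split_indicator)
  also have "\<dots> = emeasure \<sigma> (Q i) + (\<integral>\<^sup>+y. epowr (f y) p \<partial>\<sigma>)"
    by (subst nn_integral_add) auto
  also have "\<dots> < top"
    using f_norm sigma_finite[OF assms] by (auto simp: less_top[symmetric] top_unique)
  finally show ?thesis by (simp add: Fi_def less_top)
qed

lemma Gi_ennreal:
  assumes "i \<in> \<A>"
  shows "(\<integral>\<^sup>+y. g y * indicator (Q i) y \<partial>\<omega>) = ennreal (Gi i)"
proof -
  note [measurable] = Q_omega[OF assms]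
  have "(\<integral>\<^sup>+y. g y * indicator (Q i) y \<partial>\<omega>) \<le> (\<integral>\<^sup>+y. indicator (Q i) y + epowr (g y) q' \<partial>\<omega>)"
    using q'_gt_1 le_1_plus_epowr[of q'] by (intro nn_integral_mono) (auto split: split_indicator)
  also have "\<dots> = emeasure \<omega> (Q i) + (\<integral>\<^sup>+y. epowr (g y) q' \<partial>\<omega>)"
    by (subst nn_integral_add) auto
  also have "\<dots> < top"
    using g_norm omega_finite[OF assms] by (auto simp: less_top[symmetric] top_unique)
  finally show ?thesis by (simp add: Gi_def less_top)
qed

lemma Fi_nonneg: "0 \<le> Fi i" and Gi_nonneg: "0 \<le> Gi i"
  by (auto simp: Fi_def Gi_def)

lemma Fi_0: "i \<in> \<A> \<Longrightarrow> s i = 0 \<Longrightarrow> Fi i = 0"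
proof -
  assume i: "i \<in> \<A>" "s i = 0"
  then have "AE y in \<sigma>. y \<notin> Q i"
    using s_ennreal[OF i(1)] Q_sigma[OF i(1)] by (intro AE_not_in) (auto simp: null_sets_def)
  then have "(\<integral>\<^sup>+y. f y * indicator (Q i) y \<partial>\<sigma>) = (\<integral>\<^sup>+y. 0 \<partial>\<sigma>)"
    by (intro nn_integral_cong_AE) auto
  then show ?thesis by (simp add: Fi_def)
qed

lemma Gi_0: "i \<in> \<A> \<Longrightarrow> w i = 0 \<Longrightarrow> Gi i = 0"
proof -
  assume i: "i \<in> \<A>" "w i = 0"
  then have "AE y in \<omega>. y \<notin> Q i"
    using w_ennreal[OF i(1)] Q_omega[OF i(1)] by (intro AE_not_in) (auto simp: null_sets_def)
  then have "(\<integral>\<^sup>+y. g y * indicator (Q i) y \<partial>\<omega>) = (\<integral>\<^sup>+y. 0 \<partial>\<omega>)"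
    by (intro nn_integral_cong_AE) auto
  then show ?thesis by (simp add: Gi_def)
qed

lemma lam_measurable [measurable]: "i \<in> \<A> \<Longrightarrow> lam i \<in> borel_measurable \<omega>"
proof -
  assume i: "i \<in> \<A>"
  \<comment> \<open>The index set depends on x; indicators turn this into a supremum of measurable
    functions over a fixed finite set.\<close>
  have "(SUP j\<in>{j\<in>\<A>. x \<in> Q j \<and> l j < l i}. a j x)
      = (SUP j\<in>{j\<in>\<A>. l j < l i}. indicator (Q j) x * a j x)" for x
  proof (intro antisym SUP_least)
    fix j assume "j \<in> {j\<in>\<A>. x \<in> Q j \<and> l j < l i}"
    then show "a j x \<le> (SUP j\<in>{j\<in>\<A>. l j < l i}. indicator (Q j) x * a j x)"
      by (intro SUP_upper2[of j]) auto
  next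
    fix j assume j: "j \<in> {j\<in>\<A>. l j < l i}"
    show "indicator (Q j) x * a j x \<le> (SUP j\<in>{j\<in>\<A>. x \<in> Q j \<and> l j < l i}. a j x)"
    proof (cases "x \<in> Q j")
      case True
      then show ?thesis using j by (intro SUP_upper2[of j]) auto
    qed simp
  qed
  then have "lam i = (\<lambda>x. a i x - (SUP j\<in>{j\<in>\<A>. l j < l i}. indicator (Q j) x * a j x))"
    by (auto simp: lam_def)
  also have "\<dots> \<in> borel_measurable \<omega>"
    using i fin Q_omega
    by (intro borel_measurable_minus_ennreal borel_measurable_SUP borel_measurable_times_ennreal
          a_measurable borel_measurable_indicator) (auto intro: countable_finite)
  finally show ?thesis .
qed

text \<open>By nesting, a cube coarser than \<open>Q i\<close> that contains one point of
  \<open>Q j\<close> contains all of it, so the subtracted supremum runs over the same cubes at x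
  and y, and each \<open>a k\<close> in it is constant on \<open>Q j\<close>.\<close>

lemma lam_const:
  assumes "i \<in> \<A>" "j \<in> \<A>" "l i < l j" "x \<in> Q j" "y \<in> Q j"
  shows "lam i x = lam i y"
proof -
  have "{k\<in>\<A>. x \<in> Q k \<and> l k < l i} = {k\<in>\<A>. y \<in> Q k \<and> l k < l i}"
  proof -
    have "y \<in> Q k" if "k \<in> \<A>" "l k < l i" "x \<in> Q k" "x \<in> Q j" "y \<in> Q j" for k x y
      using nested[OF that(1) assms(2), of x] that assms(3) by auto
    then show ?thesis using assms(4,5) by blast
  qed
  moreover have "a k x = a k y" if "k \<in> {k\<in>\<A>. y \<in> Q k \<and> l k < l i}" for k
    using that assms a_const[of k j x y] by auto
  ultimately show ?thesis
    unfolding lam_def using a_const[OF assms] by (intro arg_cong2[where f = minus] SUP_cong)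
qed

lemma H_eq_sum_lam:
  assumes "x \<in> space \<omega>"
  shows "H x y = (\<Sum>i\<in>\<A>. indicator (Q i) x * lam i x * indicator (Q i) y)"
proof -
  let ?J = "{i\<in>\<A>. x \<in> Q i \<and> y \<in> Q i}"
  have "(\<Sum>i\<in>\<A>. indicator (Q i) x * lam i x * indicator (Q i) y) = (\<Sum>i\<in>?J. lam i x)"
    using fin by (intro sum.mono_neutral_cong_right) (auto split: split_indicator)
  also have "\<dots> = (\<Sum>i\<in>?J. a i x - (SUP j\<in>{j\<in>?J. l j < l i}. a j x))"
  proof (intro sum.cong refl)
    fix i assume i: "i \<in> ?J"
    \<comment> \<open>A coarser cube that contains x contains all of \<open>Q i\<close>, and
      therefore y; so the subtracted term does not depend on y.\<close>
    have "{j\<in>?J. l j < l i} = {j\<in>\<A>. x \<in> Q j \<and> l j < l i}"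
    proof -
      have "y \<in> Q j" if "j \<in> \<A>" "l j < l i" "x \<in> Q j" for j
        using nested[of j i x] that i by auto
      then show ?thesis by blast
    qed
    then show "lam i x = a i x - (SUP j\<in>{j\<in>?J. l j < l i}. a j x)"
      unfolding lam_def by simp
  qed
  also have "\<dots> = (SUP i\<in>?J. a i x)"
    using fin same_level[of _ _ x] a_mono[of _ _ x]
    by (intro SUP_telescope) (auto simp: inj_on_def)
  finally show ?thesis by (simp add: H_def)
qed

text \<open>With this ratio the numbers \<open>b i powr (p - 1)\<close> are powers of 2, so that their sum along a chain of
  stopping cubes is dominated by twice its last term.\<close>

definition \<theta> :: real where "\<theta> = 2 powr (1 / (p - 1))"

lemma theta_gt_1: "1 < \<theta>"
  using p_gt_1 by (simp add: \<theta>_def)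

section \<open>Rounded averages and the order of the active cubes\<close>

definition active :: "'i set" where "active = {i\<in>\<A>. 0 < Fi i}"

text \<open>Rounds the average of f down to a power of \<theta>. As these exponents are integers, a
  strict increase already means a factor of at least \<theta>, and no separate stopping threshold is
  needed.\<close>

definition n :: "'i \<Rightarrow> int" where "n i = \<lfloor>log \<theta> (Fi i / s i)\<rfloor>"

definition b :: "'i \<Rightarrow> real" where "b i = \<theta> powr real_of_int (n i)"

lemma active_subset: "active \<subseteq> \<A>" and finite_active: "finite active"
  using fin by (auto simp: active_def)

lemma activeD: "i \<in> active \<Longrightarrow> i \<in> \<A>" "i \<in> active \<Longrightarrow> 0 < Fi i" "i \<in> active \<Longrightarrow> 0 < s i" "i \<in> active \<Longrightarrow> Q i \<noteq> {}"
  using Fi_0[of i] by (auto simp: active_def less_le measure_nonneg)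

lemma b_pos: "0 < b i"
  using theta_gt_1 by (simp add: b_def)

lemma b_powr: "b i powr (p - 1) = 2 powr real_of_int (n i)"
  using p_gt_1 by (simp add: b_def \<theta>_def powr_powr)

lemma b_le: "i \<in> active \<Longrightarrow> b i * s i \<le> Fi i" and le_b: "i \<in> active \<Longrightarrow> Fi i \<le> \<theta> * b i * s i"
proof -
  assume i: "i \<in> active"
  note pos = activeD[OF i]
  let ?r = "Fi i / s i"
  have r: "0 < ?r" using pos by simp
  have "real_of_int (n i) \<le> log \<theta> ?r" unfolding n_def by simp
  then have "b i \<le> ?r"
    unfolding b_def using le_log_iff[of \<theta> ?r] theta_gt_1 r by simp
  then show "b i * s i \<le> Fi i" using pos by (simp add: pos_le_divide_eq)
  have "log \<theta> ?r \<le> real_of_int (n i) + 1" unfolding n_def by linarith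
  then have "?r \<le> \<theta> powr (real_of_int (n i) + 1)"
    using log_le_iff[of \<theta> ?r] theta_gt_1 r by simp
  also have "\<dots> = \<theta> * b i"
    using theta_gt_1 by (simp add: b_def powr_add)
  finally show "Fi i \<le> \<theta> * b i * s i"
    using pos by (simp add: pos_divide_le_eq)
qed

text \<open>Levels are compared besides the sets because different indices may carry the same set;
  inclusion alone would not be antisymmetric.\<close>

definition ancestor :: "'i \<Rightarrow> 'i \<Rightarrow> bool" where
  "ancestor i j \<longleftrightarrow> i \<in> active \<and> j \<in> active \<and> l i \<le> l j \<and> Q j \<subseteq> Q i"

lemma ancestor_refl: "i \<in> active \<Longrightarrow> ancestor i i" by (simp add: ancestor_def)

lemma ancestor_trans: "ancestor i j \<Longrightarrow> ancestor j k \<Longrightarrow> ancestor i k" by (auto simp: ancestor_def)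

lemma ancestor_less: "ancestor i j \<Longrightarrow> i \<noteq> j \<Longrightarrow> l i < l j"
proof -
  assume a: "ancestor i j" "i \<noteq> j"
  then obtain x where "x \<in> Q j" using activeD(4) by (auto simp: ancestor_def)
  then show ?thesis using a same_level[of i j x] activeD(1) by (force simp: ancestor_def)
qed

lemma ancestor_total: "i \<in> active \<Longrightarrow> j \<in> active \<Longrightarrow> x \<in> Q i \<Longrightarrow> x \<in> Q j \<Longrightarrow> ancestor i j \<or> ancestor j i"
  using nested[of i j x] nested[of j i x] activeD(1) linear[of "l i" "l j"] by (auto simp: ancestor_def)

lemma ancestorI: "i \<in> active \<Longrightarrow> j \<in> active \<Longrightarrow> x \<in> Q i \<Longrightarrow> x \<in> Q j \<Longrightarrow> l i \<le> l j \<Longrightarrow> ancestor i j"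
  using nested[of i j x] activeD(1) by (auto simp: ancestor_def)

lemma finite_ancestor: "finite {i. ancestor i j}"
  by (rule finite_subset[OF _ finite_active]) (auto simp: ancestor_def)

text \<open>Cubes are grouped by the largest \<open>n\<close> among their ancestors; the stopping cubes are those that
  set a new record. This avoids a recursive selection.\<close>

definition record_level :: "'i \<Rightarrow> int" where "record_level j = Max (n ` {i. ancestor i j})"

lemma n_le_record_level: "ancestor i j \<Longrightarrow> n i \<le> record_level j"
  unfolding record_level_def using finite_ancestor by (intro Max_ge) auto

definition stops :: "'i set" where
  "stops = {j\<in>active. \<forall>i. ancestor i j \<and> i \<noteq> j \<longrightarrow> n i < n j}"

lemma stops_subset: "stops \<subseteq> active" and finite_stops: "finite stops"
  using finite_active by (auto simp: stops_def)

lemma stops_less: "j \<in> stops \<Longrightarrow> ancestor i j \<Longrightarrow> i \<noteq> j \<Longrightarrow> n i < n j"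
  by (auto simp: stops_def)

definition block :: "'i \<Rightarrow> 'i set" where "block F = {j. ancestor F j \<and> record_level j = n F}"

lemma block_subset: "block F \<subseteq> \<A>"
  using activeD(1) by (auto simp: block_def ancestor_def)

text \<open>Among the ancestors of \<open>j\<close> with the largest \<open>n\<close>, the coarsest
  is a stopping cube: a still coarser ancestor cannot attain the maximum and so has strictly smaller
  \<open>n\<close>.\<close>

lemma stops_exists:
  assumes "j \<in> active"
  shows "\<exists>F\<in>stops. j \<in> block F"
proof -
  let ?S = "{i. ancestor i j \<and> n i = record_level j}"
  have "record_level j \<in> n ` {i. ancestor i j}"
    unfolding record_level_def using finite_ancestor ancestor_refl[OF assms] by (intro Max_in) auto
  then have "?S \<noteq> {}" by auto
  moreover have "finite ?S" using finite_ancestor by (rule finite_subset[rotated]) auto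
  ultimately obtain F where F: "F \<in> ?S" "\<And>k. k \<in> ?S \<Longrightarrow> l F \<le> l k"
    using ex_is_arg_min_if_finite[of ?S l] unfolding is_arg_min_linorder by blast
  have "n k < n F" if k: "ancestor k F" "k \<noteq> F" for k
  proof -
    have "l k < l F" using ancestor_less k by auto
    moreover have "ancestor k j" using k F ancestor_trans by blast
    ultimately have "n k \<noteq> record_level j" using F(2)[of k] by auto
    then show ?thesis using n_le_record_level[OF \<open>ancestor k j\<close>] F(1) by auto
  qed
  then have "F \<in> stops" using F(1) by (auto simp: stops_def ancestor_def)
  then show ?thesis using F(1) by (auto simp: block_def)
qed

text \<open>The layers of one block integrated in y against \<sigma>, that is, the part of the
  operator belonging to the block, applied to the constant 1.\<close>

definition tau :: "'i \<Rightarrow> 'a \<Rightarrow> ennreal" where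
  "tau F x = (\<Sum>j\<in>block F. indicator (Q j) x * lam j x * ennreal (s j))"

lemma tau_measurable [measurable]: "tau F \<in> borel_measurable \<omega>"
proof -
  have "(\<lambda>x. indicator (Q j) x * lam j x * ennreal (s j)) \<in> borel_measurable \<omega>" if "j \<in> block F" for j
  proof -
    have j: "j \<in> \<A>" using that block_subset by auto
    note [measurable] = Q_omega[OF j] lam_measurable[OF j]
    show ?thesis by measurable
  qed
  then show ?thesis unfolding tau_def[abs_def] by measurable
qed

lemma integral_H:
  assumes x: "x \<in> space \<omega>" and u [measurable]: "u \<in> borel_measurable \<sigma>"
  shows "(\<integral>\<^sup>+y. H x y * u y \<partial>\<sigma>)
       = (\<Sum>i\<in>\<A>. indicator (Q i) x * lam i x * (\<integral>\<^sup>+y. u y * indicator (Q i) y \<partial>\<sigma>))"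
proof -
  note Q_sigma [measurable]
  have "(\<integral>\<^sup>+y. H x y * u y \<partial>\<sigma>)
      = (\<integral>\<^sup>+y. (\<Sum>i\<in>\<A>. indicator (Q i) x * lam i x * (u y * indicator (Q i) y)) \<partial>\<sigma>)"
    by (simp add: H_eq_sum_lam[OF x] sum_distrib_left sum_distrib_right ac_simps)
  also have "\<dots> = (\<Sum>i\<in>\<A>. (\<integral>\<^sup>+y. indicator (Q i) x * lam i x * (u y * indicator (Q i) y) \<partial>\<sigma>))"
    by (intro nn_integral_sum) measurable
  also have "\<dots> = (\<Sum>i\<in>\<A>. indicator (Q i) x * lam i x * (\<integral>\<^sup>+y. u y * indicator (Q i) y \<partial>\<sigma>))"
    by (intro sum.cong refl nn_integral_cmult) measurable
  finally show ?thesis .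
qed

text \<open>On the cubes of one block the averages of f are at most \<theta> times
  \<open>b F\<close>, since none of them exceeds the record set by \<open>F\<close>. So f may be
  replaced there by this constant.\<close>

lemma integral_H_f_le:
  assumes x: "x \<in> space \<omega>"
  shows "(\<integral>\<^sup>+y. H x y * f y \<partial>\<sigma>) \<le> ennreal \<theta> * (\<Sum>F\<in>stops. ennreal (b F) * tau F x)"
proof -
  let ?t = "\<lambda>i. indicator (Q i) x * lam i x"
  have "(\<integral>\<^sup>+y. H x y * f y \<partial>\<sigma>) = (\<Sum>i\<in>\<A>. ?t i * ennreal (Fi i))"
    by (simp add: integral_H[OF x] Fi_ennreal)
  also have "\<dots> = (\<Sum>i\<in>active. ?t i * ennreal (Fi i))"
    using fin Fi_nonneg by (intro sum.mono_neutral_right) (auto simp: active_def less_le)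
  \<comment> \<open>Each active cube is charged to all blocks containing it; for the inequality one
    block is enough.\<close>
  also have "\<dots> \<le> (\<Sum>i\<in>active. \<Sum>F\<in>stops. if i \<in> block F then ennreal \<theta> * (ennreal (b F) * (?t i * ennreal (s i))) else 0)"
  proof (intro sum_mono)
    fix i assume i: "i \<in> active"
    obtain F where F: "F \<in> stops" "i \<in> block F" using stops_exists[OF i] by auto
    have "n i \<le> n F" using F n_le_record_level[OF ancestor_refl[OF i]] by (auto simp: block_def)
    then have "b i \<le> b F" using theta_gt_1 by (simp add: b_def)
    then have "\<theta> * b i * s i \<le> \<theta> * b F * s i"
      using theta_gt_1 by (intro mult_right_mono mult_left_mono) auto
    with le_b[OF i] have "Fi i \<le> \<theta> * b F * s i" by linarith
    then have "ennreal (Fi i) \<le> ennreal \<theta> * ennreal (b F) * ennreal (s i)"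
      using theta_gt_1 b_pos[of F] by (simp add: ennreal_leI flip: ennreal_mult)
    then have "?t i * ennreal (Fi i) \<le> ?t i * (ennreal \<theta> * ennreal (b F) * ennreal (s i))"
      by (rule mult_left_mono) simp
    also have "\<dots> = (if i \<in> block F then ennreal \<theta> * (ennreal (b F) * (?t i * ennreal (s i))) else 0)"
      using F by (simp add: ac_simps)
    also have "\<dots> \<le> (\<Sum>F\<in>stops. if i \<in> block F then ennreal \<theta> * (ennreal (b F) * (?t i * ennreal (s i))) else 0)"
      using F finite_stops by (intro member_le_sum) auto
    finally show "?t i * ennreal (Fi i) \<le>
      (\<Sum>F\<in>stops. if i \<in> block F then ennreal \<theta> * (ennreal (b F) * (?t i * ennreal (s i))) else 0)" .
  qed
  also have "\<dots> = (\<Sum>F\<in>stops. \<Sum>i\<in>active. if i \<in> block F then ennreal \<theta> * (ennreal (b F) * (?t i * ennreal (s i))) else 0)"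
    by (rule sum.swap)
  also have "\<dots> = (\<Sum>F\<in>stops. ennreal \<theta> * (ennreal (b F) * tau F x))"
  proof (intro sum.cong refl)
    fix F
    have "active \<inter> block F = block F" by (auto simp: block_def ancestor_def)
    then show "(\<Sum>i\<in>active. if i \<in> block F then ennreal \<theta> * (ennreal (b F) * (?t i * ennreal (s i))) else 0)
       = ennreal \<theta> * (ennreal (b F) * tau F x)"
      using finite_active by (simp add: tau_def sum_distrib_left flip: sum.inter_restrict)
  qed
  also have "\<dots> = ennreal \<theta> * (\<Sum>F\<in>stops. ennreal (b F) * tau F x)"
    by (simp add: sum_distrib_left)
  finally show ?thesis .
qed

lemma tau_outside: "x \<notin> Q F \<Longrightarrow> tau F x = 0"
  unfolding tau_def by (intro sum.neutral) (auto simp: block_def ancestor_def split: split_indicator)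

text \<open>Every cube of the block lies in \<open>Q F\<close>, so \<open>s j\<close> is the
  integral of the indicator of \<open>Q F\<close> over \<open>Q j\<close>; adding the remaining
  nonnegative layers gives \<open>H\<close> applied to this indicator. This makes the testing
  condition applicable.\<close>

lemma tau_le:
  assumes x: "x \<in> space \<omega>" and F: "F \<in> active"
  shows "tau F x \<le> indicator (Q F) x * (\<integral>\<^sup>+y. H x y * indicator (Q F) y \<partial>\<sigma>)"
proof (cases "x \<in> Q F")
  case False
  then show ?thesis by (simp add: tau_outside)
next
  case True
  note [measurable] = Q_sigma[OF activeD(1)[OF F]]
  have "tau F x \<le> (\<Sum>j\<in>block F. indicator (Q j) x * lam j x * (\<integral>\<^sup>+y. indicator (Q F) y * indicator (Q j) y \<partial>\<sigma>))"
    unfolding tau_def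
  proof (intro sum_mono mult_left_mono)
    fix j assume j: "j \<in> block F"
    then have "j \<in> \<A>" using block_subset by auto
    have "(\<integral>\<^sup>+y. indicator (Q F) y * indicator (Q j) y \<partial>\<sigma>) = (\<integral>\<^sup>+y. indicator (Q j) y \<partial>\<sigma>)"
      using j by (intro nn_integral_cong) (auto simp: block_def ancestor_def split: split_indicator)
    also have "\<dots> = ennreal (s j)"
      using Q_sigma[OF \<open>j \<in> \<A>\<close>] s_ennreal[OF \<open>j \<in> \<A>\<close>] by simp
    finally show "ennreal (s j) \<le> (\<integral>\<^sup>+y. indicator (Q F) y * indicator (Q j) y \<partial>\<sigma>)" by simp
  qed simp
  also have "\<dots> \<le> (\<Sum>j\<in>\<A>. indicator (Q j) x * lam j x * (\<integral>\<^sup>+y. indicator (Q F) y * indicator (Q j) y \<partial>\<sigma>))"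
    using fin block_subset by (intro sum_mono2) auto
  also have "\<dots> = (\<integral>\<^sup>+y. H x y * indicator (Q F) y \<partial>\<sigma>)"
    by (subst integral_H[OF x]) auto
  finally show ?thesis using True by simp
qed

text \<open>Instead of the maximal inequality, \<open>f * m powr (p - 1) \<le> m powr p / 4 + 4 powr (p - 1) * f powr p\<close>
  is used with \<open>m\<close> the largest \<open>b F\<close> at the point: the first summand adds up to half of the left-hand side.\<close>

lemma carleson: "(\<Sum>F\<in>stops. b F powr p * s F) \<le> 4 powr p"
proof -
  let ?A = "\<Sum>F\<in>stops. b F powr p * s F"
  have meas: "F \<in> stops \<Longrightarrow> Q F \<in> sets \<sigma>" for F
    using stops_subset active_subset Q_sigma by blast
  note [measurable] = meas
  have A_nonneg: "0 \<le> ?A" by (intro sum_nonneg) auto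
  have point: "(\<Sum>F\<in>stops. ennreal (b F powr (p - 1)) * (f y * indicator (Q F) y))
      \<le> (\<Sum>F\<in>stops. ennreal (1/2 * b F powr p) * indicator (Q F) y) + ennreal (2 * 4 powr (p - 1)) * epowr (f y) p" for y
  proof (cases "f y")
    case top
    then show ?thesis by (simp add: ennreal_mult_top)
  next
    case (real u)
    let ?J = "{F\<in>stops. y \<in> Q F}"
    have fJ: "finite ?J" using finite_stops by auto
    show ?thesis
    proof (cases "?J = {}")
      case True
      then have "(\<Sum>F\<in>stops. ennreal (b F powr (p - 1)) * (f y * indicator (Q F) y)) = 0"
        by (intro sum.neutral) auto
      then show ?thesis by simp
    next
      case False
      then obtain F0 where F0: "F0 \<in> ?J" "\<And>F. F \<in> ?J \<Longrightarrow> n F \<le> n F0"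
        using ex_is_arg_min_if_finite[OF fJ, of "\<lambda>F. - n F"] unfolding is_arg_min_linorder by auto
      \<comment> \<open>The stopping cubes containing y form a chain, along which \<open>n\<close>
        strictly increases; hence their powers of two are distinct.\<close>
      have inj: "inj_on n ?J"
      proof (intro inj_onI)
        fix F1 F2 assume "F1 \<in> ?J" "F2 \<in> ?J" "n F1 = n F2"
        then show "F1 = F2"
          using ancestor_total[of F1 F2 y] stops_less[of F1 F2] stops_less[of F2 F1] stops_subset by auto
      qed
      have "(\<Sum>F\<in>stops. ennreal (b F powr (p - 1)) * (f y * indicator (Q F) y))
          = (\<Sum>F\<in>?J. ennreal (b F powr (p - 1)) * f y)"
        using finite_stops by (intro sum.mono_neutral_cong_right) (auto split: split_indicator)
      also have "\<dots> = ennreal (u * (\<Sum>F\<in>?J. 2 powr real_of_int (n F)))"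
      proof -
        have "ennreal (b F powr (p - 1)) * f y = ennreal (u * 2 powr real_of_int (n F))" for F
          unfolding b_powr using real by (simp add: mult.commute flip: ennreal_mult)
        then show ?thesis
          using real by (simp add: sum_distrib_left)
      qed
      also have "\<dots> \<le> ennreal (u * (2 * b F0 powr (p - 1)))"
        unfolding b_powr using real sum_powers_of_two_le[OF fJ inj F0(2)]
        by (intro ennreal_leI mult_left_mono) auto
      also have "\<dots> \<le> ennreal (2 * ((1/4) * b F0 powr p + 4 powr (p - 1) * u powr p))"
        using mult_le_cut[OF p_gt_1, of u "b F0"] b_pos real by (intro ennreal_leI) auto
      also have "\<dots> = ennreal (1/2 * b F0 powr p) * indicator (Q F0) y + ennreal (2 * 4 powr (p - 1)) * epowr (f y) p"
        using real F0 by (simp add: epowr_ennreal flip: ennreal_mult ennreal_plus)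
      also have "\<dots> \<le> (\<Sum>F\<in>stops. ennreal (1/2 * b F powr p) * indicator (Q F) y) + ennreal (2 * 4 powr (p - 1)) * epowr (f y) p"
        using F0 finite_stops by (intro add_mono member_le_sum) auto
      finally show ?thesis .
    qed
  qed
  have "ennreal ?A = (\<Sum>F\<in>stops. ennreal (b F powr p * s F))"
    by (subst sum_ennreal) auto
  also have "\<dots> \<le> (\<Sum>F\<in>stops. ennreal (b F powr (p - 1)) * (\<integral>\<^sup>+y. f y * indicator (Q F) y \<partial>\<sigma>))"
  proof (intro sum_mono)
    fix F assume F: "F \<in> stops"
    then have FA: "F \<in> active" "F \<in> \<A>" using stops_subset active_subset by auto
    have "b F powr p * s F = b F powr (p - 1) * (b F * s F)"
    proof -
      have e: "b F powr p = b F * b F powr (p - 1)"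
        using powr_mult_base[of "b F" "p - 1"] b_pos[of F] by simp
      show ?thesis by (simp only: e ac_simps)
    qed
    also have "\<dots> \<le> b F powr (p - 1) * Fi F"
      using b_le[OF FA(1)] by (intro mult_left_mono) auto
    finally show "ennreal (b F powr p * s F) \<le> ennreal (b F powr (p - 1)) * (\<integral>\<^sup>+y. f y * indicator (Q F) y \<partial>\<sigma>)"
      using Fi_nonneg by (simp add: Fi_ennreal[OF FA(2)] ennreal_leI flip: ennreal_mult)
  qed
  also have "\<dots> = (\<integral>\<^sup>+y. (\<Sum>F\<in>stops. ennreal (b F powr (p - 1)) * (f y * indicator (Q F) y)) \<partial>\<sigma>)"
    by (subst nn_integral_sum) (auto intro!: sum.cong nn_integral_cmult[symmetric])
  also have "\<dots> \<le> (\<integral>\<^sup>+y. (\<Sum>F\<in>stops. ennreal (1/2 * b F powr p) * indicator (Q F) y)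
      + ennreal (2 * 4 powr (p - 1)) * epowr (f y) p \<partial>\<sigma>)"
    using point by (intro nn_integral_mono) auto
  also have "\<dots> = (\<Sum>F\<in>stops. ennreal (1/2 * b F powr p) * emeasure \<sigma> (Q F))
      + ennreal (2 * 4 powr (p - 1)) * (\<integral>\<^sup>+y. epowr (f y) p \<partial>\<sigma>)"
    by (subst nn_integral_add) (auto simp: nn_integral_sum nn_integral_cmult nn_integral_cmult_indicator)
  also have "(\<Sum>F\<in>stops. ennreal (1/2 * b F powr p) * emeasure \<sigma> (Q F)) = (\<Sum>F\<in>stops. ennreal (1/2 * (b F powr p * s F)))"
    using stops_subset active_subset
    by (intro sum.cong refl) (auto simp: s_ennreal subset_iff mult.assoc simp flip: ennreal_mult)
  also have "\<dots> = ennreal (1/2 * ?A)"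
    by (subst sum_ennreal) (auto simp: sum_distrib_left)
  also have "ennreal (1/2 * ?A) + ennreal (2 * 4 powr (p - 1)) * (\<integral>\<^sup>+y. epowr (f y) p \<partial>\<sigma>)
      \<le> ennreal (1/2 * ?A) + ennreal (2 * 4 powr (p - 1)) * 1"
    using f_norm by (intro add_left_mono mult_left_mono) auto
  also have "\<dots> = ennreal (1/2 * ?A + 2 * 4 powr (p - 1))"
    using A_nonneg by (simp flip: ennreal_plus)
  \<comment> \<open>Half of the sum can be absorbed because there are finitely many stopping cubes,
    so \<open>?A\<close> is a real number. What remains is 4 * 4^(p-1).\<close>
  finally have "?A \<le> 1/2 * ?A + 2 * 4 powr (p - 1)"
    using A_nonneg by (subst (asm) ennreal_le_iff) auto
  moreover have "4 * 4 powr (p - 1) = 4 powr p" by (simp add: powr_diff)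
  ultimately show ?thesis by linarith
qed

section \<open>Children of stopping cubes and the estimate of one block\<close>

definition child :: "'i \<Rightarrow> 'i \<Rightarrow> bool" where
  "child F F' \<longleftrightarrow> F \<in> stops \<and> F' \<in> stops \<and> ancestor F F' \<and> F \<noteq> F' \<and>
     (\<forall>k\<in>stops. ancestor k F' \<and> k \<noteq> F' \<longrightarrow> l k \<le> l F)"

definition children :: "'i \<Rightarrow> 'i set" where "children F = {F'. child F F'}"

definition residual :: "'i \<Rightarrow> 'a set" where "residual F = Q F - (\<Union>F'\<in>children F. Q F')"

lemma children_subset: "children F \<subseteq> stops" and finite_children: "finite (children F)"
proof -
  show "children F \<subseteq> stops" by (auto simp: children_def child_def)
  then show "finite (children F)" using finite_stops finite_subset by blast
qed

lemma stopsD: "F \<in> stops \<Longrightarrow> F \<in> active" "F \<in> stops \<Longrightarrow> F \<in> \<A>" "F \<in> stops \<Longrightarrow> Q F \<in> sets \<omega>" "F \<in> stops \<Longrightarrow> Q F \<in> sets \<sigma>"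
  using stops_subset active_subset Q_omega Q_sigma by blast+

lemma children_subset_Q: "F' \<in> children F \<Longrightarrow> Q F' \<subseteq> Q F"
  by (auto simp: children_def child_def ancestor_def)

lemma child_unique: "child F1 F' \<Longrightarrow> child F2 F' \<Longrightarrow> F1 = F2"
proof -
  assume c: "child F1 F'" "child F2 F'"
  then have "l F1 = l F2" by (auto simp: child_def intro!: antisym)
  moreover obtain x where "x \<in> Q F'" using c(1) activeD(4)[of F'] by (auto simp: child_def ancestor_def)
  ultimately show ?thesis
    using c same_level[of F1 F2 x] activeD(1) by (auto simp: child_def ancestor_def)
qed

lemma children_disjoint: "F1 \<in> children F \<Longrightarrow> F2 \<in> children F \<Longrightarrow> x \<in> Q F1 \<Longrightarrow> x \<in> Q F2 \<Longrightarrow> F1 = F2"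
proof (rule ccontr)
  assume c: "F1 \<in> children F" "F2 \<in> children F" "x \<in> Q F1" "x \<in> Q F2" "F1 \<noteq> F2"
  have F: "F1 \<in> active" "F2 \<in> active" using c children_subset stops_subset by auto
  have False if "G1 \<in> children F" "G2 \<in> children F" "G1 \<noteq> G2" "ancestor G1 G2" for G1 G2
  proof -
    have "l F < l G1" using that(1) ancestor_less by (auto simp: children_def child_def)
    moreover have "l G1 \<le> l F" using that by (auto simp: children_def child_def)
    ultimately show False by simp
  qed
  then show False using ancestor_total[OF F c(3,4)] c by metis
qed

text \<open>If a stopping cube \<open>G2\<close> below \<open>G1\<close> also contains x, the
  coarsest stopping cube strictly below \<open>G1\<close> that contains x is a child of
  \<open>G1\<close>, which excludes x from the residual of \<open>G1\<close>.\<close>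

lemma residual_disjoint: "F1 \<in> stops \<Longrightarrow> F2 \<in> stops \<Longrightarrow> x \<in> residual F1 \<Longrightarrow> x \<in> residual F2 \<Longrightarrow> F1 = F2"
proof (rule ccontr)
  assume c: "F1 \<in> stops" "F2 \<in> stops" "x \<in> residual F1" "x \<in> residual F2" "F1 \<noteq> F2"
  have False if "G1 \<in> stops" "G2 \<in> stops" "G1 \<noteq> G2" "x \<in> residual G1" "x \<in> residual G2" "ancestor G1 G2" for G1 G2
  proof -
    let ?S = "{k\<in>stops. ancestor G1 k \<and> k \<noteq> G1 \<and> x \<in> Q k}"
    have "G2 \<in> ?S" using that by (auto simp: residual_def)
    moreover have "finite ?S" using finite_stops by auto
    ultimately obtain k where k: "k \<in> ?S" "\<And>j. j \<in> ?S \<Longrightarrow> l k \<le> l j"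
      using ex_is_arg_min_if_finite[of ?S l] unfolding is_arg_min_linorder by blast
    have "l j \<le> l G1" if j: "j \<in> stops" "ancestor j k" "j \<noteq> k" for j
    proof (rule ccontr)
      assume "\<not> l j \<le> l G1"
      moreover have "x \<in> Q j" using j k(1) by (auto simp: ancestor_def)
      moreover have "x \<in> Q G1" using \<open>x \<in> residual G1\<close> by (auto simp: residual_def)
      ultimately have "j \<in> ?S" using j \<open>G1 \<in> stops\<close> stopsD(1) ancestorI[of G1 j x] by auto
      then show False using k(2)[of j] ancestor_less[OF j(2,3)] by simp
    qed
    then have "child G1 k" using k(1) \<open>G1 \<in> stops\<close> by (auto simp: child_def)
    then show False using k(1) \<open>x \<in> residual G1\<close> by (auto simp: residual_def children_def)
  qed
  then show False using ancestor_total[of F1 F2 x] stopsD(1) c by (metis DiffD1 residual_def)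
qed

text \<open>A cube of the block of \<open>F\<close> that meets the child \<open>F'\<close> must be
  strictly coarser than \<open>F'\<close>: otherwise \<open>F'\<close> would be its ancestor, and
  the larger \<open>n F'\<close> would exceed the record level of the block. Thus each layer of
  \<open>tau F\<close> is constant on \<open>Q F'\<close> by \<open>lam_const\<close>.\<close>

lemma tau_const:
  assumes "child F F'" "x \<in> Q F'" "y \<in> Q F'"
  shows "tau F x = tau F y"
  unfolding tau_def
proof (intro sum.cong refl)
  fix j assume j: "j \<in> block F"
  have F: "F' \<in> active" "F' \<in> \<A>" "j \<in> active" "j \<in> \<A>" using assms j stopsD activeD by (auto simp: child_def block_def ancestor_def)
  show "indicator (Q j) x * lam j x * ennreal (s j) = indicator (Q j) y * lam j y * ennreal (s j)"
  proof (cases "Q j \<inter> Q F' = {}")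
    case True
    then show ?thesis using assms by (auto split: split_indicator)
  next
    case False
    then obtain u where u: "u \<in> Q j" "u \<in> Q F'" by auto
    have "l j < l F'"
    proof (rule ccontr)
      assume "\<not> l j < l F'"
      then have "ancestor F' j" using ancestorI[OF F(1,3) u(2,1)] by auto
      then have "n F' \<le> n F" using n_le_record_level[of F' j] j by (simp add: block_def)
      moreover have "n F < n F'" using assms stops_less by (auto simp: child_def)
      ultimately show False by simp
    qed
    then have "Q F' \<subseteq> Q j" using nested[of j F' u] F u by auto
    then have "x \<in> Q j" "y \<in> Q j" using assms by auto
    then show ?thesis using lam_const[OF F(4,2) \<open>l j < l F'\<close> assms(2,3)] by simp
  qed
qed

text \<open>On \<open>Q F'\<close> the first factor is a constant, so g may be replaced by its mean.
  Young's inequality applied to these two numbers, times the measure of \<open>Q F'\<close>, leaves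
  the mean of g instead of its q'-th power integral.\<close>

lemma child_term:
  assumes c: "child F F'"
  shows "(\<integral>\<^sup>+x. ennreal (b F) * tau F x * g x * indicator (Q F') x \<partial>\<omega>)
     \<le> (\<integral>\<^sup>+x. epowr (ennreal (b F) * tau F x) q * indicator (Q F') x \<partial>\<omega>)
       + ennreal ((Gi F' / w F') powr q' * w F')"
proof -
  have F': "F' \<in> \<A>" "F' \<in> stops" "Q F' \<noteq> {}" using c stopsD activeD by (auto simp: child_def)
  note [measurable] = stopsD(3)[OF F'(2)]
  obtain x0 where x0: "x0 \<in> Q F'" using F' by auto
  define c where "c = ennreal (b F) * tau F x0"
  have eq: "x \<in> Q F' \<Longrightarrow> ennreal (b F) * tau F x = c" for x
    using tau_const[OF assms _ x0] by (simp add: c_def)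
  have "(\<integral>\<^sup>+x. ennreal (b F) * tau F x * g x * indicator (Q F') x \<partial>\<omega>)
      = (\<integral>\<^sup>+x. c * (g x * indicator (Q F') x) \<partial>\<omega>)"
    by (intro nn_integral_cong) (auto simp: eq split: split_indicator)
  also have "\<dots> = c * ennreal (Gi F')"
    by (simp add: nn_integral_cmult Gi_ennreal[OF F'(1)])
  also have "\<dots> = c * ennreal (Gi F' / w F') * ennreal (w F')"
  proof (cases "w F' = 0")
    case True
    then show ?thesis using Gi_0[OF F'(1)] by simp
  next
    case False
    then have "ennreal (Gi F') = ennreal (Gi F' / w F') * ennreal (w F')"
      using Gi_nonneg by (simp flip: ennreal_mult)
    then show ?thesis by (simp add: mult.assoc)
  qed
  also have "\<dots> \<le> (epowr c q + epowr (ennreal (Gi F' / w F')) q') * ennreal (w F')"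
    using young_ennreal[OF q_gt_1 conj] by (intro mult_right_mono) auto
  also have "\<dots> = epowr c q * ennreal (w F') + ennreal ((Gi F' / w F') powr q' * w F')"
    using Gi_nonneg by (simp add: distrib_right epowr_ennreal ennreal_mult)
  also have "epowr c q * ennreal (w F') = (\<integral>\<^sup>+x. epowr c q * indicator (Q F') x \<partial>\<omega>)"
    by (simp add: nn_integral_cmult_indicator w_ennreal[OF F'(1)])
  also have "\<dots> = (\<integral>\<^sup>+x. epowr (ennreal (b F) * tau F x) q * indicator (Q F') x \<partial>\<omega>)"
    by (intro nn_integral_cong) (auto simp: eq split: split_indicator)
  finally show ?thesis .
qed

lemma residual_measurable [measurable]: "F \<in> stops \<Longrightarrow> residual F \<in> sets \<omega>"
  unfolding residual_def using finite_children children_subset stopsD(3) by (intro sets.Diff sets.finite_UN) auto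

lemma indicator_split:
  "indicator (Q F) x = (indicator (residual F) x + (\<Sum>F'\<in>children F. indicator (Q F') x) :: ennreal)"
proof (cases "x \<in> (\<Union>F'\<in>children F. Q F')")
  case True
  then obtain F0 where F0: "F0 \<in> children F" "x \<in> Q F0" by auto
  have "(\<Sum>F'\<in>children F. indicator (Q F') x) = (\<Sum>F'\<in>children F. if F' = F0 then 1 else (0::ennreal))"
  proof (intro sum.cong refl)
    fix F' assume "F' \<in> children F"
    then show "indicator (Q F') x = (if F' = F0 then 1 else (0::ennreal))"
      using children_disjoint[of F' F F0 x] F0 by (cases "x \<in> Q F'") auto
  qed
  moreover have "x \<in> Q F" "x \<notin> residual F" using F0 children_subset_Q[OF F0(1)] by (auto simp: residual_def)
  ultimately show ?thesis using F0 finite_children by simp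
next
  case False
  then have "(\<Sum>F'\<in>children F. indicator (Q F') x) = (0::ennreal)"
    by (intro sum.neutral) auto
  then show ?thesis using False by (auto simp: residual_def split: split_indicator)
qed

text \<open>Young's inequality on all of \<open>Q F\<close> would count the integral of g^q' once
  for every stopping cube around a point. It is used pointwise only on the residuals, which are
  disjoint; the children contribute means of g.\<close>

lemma stopping_term:
  assumes F: "F \<in> stops"
  shows "(\<integral>\<^sup>+x. ennreal (b F) * tau F x * g x \<partial>\<omega>)
     \<le> (\<integral>\<^sup>+x. epowr (ennreal (b F) * tau F x) q \<partial>\<omega>) + (\<integral>\<^sup>+x. epowr (g x) q' * indicator (residual F) x \<partial>\<omega>)
       + (\<Sum>F'\<in>children F. ennreal ((Gi F' / w F') powr q' * w F'))"
proof -
  note [measurable] = residual_measurable[OF F] stopsD(3)[OF F]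
  have mchildren [measurable]: "F' \<in> children F \<Longrightarrow> Q F' \<in> sets \<omega>" for F' using children_subset stopsD(3) by auto
  have split: "(\<integral>\<^sup>+x. u x * indicator (Q F) x \<partial>\<omega>)
      = (\<integral>\<^sup>+x. u x * indicator (residual F) x \<partial>\<omega>) + (\<Sum>F'\<in>children F. (\<integral>\<^sup>+x. u x * indicator (Q F') x \<partial>\<omega>))"
    if [measurable]: "u \<in> borel_measurable \<omega>" for u :: "'a \<Rightarrow> ennreal"
    unfolding indicator_split[of F] distrib_left sum_distrib_left
    by (subst nn_integral_add) (auto simp: nn_integral_sum)
  let ?t = "\<lambda>x. ennreal (b F) * tau F x"
  have "(\<integral>\<^sup>+x. ?t x * g x \<partial>\<omega>) = (\<integral>\<^sup>+x. ?t x * g x * indicator (Q F) x \<partial>\<omega>)"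
    by (intro nn_integral_cong) (auto simp: tau_outside split: split_indicator)
  also have "\<dots> = (\<integral>\<^sup>+x. ?t x * g x * indicator (residual F) x \<partial>\<omega>) + (\<Sum>F'\<in>children F. (\<integral>\<^sup>+x. ?t x * g x * indicator (Q F') x \<partial>\<omega>))"
    by (rule split) measurable
  also have "\<dots> \<le> ((\<integral>\<^sup>+x. epowr (?t x) q * indicator (residual F) x \<partial>\<omega>) + (\<integral>\<^sup>+x. epowr (g x) q' * indicator (residual F) x \<partial>\<omega>))
     + (\<Sum>F'\<in>children F. (\<integral>\<^sup>+x. epowr (?t x) q * indicator (Q F') x \<partial>\<omega>)
       + ennreal ((Gi F' / w F') powr q' * w F'))"
  proof (intro add_mono sum_mono child_term)
    have "(\<integral>\<^sup>+x. ?t x * g x * indicator (residual F) x \<partial>\<omega>)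
        \<le> (\<integral>\<^sup>+x. epowr (?t x) q * indicator (residual F) x + epowr (g x) q' * indicator (residual F) x \<partial>\<omega>)"
      using young_ennreal[OF q_gt_1 conj]
      by (intro nn_integral_mono) (auto split: split_indicator)
    then show "(\<integral>\<^sup>+x. ?t x * g x * indicator (residual F) x \<partial>\<omega>) \<le>
        (\<integral>\<^sup>+x. epowr (?t x) q * indicator (residual F) x \<partial>\<omega>) + (\<integral>\<^sup>+x. epowr (g x) q' * indicator (residual F) x \<partial>\<omega>)"
      by (subst (asm) nn_integral_add) auto
  qed (auto simp: children_def)
  also have "\<dots> = (\<integral>\<^sup>+x. epowr (?t x) q * indicator (Q F) x \<partial>\<omega>) + (\<integral>\<^sup>+x. epowr (g x) q' * indicator (residual F) x \<partial>\<omega>)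
       + (\<Sum>F'\<in>children F. ennreal ((Gi F' / w F') powr q' * w F'))"
    by (subst split) (auto simp: sum.distrib ac_simps)
  also have "(\<integral>\<^sup>+x. epowr (?t x) q * indicator (Q F) x \<partial>\<omega>) = (\<integral>\<^sup>+x. epowr (?t x) q \<partial>\<omega>)"
    by (intro nn_integral_cong) (auto simp: tau_outside split: split_indicator)
  finally show ?thesis .
qed

text \<open>Under the hypothesis \<open>dominated\<close>, the averages of \<open>g\<close> over the children of a stopping cube, by which
  \<open>g\<close> may be replaced there since \<open>tau F\<close> is constant on them, are paid for by the Carleson sum of \<open>f\<close>.\<close>

lemma form_bound:
  assumes testing: "\<And>i. i \<in> \<A> \<Longrightarrow>
      (\<integral>\<^sup>+x. epowr (indicator (Q i) x * (\<integral>\<^sup>+y. H x y * indicator (Q i) y \<partial>\<sigma>)) q \<partial>\<omega>)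
        \<le> epowr (emeasure \<sigma> (Q i)) (q / p)"
    and dominated: "\<And>i. i \<in> \<A> \<Longrightarrow> (Gi i / w i) powr q' * w i \<le> (Fi i / s i) powr p * s i"
  shows "(\<integral>\<^sup>+x. (\<integral>\<^sup>+y. H x y * f y \<partial>\<sigma>) * g x \<partial>\<omega>) \<le> ennreal (\<theta> * (4 powr q + 1 + \<theta> powr p * 4 powr p))"
proof -
  let ?c = "\<lambda>F. b F powr p * s F"
  have c_nonneg: "0 \<le> ?c F" for F by auto
  have c_le: "?c F \<le> 4 powr p" if "F \<in> stops" for F
  proof -
    have "?c F \<le> (\<Sum>F\<in>stops. ?c F)"
      using that finite_stops by (intro member_le_sum[of F]) auto
    then show ?thesis using carleson by linarith
  qed
  have test: "(\<integral>\<^sup>+x. epowr (ennreal (b F) * tau F x) q \<partial>\<omega>) \<le> ennreal (?c F * 4 powr (q - p))" if F: "F \<in> stops" for F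
  proof -
    have "(\<integral>\<^sup>+x. epowr (ennreal (b F) * tau F x) q \<partial>\<omega>)
       \<le> (\<integral>\<^sup>+x. epowr (ennreal (b F)) q * epowr (indicator (Q F) x * (\<integral>\<^sup>+y. H x y * indicator (Q F) y \<partial>\<sigma>)) q \<partial>\<omega>)"
      unfolding epowr_mult[symmetric] using tau_le[OF _ stopsD(1)[OF F]] q_gt_1
      by (intro nn_integral_mono epowr_mono mult_left_mono) auto
    also have "\<dots> = epowr (ennreal (b F)) q *
         (\<integral>\<^sup>+x. epowr (indicator (Q F) x * (\<integral>\<^sup>+y. H x y * indicator (Q F) y \<partial>\<sigma>)) q \<partial>\<omega>)"
    proof (rule nn_integral_cmult)
      have [measurable]: "\<And>i. i \<in> \<A> \<Longrightarrow> Q i \<in> sets \<omega>" "Q F \<in> sets \<omega>" "Q F \<in> sets \<sigma>"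
        using Q_omega stopsD F by auto
      have "(\<lambda>x. epowr (indicator (Q F) x * (\<Sum>i\<in>\<A>. indicator (Q i) x * lam i x *
           (\<integral>\<^sup>+y. indicator (Q F) y * indicator (Q i) y \<partial>\<sigma>))) q) \<in> borel_measurable \<omega>"
        by measurable
      then show "(\<lambda>x. epowr (indicator (Q F) x * (\<integral>\<^sup>+y. H x y * indicator (Q F) y \<partial>\<sigma>)) q) \<in> borel_measurable \<omega>"
        by (rule measurable_cong[THEN iffD1, rotated]) (simp add: integral_H)
    qed
    also have "\<dots> \<le> epowr (ennreal (b F)) q * epowr (emeasure \<sigma> (Q F)) (q / p)"
      using testing[OF stopsD(2)[OF F]] by (intro mult_left_mono) auto
    also have "\<dots> = ennreal (b F powr q * s F powr (q / p))"
      using b_pos[of F] by (simp add: s_ennreal[OF stopsD(2)[OF F]] epowr_ennreal ennreal_mult)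
    also have "b F powr q * s F powr (q / p) = ?c F powr (q / p)"
      using p_gt_1 by (simp add: powr_mult powr_powr)
    \<comment> \<open>Testing yields the power q / p of \<open>?c F\<close>. Since q / p \<ge> 1,
      the surplus power is bounded by means of \<open>?c F\<close> \<le> 4^p, and one factor
      \<open>?c F\<close> remains to be summed by \<open>carleson\<close>.\<close>
    also have "?c F powr (q / p) = ?c F * ?c F powr (q / p - 1)"
      using powr_mult_base[OF c_nonneg[of F], of "q / p - 1"] by simp
    also have "ennreal \<dots> \<le> ennreal (?c F * (4 powr p) powr (q / p - 1))"
      using c_le[OF F] p_gt_1 p_le_q by (intro ennreal_leI mult_left_mono powr_mono2) auto
    also have "(4 powr p) powr (q / p - 1) = 4 powr (q - p)"
      using p_gt_1 by (simp add: powr_powr algebra_simps)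
    finally show ?thesis .
  qed
  \<comment> \<open>The hypothesis \<open>dominated\<close> trades the mean of g for that of f,
    which on a stopping cube is at most \<theta> times \<open>b F\<close>.\<close>
  have gi: "ennreal ((Gi F / w F) powr q' * w F) \<le> ennreal (\<theta> powr p * ?c F)" if F: "F \<in> stops" for F
  proof -
    note pos = activeD[OF stopsD(1)[OF F]]
    have "(Fi F / s F) powr p * s F \<le> (\<theta> * b F) powr p * s F"
      using le_b[OF stopsD(1)[OF F]] pos p_gt_1
      by (intro mult_right_mono powr_mono2) (auto simp: pos_divide_le_eq)
    also have "\<dots> = \<theta> powr p * ?c F"
      using theta_gt_1 b_pos[of F] by (simp add: powr_mult)
    finally show ?thesis using dominated[OF stopsD(2)[OF F]] by (intro ennreal_leI) linarith
  qed
  have "(\<integral>\<^sup>+x. (\<integral>\<^sup>+y. H x y * f y \<partial>\<sigma>) * g x \<partial>\<omega>)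
     \<le> (\<integral>\<^sup>+x. (ennreal \<theta> * (\<Sum>F\<in>stops. ennreal (b F) * tau F x)) * g x \<partial>\<omega>)"
    using integral_H_f_le by (intro nn_integral_mono mult_right_mono) auto
  also have "\<dots> = (\<integral>\<^sup>+x. ennreal \<theta> * (\<Sum>F\<in>stops. ennreal (b F) * tau F x * g x) \<partial>\<omega>)"
    by (simp add: sum_distrib_right mult.assoc)
  also have "\<dots> = ennreal \<theta> * (\<Sum>F\<in>stops. (\<integral>\<^sup>+x. ennreal (b F) * tau F x * g x \<partial>\<omega>))"
    by (simp add: nn_integral_cmult nn_integral_sum)
  also have "\<dots> \<le> ennreal \<theta> * (\<Sum>F\<in>stops. ennreal (?c F * 4 powr (q - p))
       + (\<integral>\<^sup>+x. epowr (g x) q' * indicator (residual F) x \<partial>\<omega>)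
       + (\<Sum>F'\<in>children F. ennreal (\<theta> powr p * ?c F')))"
    using test gi children_subset
    by (intro mult_left_mono sum_mono order.trans[OF stopping_term] add_mono) auto
  also have "\<dots> = ennreal \<theta> * (ennreal (4 powr (q - p)) * (\<Sum>F\<in>stops. ennreal (?c F))
       + (\<Sum>F\<in>stops. (\<integral>\<^sup>+x. epowr (g x) q' * indicator (residual F) x \<partial>\<omega>))
       + (\<Sum>F\<in>stops. \<Sum>F'\<in>children F. ennreal (\<theta> powr p * ?c F')))"
  proof -
    have "(\<Sum>F\<in>stops. ennreal (?c F * 4 powr (q - p))) = ennreal (4 powr (q - p)) * (\<Sum>F\<in>stops. ennreal (?c F))"
      by (subst sum_distrib_left, intro sum.cong refl, subst mult.commute, rule ennreal_mult) auto
    then show ?thesis by (simp only: sum.distrib)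
  qed
  also have "\<dots> \<le> ennreal \<theta> * (ennreal (4 powr (q - p)) * ennreal (4 powr p) + 1 + ennreal (\<theta> powr p * 4 powr p))"
  proof (intro mult_left_mono add_mono)
    have S: "(\<Sum>F\<in>stops. ennreal (?c F)) \<le> ennreal (4 powr p)"
      using carleson by (subst sum_ennreal) (auto intro: ennreal_leI)
    then show "(\<Sum>F\<in>stops. ennreal (?c F)) \<le> ennreal (4 powr p)" .
    have "(\<Sum>F\<in>stops. (\<integral>\<^sup>+x. epowr (g x) q' * indicator (residual F) x \<partial>\<omega>))
       = (\<integral>\<^sup>+x. (\<Sum>F\<in>stops. epowr (g x) q' * indicator (residual F) x) \<partial>\<omega>)"
      by (subst nn_integral_sum) auto
    also have "\<dots> \<le> (\<integral>\<^sup>+x. epowr (g x) q' \<partial>\<omega>)"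
    proof (intro nn_integral_mono)
      fix x
      show "(\<Sum>F\<in>stops. epowr (g x) q' * indicator (residual F) x) \<le> epowr (g x) q'"
      proof (cases "\<exists>F0\<in>stops. x \<in> residual F0")
        case True
        then obtain F0 where F0: "F0 \<in> stops" "x \<in> residual F0" by auto
        have "(\<Sum>F\<in>stops. epowr (g x) q' * indicator (residual F) x) = (\<Sum>F\<in>stops. if F = F0 then epowr (g x) q' else 0)"
        proof (intro sum.cong refl)
          fix F assume "F \<in> stops"
          then show "epowr (g x) q' * indicator (residual F) x = (if F = F0 then epowr (g x) q' else 0)"
            using residual_disjoint[of F F0 x] F0 by (cases "x \<in> residual F") auto
        qed
        then show ?thesis using F0 finite_stops by simp
      next
        case False
        then have "(\<Sum>F\<in>stops. epowr (g x) q' * indicator (residual F) x) = 0"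
          by (intro sum.neutral) auto
        then show ?thesis by simp
      qed
    qed
    also have "\<dots> \<le> 1" by (rule g_norm)
    finally show "(\<Sum>F\<in>stops. (\<integral>\<^sup>+x. epowr (g x) q' * indicator (residual F) x \<partial>\<omega>)) \<le> 1" .
    \<comment> \<open>Every stopping cube has at most one parent, so the double sum runs over
      distinct cubes.\<close>
    have "(\<Sum>F\<in>stops. \<Sum>F'\<in>children F. ennreal (\<theta> powr p * ?c F')) = (\<Sum>F'\<in>(\<Union>F\<in>stops. children F). ennreal (\<theta> powr p * ?c F'))"
      using finite_stops finite_children child_unique
      by (intro sum.UNION_disjoint[symmetric]) (auto simp: children_def)
    also have "\<dots> \<le> (\<Sum>F\<in>stops. ennreal (\<theta> powr p * ?c F))"
      using finite_stops children_subset by (intro sum_mono2) auto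
    also have "\<dots> = ennreal (\<theta> powr p) * (\<Sum>F\<in>stops. ennreal (?c F))"
      by (subst sum_distrib_left, intro sum.cong refl, rule ennreal_mult) auto
    also have "\<dots> \<le> ennreal (\<theta> powr p * 4 powr p)"
      using S by (simp add: ennreal_mult mult_left_mono)
    finally show "(\<Sum>F\<in>stops. \<Sum>F'\<in>children F. ennreal (\<theta> powr p * ?c F')) \<le> ennreal (\<theta> powr p * 4 powr p)" .
  qed auto
  also have "ennreal (4 powr (q - p)) * ennreal (4 powr p) = ennreal (4 powr q)"
    by (simp add: powr_add[symmetric] flip: ennreal_mult)
  also have "ennreal \<theta> * (ennreal (4 powr q) + 1 + ennreal (\<theta> powr p * 4 powr p))
      = ennreal (\<theta> * (4 powr q + 1 + \<theta> powr p * 4 powr p))"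
  proof -
    let ?Y = "\<theta> powr p * 4 powr p"
    have "ennreal (\<theta> * (4 powr q + 1 + ?Y)) = ennreal \<theta> * ennreal (4 powr q + 1 + ?Y)"
      using theta_gt_1 by (intro ennreal_mult) auto
    also have "ennreal (4 powr q + 1 + ?Y) = ennreal (4 powr q + 1) + ennreal ?Y"
      by (rule ennreal_plus) auto
    also have "ennreal (4 powr q + 1) = ennreal (4 powr q) + 1"
      by simp
    finally show ?thesis ..
  qed
  finally show ?thesis .
qed

end

section \<open>Duality and atoms\<close>

lemma ennreal_mult_inverse: "x \<noteq> 0 \<Longrightarrow> x \<noteq> top \<Longrightarrow> x * inverse x = (1::ennreal)"
  by (simp add: ennreal_divide_self divide_ennreal_def[symmetric] less_top)

lemma Lp_norm_cong:
  "(\<And>x. x \<in> space \<mu> \<Longrightarrow> f x = g x) \<Longrightarrow> Lp_norm p \<mu> f = Lp_norm p \<mu> g"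
  unfolding Lp_norm_def by (metis (mono_tags, lifting) nn_integral_cong)

lemma Lp_norm_le_iff:
  assumes "0 < p"
  shows "Lp_norm p \<mu> f \<le> c \<longleftrightarrow> (\<integral>\<^sup>+x. epowr (f x) p \<partial>\<mu>) \<le> epowr c p"
  using assms epowr_le_iff[of "1/p" "\<integral>\<^sup>+x. epowr (f x) p \<partial>\<mu>" c] by (simp add: Lp_norm_def)

lemma Lp_norm_mono:
  "0 < p \<Longrightarrow> (\<And>x. x \<in> space \<mu> \<Longrightarrow> f x \<le> g x) \<Longrightarrow> Lp_norm p \<mu> f \<le> Lp_norm p \<mu> g"
  unfolding Lp_norm_def by (intro epowr_mono nn_integral_mono) auto

lemma Lp_norm_cmult:
  assumes "0 < p" and [measurable]: "f \<in> borel_measurable \<mu>"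
  shows "Lp_norm p \<mu> (\<lambda>x. c * f x) = c * Lp_norm p \<mu> f"
  using assms by (simp add: Lp_norm_def epowr_mult nn_integral_cmult epowr_epowr)

lemma Lp_norm_indicator:
  assumes "0 < p" "R \<in> sets \<mu>"
  shows "Lp_norm p \<mu> (indicator R) = epowr (emeasure \<mu> R) (1 / p)"
proof -
  have "(\<integral>\<^sup>+x. epowr (indicator R x) p \<partial>\<mu>) = (\<integral>\<^sup>+x. indicator R x \<partial>\<mu>)"
    by (intro nn_integral_cong) (auto split: split_indicator)
  then show ?thesis using assms by (simp add: Lp_norm_def)
qed

text \<open>The constant 2 instead of 1 comes from using the crude form of Young's inequality.\<close>
lemma holder_2:
  assumes q: "1 < q" "1/q + 1/q' = 1"
    and [measurable]: "f \<in> borel_measurable \<mu>" "g \<in> borel_measurable \<mu>"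
    and g: "Lp_norm q' \<mu> g \<noteq> top" "Lp_norm q' \<mu> g \<noteq> 0"
  shows "(\<integral>\<^sup>+x. f x * g x \<partial>\<mu>) \<le> 2 * Lp_norm q \<mu> f * Lp_norm q' \<mu> g"
proof -
  have q': "1 < q'" using conjugate_exponent_gt_1[OF q] .
  let ?A = "Lp_norm q \<mu> f" and ?B = "Lp_norm q' \<mu> g"
  have A: "(\<integral>\<^sup>+x. epowr (f x) q \<partial>\<mu>) = epowr ?A q" using q by (simp add: Lp_norm_def epowr_epowr)
  have B: "(\<integral>\<^sup>+x. epowr (g x) q' \<partial>\<mu>) = epowr ?B q'" using q' by (simp add: Lp_norm_def epowr_epowr)
  consider "?A = top" | "?A = 0" | "?A \<noteq> top" "?A \<noteq> 0" by auto
  then show ?thesis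
  proof cases
    case 1
    then show ?thesis using g by (simp add: ennreal_mult_top ennreal_top_mult ennreal_mult_eq_top_iff)
  next
    case 2
    then have "AE x in \<mu>. epowr (f x) q = 0" using A by (subst nn_integral_0_iff_AE[symmetric]) auto
    then have "(\<integral>\<^sup>+x. f x * g x \<partial>\<mu>) = (\<integral>\<^sup>+x. 0 \<partial>\<mu>)" by (intro nn_integral_cong_AE) auto
    then show ?thesis by simp
  next
    case 3
    have iA: "?A * inverse ?A = 1" and iB: "?B * inverse ?B = 1" using 3 g ennreal_mult_inverse by auto
    have "(\<integral>\<^sup>+x. f x * g x \<partial>\<mu>) = (\<integral>\<^sup>+x. (?A * ?B) * ((f x * inverse ?A) * (g x * inverse ?B)) \<partial>\<mu>)"
    proof (intro nn_integral_cong)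
      fix x
      have "(?A * ?B) * ((f x * inverse ?A) * (g x * inverse ?B))
          = f x * g x * ((?A * inverse ?A) * (?B * inverse ?B))" by (simp only: ac_simps)
      then show "f x * g x = (?A * ?B) * ((f x * inverse ?A) * (g x * inverse ?B))"
        by (simp add: iA iB)
    qed
    also have "\<dots> = (?A * ?B) * (\<integral>\<^sup>+x. (f x * inverse ?A) * (g x * inverse ?B) \<partial>\<mu>)"
      by (rule nn_integral_cmult) measurable
    also have "\<dots> \<le> (?A * ?B) * (\<integral>\<^sup>+x. epowr (f x) q * epowr (inverse ?A) q + epowr (g x) q' * epowr (inverse ?B) q' \<partial>\<mu>)"
      unfolding epowr_mult[symmetric] using young_ennreal[OF q] by (intro mult_left_mono nn_integral_mono) auto
    also have "(\<integral>\<^sup>+x. epowr (f x) q * epowr (inverse ?A) q + epowr (g x) q' * epowr (inverse ?B) q' \<partial>\<mu>)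
       = epowr ?A q * epowr (inverse ?A) q + epowr ?B q' * epowr (inverse ?B) q'"
      by (subst nn_integral_add) (auto simp: nn_integral_multc A B)
    also have "\<dots> = 2"
      by (simp add: iA iB flip: epowr_mult)
    finally show ?thesis by (simp add: ac_simps)
  qed
qed

text \<open>The extremal function is h^(q-1), normalised. As h may have infinite norm, it is
  truncated in height and to sets of finite measure, which makes the normalisation \<open>c\<close>
  finite; monotone convergence removes the truncation.\<close>

lemma Lp_norm_le_by_duality:
  fixes h :: "'a \<Rightarrow> ennreal"
  assumes q: "1 < q" "1/q + 1/q' = 1"
    and h [measurable]: "h \<in> borel_measurable \<mu>" and "sigma_finite_measure \<mu>"
    and dual: "\<And>g. g \<in> borel_measurable \<mu> \<Longrightarrow> (\<integral>\<^sup>+x. epowr (g x) q' \<partial>\<mu>) \<le> 1 \<Longrightarrow> (\<integral>\<^sup>+x. h x * g x \<partial>\<mu>) \<le> B"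
  shows "Lp_norm q \<mu> h \<le> B"
proof -
  interpret sigma_finite_measure \<mu> by fact
  obtain E :: "nat \<Rightarrow> 'a set" where E: "range E \<subseteq> sets \<mu>" "(\<Union>i. E i) = space \<mu>"
      "\<And>i. emeasure \<mu> (E i) \<noteq> \<infinity>" "incseq E"
    using sigma_finite_incseq by blast
  have [measurable]: "E n \<in> sets \<mu>" for n using E by auto
  have q': "1 < q'" using conjugate_exponent_gt_1[OF q] .
  define hn where "hn n x = min (h x) (of_nat n) * indicator (E n) x" for n x
  have [measurable]: "hn n \<in> borel_measurable \<mu>" for n unfolding hn_def by measurable
  have bound: "(\<integral>\<^sup>+x. epowr (hn n x) q \<partial>\<mu>) \<le> epowr B q" for n
  proof -
    let ?I = "\<integral>\<^sup>+x. epowr (hn n x) q \<partial>\<mu>"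
    have "?I \<le> (\<integral>\<^sup>+x. epowr (of_nat n) q * indicator (E n) x \<partial>\<mu>)"
      using q by (intro nn_integral_mono) (auto simp: hn_def intro!: epowr_mono split: split_indicator)
    also have "\<dots> < top"
      using E(3)[of n]
      by (simp add: nn_integral_cmult_indicator ennreal_mult_eq_top_iff less_top[symmetric])
    finally have fin: "?I \<noteq> top" by simp
    show ?thesis
    proof (cases "?I = 0")
      case True
      then show ?thesis by simp
    next
      case False
      define c where "c = epowr ?I (1 / q')"
      have c: "c * inverse c = 1" using False fin by (intro ennreal_mult_inverse) (auto simp: c_def)
      let ?g = "\<lambda>x. epowr (hn n x) (q - 1) * inverse c"
      have e: "(q - 1) * q' = q" using q q' by (simp add: field_simps)
      have "(\<integral>\<^sup>+x. epowr (?g x) q' \<partial>\<mu>) = (\<integral>\<^sup>+x. epowr (hn n x) q \<partial>\<mu>) * epowr (inverse c) q'"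
        by (simp add: epowr_mult epowr_epowr e nn_integral_multc)
      also have "?I = epowr c q'" using q' by (simp add: c_def epowr_epowr)
      also have "epowr c q' * epowr (inverse c) q' = 1" by (simp add: c flip: epowr_mult)
      finally have "(\<integral>\<^sup>+x. h x * ?g x \<partial>\<mu>) \<le> B" by (intro dual) auto
      moreover have "(\<integral>\<^sup>+x. epowr (hn n x) q * inverse c \<partial>\<mu>) \<le> (\<integral>\<^sup>+x. h x * ?g x \<partial>\<mu>)"
      proof (intro nn_integral_mono)
        fix x
        have "epowr (hn n x) q = hn n x * epowr (hn n x) (q - 1)"
          using epowr_add[of "hn n x" 1 "q - 1"] by simp
        moreover have "hn n x \<le> h x" by (auto simp: hn_def split: split_indicator)
        ultimately show "epowr (hn n x) q * inverse c \<le> h x * ?g x"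
          by (simp add: mult.assoc mult_right_mono)
      qed
      ultimately have "?I * inverse c \<le> B"
        by (simp add: nn_integral_multc)
      moreover have "?I = epowr ?I (1 / q) * c"
        unfolding c_def epowr_add[symmetric] q(2) by simp
      then have "?I * inverse c = epowr ?I (1 / q)"
        using c by (metis mult.assoc mult.right_neutral)
      ultimately have "epowr ?I (1 / q) \<le> B" by simp
      then show ?thesis using q epowr_le_iff[of "1/q" ?I B] by simp
    qed
  qed
  have inc: "incseq (\<lambda>n. hn n x)" for x
    using incseq_SucD[OF E(4)] unfolding hn_def
    by (intro incseq_SucI mult_mono min.mono) (auto split: split_indicator)
  have sup: "(SUP n. hn n x) = h x" if x: "x \<in> space \<mu>" for x
  proof (rule antisym)
    show "(SUP n. hn n x) \<le> h x"
      by (intro SUP_least) (auto simp: hn_def split: split_indicator)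
    obtain m where m: "x \<in> E m" using x E(2) by auto
    have "min (h x) (of_nat k) \<le> (SUP n. hn n x)" for k
    proof (rule SUP_upper2[of "max k m"])
      have "x \<in> E (max k m)" using m incseqD[OF E(4), of m "max k m"] by auto
      then show "min (h x) (of_nat k) \<le> hn (max k m) x"
        unfolding hn_def using min.mono[OF order.refl, of "of_nat k" "of_nat (max k m)" "h x"]
        by (simp only: indicator_simps mult_1_right of_nat_le_iff max.cobounded1)
    qed simp
    then have "(SUP k::nat. min (h x) (of_nat k)) \<le> (SUP n. hn n x)" by (intro SUP_least) auto
    moreover have "(SUP k::nat. min (h x) (of_nat k)) = h x"
      by (simp add: inf_min[symmetric] inf_SUP[symmetric] ennreal_SUP_of_nat_eq_top)
    ultimately show "h x \<le> (SUP n. hn n x)" by simp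
  qed
  have "(\<integral>\<^sup>+x. epowr (h x) q \<partial>\<mu>) = (\<integral>\<^sup>+x. (SUP n. epowr (hn n x) q) \<partial>\<mu>)"
    using q inc by (intro nn_integral_cong) (simp add: epowr_SUP[symmetric] sup)
  also have "\<dots> = (SUP n. (\<integral>\<^sup>+x. epowr (hn n x) q \<partial>\<mu>))"
    using q inc
    by (intro nn_integral_monotone_convergence_SUP) (auto simp: incseq_def le_fun_def intro!: epowr_mono)
  also have "\<dots> \<le> epowr B q" using bound by (intro SUP_least) auto
  finally show ?thesis using q by (subst Lp_norm_le_iff) auto
qed

text \<open>On a countable set of measurable points every function is a countable sum of multiples
  of indicators. The function h is arbitrary because it will involve the diagonal values
  \<open>K x x\<close>, which are not known to depend measurably on x.\<close>

lemma nn_integral_countable_indicator: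
  fixes h :: "'a \<Rightarrow> ennreal"
  assumes "countable A" and A: "\<And>a. a \<in> A \<Longrightarrow> {a} \<in> sets M"
  shows "(\<integral>\<^sup>+x. h x * indicator A x \<partial>M) = (\<integral>\<^sup>+a. h a * emeasure M {a} \<partial>count_space A)"
proof -
  have "h x * indicator A x = (\<integral>\<^sup>+a. h a * indicator {a} x \<partial>count_space A)" for x
  proof (cases "x \<in> A")
    case True
    have "(\<integral>\<^sup>+a. h a * indicator {a} x \<partial>count_space A) = (\<integral>\<^sup>+a. h x * indicator {x} a \<partial>count_space A)"
      by (intro nn_integral_cong) (auto split: split_indicator)
    also have "\<dots> = h x" using True by (simp add: nn_integral_cmult_indicator)
    finally show ?thesis using True by simp
  next
    case False
    then have "(\<integral>\<^sup>+a. h a * indicator {a} x \<partial>count_space A) = (\<integral>\<^sup>+a. 0 \<partial>count_space A)"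
      by (intro nn_integral_cong) (auto split: split_indicator)
    then show ?thesis using False by simp
  qed
  then have "(\<integral>\<^sup>+x. h x * indicator A x \<partial>M) = (\<integral>\<^sup>+x. (\<integral>\<^sup>+a. h a * indicator {a} x \<partial>count_space A) \<partial>M)"
    by simp
  also have "\<dots> = (\<integral>\<^sup>+a. (\<integral>\<^sup>+x. h a * indicator {a} x \<partial>M) \<partial>count_space A)"
    using assms by (intro nn_integral_count_space_nn_integral) auto
  also have "\<dots> = (\<integral>\<^sup>+a. h a * emeasure M {a} \<partial>count_space A)"
    using A by (intro nn_integral_cong) (simp add: nn_integral_cmult_indicator)
  finally show ?thesis .
qed

text \<open>Restricting to an exhaustion by sets of finite measure reduces this to finite measures:
  an atom is an atom of one of the restrictions.\<close>

lemma (in sigma_finite_measure) countable_atoms: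
  assumes "\<And>x. x \<in> space M \<Longrightarrow> {x} \<in> sets M"
  shows "countable {x \<in> space M. emeasure M {x} \<noteq> 0}"
proof -
  obtain E :: "nat \<Rightarrow> 'a set" where E: "range E \<subseteq> sets M" "(\<Union>i. E i) = space M"
      "\<And>i. emeasure M (E i) \<noteq> \<infinity>"
    using sigma_finite by blast
  have "{x \<in> space M. emeasure M {x} \<noteq> 0} \<subseteq> (\<Union>n. {x. measure (density M (indicator (E n))) {x} \<noteq> 0})"
  proof
    fix x assume x: "x \<in> {x \<in> space M. emeasure M {x} \<noteq> 0}"
    then have "x \<in> (\<Union>i. E i)" using E(2) by simp
    then obtain n where n: "x \<in> E n" by blast
    have En: "E n \<in> sets M" using E by auto
    have sx: "{x} \<in> sets M" using x assms by auto
    have "emeasure (density M (indicator (E n))) {x} = (\<integral>\<^sup>+y. indicator {x} y \<partial>M)"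
      using En sx n by (subst emeasure_density) (auto intro!: nn_integral_cong split: split_indicator)
    also have "\<dots> = emeasure M {x}" using sx by simp
    finally have 1: "emeasure (density M (indicator (E n))) {x} = emeasure M {x}" .
    have "emeasure M {x} \<le> emeasure M (E n)" using n En by (intro emeasure_mono) auto
    then have "emeasure M {x} \<noteq> top" using E(3)[of n] by (auto simp: top_unique)
    then have "measure (density M (indicator (E n))) {x} \<noteq> 0"
      using x 1 by (simp add: measure_def enn2real_eq_0_iff)
    then show "x \<in> (\<Union>n. {x. measure (density M (indicator (E n))) {x} \<noteq> 0})" by auto
  qed
  moreover have "countable {x. measure (density M (indicator (E n))) {x} \<noteq> 0}" for n
  proof -
    have En: "E n \<in> sets M" using E by auto
    have "finite_measure (density M (indicator (E n)))"
      using En E(3)[of n] by (intro finite_measureI) (simp add: emeasure_density space_density)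
    then show ?thesis by (rule finite_measure.countable_support)
  qed
  ultimately show ?thesis by (meson countable_UN countableI_type countable_subset)
qed

section \<open>Dyadic kernels\<close>

lemma space_qborel [simp]: "space (qborel X \<rho>) = X"
  unfolding qborel_def by (rule space_measure_of) (auto simp: qopen_def)

locale pair_of_weights =
  fixes X :: "'a set" and \<rho> :: "'a \<Rightarrow> 'a \<Rightarrow> real" and \<sigma> \<omega> :: "'a measure"
  assumes sets_sigma: "sets \<sigma> = sets (qborel X \<rho>)" and sets_omega: "sets \<omega> = sets (qborel X \<rho>)"
    and sigma_finite_sigma: "sigma_finite_measure \<sigma>" and sigma_finite_omega: "sigma_finite_measure \<omega>"

text \<open>The infimum of \<open>K\<close> over \<open>R \<times> Q i\<close>, where \<open>R\<close> is the cube around \<open>x\<close> three generations below \<open>Q i\<close>.\<close>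

definition inf_kernel ::
  "('a \<Rightarrow> 'a \<Rightarrow> ennreal) \<Rightarrow> (int \<Rightarrow> nat set) \<Rightarrow> (int \<Rightarrow> nat \<Rightarrow> 'a set) \<Rightarrow> int \<times> nat \<Rightarrow> 'a \<Rightarrow> ennreal" where
  "inf_kernel K I Q i x = (SUP \<beta>\<in>I (fst i + 3). indicator (Q (fst i + 3) \<beta>) x *
     (INF x'\<in>Q (fst i + 3) \<beta>. INF y'\<in>Q (fst i) (snd i). K x' y'))"

context dyadic_system
begin

definition cube :: "int \<times> nat \<Rightarrow> 'a set" where "cube i = Q (fst i) (snd i)"

text \<open>Within a residue class modulo 3, a strictly finer cube is at least three generations finer, hence
  lies in a single set of constancy of \<open>inf_kernel\<close>.\<close>

definition idx :: "int \<Rightarrow> (int \<times> nat) set" where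
  "idx j = {i. fst i mod 3 = j \<and> snd i \<in> I (fst i)}"

abbreviation av :: "('a \<Rightarrow> 'a \<Rightarrow> ennreal) \<Rightarrow> int \<times> nat \<Rightarrow> 'a \<Rightarrow> ennreal" where
  "av K \<equiv> inf_kernel K I Q"

lemma cube_subset: "\<alpha> \<in> I k \<Longrightarrow> Q k \<alpha> \<subseteq> X"
  using cover by blast

lemma cube_unique: "\<alpha> \<in> I k \<Longrightarrow> \<beta> \<in> I k \<Longrightarrow> x \<in> Q k \<alpha> \<Longrightarrow> x \<in> Q k \<beta> \<Longrightarrow> \<alpha> = \<beta>"
  using disjoint[of k] by (auto simp: disjoint_family_on_def)

lemma cube_exists: "x \<in> X \<Longrightarrow> \<exists>\<alpha>\<in>I k. x \<in> Q k \<alpha>"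
  using cover by blast

lemma cube_nested: "k \<le> l \<Longrightarrow> \<alpha> \<in> I k \<Longrightarrow> \<beta> \<in> I l \<Longrightarrow> x \<in> Q k \<alpha> \<Longrightarrow> x \<in> Q l \<beta> \<Longrightarrow> Q l \<beta> \<subseteq> Q k \<alpha>"
  using nested[of k l \<alpha> \<beta>] by auto

lemma av_eq:
  assumes "\<beta> \<in> I (fst i + 3)" "x \<in> Q (fst i + 3) \<beta>"
  shows "av K i x = (INF x'\<in>Q (fst i + 3) \<beta>. INF y'\<in>Q (fst i) (snd i). K x' y')"
proof (rule antisym)
  show "av K i x \<le> (INF x'\<in>Q (fst i + 3) \<beta>. INF y'\<in>Q (fst i) (snd i). K x' y')"
    unfolding inf_kernel_def
  proof (rule SUP_least)
    fix \<gamma> assume g: "\<gamma> \<in> I (fst i + 3)"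
    show "indicator (Q (fst i + 3) \<gamma>) x * (INF x'\<in>Q (fst i + 3) \<gamma>. INF y'\<in>Q (fst i) (snd i). K x' y')
       \<le> (INF x'\<in>Q (fst i + 3) \<beta>. INF y'\<in>Q (fst i) (snd i). K x' y')"
    proof (cases "x \<in> Q (fst i + 3) \<gamma>")
      case True
      then have "\<gamma> = \<beta>" using cube_unique[OF g assms(1) _ assms(2)] by simp
      then show ?thesis using assms by simp
    qed simp
  qed
  show "(INF x'\<in>Q (fst i + 3) \<beta>. INF y'\<in>Q (fst i) (snd i). K x' y') \<le> av K i x"
    unfolding inf_kernel_def using assms by (intro SUP_upper2[of \<beta>]) auto
qed

lemma av_le:
  assumes "i \<in> idx j" "x \<in> cube i" "y \<in> cube i"
  shows "av K i x \<le> K x y"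
proof -
  have "x \<in> X" using assms cube_subset by (auto simp: idx_def cube_def)
  then obtain \<beta> where b: "\<beta> \<in> I (fst i + 3)" "x \<in> Q (fst i + 3) \<beta>" using cube_exists by blast
  show ?thesis unfolding av_eq[OF b]
    using assms b by (intro INF_lower2[of x] INF_lower2[of y]) (auto simp: cube_def)
qed

lemma idx_level:
  assumes "i \<in> idx j" "i' \<in> idx j" "fst i < fst i'"
  shows "fst i + 3 \<le> fst i'"
proof -
  have "fst i mod 3 = fst i' mod 3" using assms by (auto simp: idx_def)
  then show ?thesis using assms(3) by presburger
qed

lemma idx_nested:
  assumes "i \<in> idx j" "i' \<in> idx j" "fst i \<le> fst i'" "x \<in> cube i" "x \<in> cube i'"
  shows "cube i' \<subseteq> cube i"
  using assms cube_nested by (auto simp: idx_def cube_def; blast)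

lemma av_mono:
  assumes i: "i \<in> idx j" "i' \<in> idx j" "fst i < fst i'" and x: "x \<in> cube i" "x \<in> cube i'"
  shows "av K i x \<le> av K i' x"
proof -
  have "x \<in> X" using assms cube_subset by (auto simp: idx_def cube_def)
  then obtain \<beta> \<beta>' where b: "\<beta> \<in> I (fst i + 3)" "x \<in> Q (fst i + 3) \<beta>"
     "\<beta>' \<in> I (fst i' + 3)" "x \<in> Q (fst i' + 3) \<beta>'" using cube_exists by meson
  have "cube i' \<subseteq> cube i" using idx_nested i x by auto
  moreover have "Q (fst i' + 3) \<beta>' \<subseteq> Q (fst i + 3) \<beta>"
    using b i by (intro cube_nested[of _ _ _ _ x]) auto
  ultimately show ?thesis unfolding av_eq[OF b(1,2)] av_eq[OF b(3,4)]
    by (intro INF_superset_mono) (auto simp: cube_def)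
qed

text \<open>The finer cube is at least three generations down, so it lies inside one cube of
  generation \<open>fst i + 3\<close>, on which the infimum is the same for all points.\<close>

lemma av_const:
  assumes i: "i \<in> idx j" "i' \<in> idx j" "fst i < fst i'" and x: "x \<in> cube i'" "y \<in> cube i'"
  shows "av K i x = av K i y"
proof -
  have "x \<in> X" using assms cube_subset by (auto simp: idx_def cube_def)
  then obtain \<beta> where b: "\<beta> \<in> I (fst i + 3)" "x \<in> Q (fst i + 3) \<beta>" using cube_exists by blast
  have "cube i' \<subseteq> Q (fst i + 3) \<beta>"
    using idx_level[OF i] b i x cube_nested[of "fst i + 3" "fst i'" \<beta> "snd i'" x]
    by (auto simp: cube_def idx_def)
  then have "y \<in> Q (fst i + 3) \<beta>" using x by auto
  then show ?thesis using av_eq[OF b] av_eq[OF b(1)] by simp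
qed

lemma cube_sets: "i \<in> idx j \<Longrightarrow> sets M = sets (qborel X \<rho>) \<Longrightarrow> cube i \<in> sets M"
  using cube_borel by (auto simp: idx_def cube_def)

text \<open>For fixed \<open>i\<close> this is a countable supremum of constants times indicators of
  cubes, measurable whatever the kernel is. The definition by a supremum, rather than by choosing
  the cube around x, makes this visible.\<close>

lemma av_measurable:
  assumes M: "sets M = sets (qborel X \<rho>)"
  shows "av K i \<in> borel_measurable M"
  unfolding inf_kernel_def[abs_def]
proof (intro borel_measurable_SUP borel_measurable_times_ennreal borel_measurable_const borel_measurable_indicator)
  fix \<beta> assume "\<beta> \<in> I (fst i + 3)"
  then show "Q (fst i + 3) \<beta> \<in> sets M" using cube_borel M by simp
qed auto

definition dyadic_kernel :: "('a \<Rightarrow> 'a \<Rightarrow> ennreal) \<Rightarrow> (int \<times> nat) set \<Rightarrow> 'a \<Rightarrow> 'a \<Rightarrow> ennreal" where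
  "dyadic_kernel K A x y = (SUP i\<in>A. indicator (cube i) x * indicator (cube i) y *
      min (av K i x) (av (\<lambda>x y. K y x) i y))"

lemma dyadic_kernel_le: "A \<subseteq> idx j \<Longrightarrow> dyadic_kernel K A x y \<le> K x y"
  unfolding dyadic_kernel_def
  by (intro SUP_least) (auto split: split_indicator intro!: min.coboundedI1 av_le[of _ j])

text \<open>Each term is built from functions of one variable, so joint measurability does not refer
  to that of \<open>K\<close>.\<close>

lemma dyadic_kernel_measurable:
  assumes "A \<subseteq> idx j" "sets M = sets (qborel X \<rho>)" "sets N = sets (qborel X \<rho>)"
  shows "(\<lambda>z. dyadic_kernel K A (fst z) (snd z)) \<in> borel_measurable (M \<Otimes>\<^sub>M N)"
  unfolding dyadic_kernel_def
proof (intro borel_measurable_SUP)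
  fix i assume "i \<in> A"
  then have i: "i \<in> idx j" using assms by auto
  note [measurable] = cube_sets[OF i assms(2)] cube_sets[OF i assms(3)]
    av_measurable[OF assms(2)] av_measurable[OF assms(3)]
  show "(\<lambda>z. indicator (cube i) (fst z) * indicator (cube i) (snd z) *
      min (av K i (fst z)) (av (\<lambda>x y. K y x) i (snd z))) \<in> borel_measurable (M \<Otimes>\<^sub>M N)"
    by measurable
qed auto

end

section \<open>Bounds for dyadic kernels under testing\<close>

definition form_const :: "real \<Rightarrow> real \<Rightarrow> real" where
  "form_const p q = 2 powr (1 / (p - 1)) * (4 powr q + 1 + (2 powr (1 / (p - 1))) powr p * 4 powr p)"

lemma form_const_nonneg: "0 \<le> form_const p q"
  by (simp add: form_const_def)

text \<open>Testing constant 1 is assumed; the general case follows by rescaling the kernel. The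
  condition for the adjoint is the same locale with weights exchanged, kernel transposed and
  exponents \<open>q'\<close>, \<open>p'\<close>.\<close>

locale dyadic_testing = dyadic_system X \<rho> A\<^sub>0 \<delta> x\<^sub>0 I Q z + pair_of_weights X \<rho> \<sigma> \<omega>
  for X :: "'a set" and \<rho> :: "'a \<Rightarrow> 'a \<Rightarrow> real" and A\<^sub>0 \<delta> :: real and x\<^sub>0 :: 'a
    and I :: "int \<Rightarrow> nat set" and Q :: "int \<Rightarrow> nat \<Rightarrow> 'a set" and z :: "int \<Rightarrow> nat \<Rightarrow> 'a"
    and \<sigma> \<omega> :: "'a measure" +
  fixes K :: "'a \<Rightarrow> 'a \<Rightarrow> ennreal" and p q p' q' :: real
  assumes exponents: "1 < p" "p \<le> q" "1/p + 1/p' = 1" "1/q + 1/q' = 1"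
    and finite_sigma: "\<alpha> \<in> I k \<Longrightarrow> emeasure \<sigma> (Q k \<alpha>) \<noteq> top"
    and finite_omega: "\<alpha> \<in> I k \<Longrightarrow> emeasure \<omega> (Q k \<alpha>) \<noteq> top"
    and testing: "\<alpha> \<in> I k \<Longrightarrow>
      (\<integral>\<^sup>+x. epowr (indicator (Q k \<alpha>) x * (\<integral>\<^sup>+y. K x y * indicator (Q k \<alpha>) y \<partial>\<sigma>)) q \<partial>\<omega>)
        \<le> epowr (emeasure \<sigma> (Q k \<alpha>)) (q / p)"
begin

text \<open>The order of the exponents that the dual instance of the locale requires.\<close>

lemma q'_bounds: "1 < q'" "q' \<le> p'"
proof -
  show "1 < q'" using conjugate_exponent_gt_1[of q q'] exponents by auto
  have "1 < p'" using conjugate_exponent_gt_1[of p p'] exponents by auto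
  have "1/q \<le> 1/p" using exponents by (simp add: frac_le)
  then have "1/p' \<le> 1/q'" using exponents by linarith
  then show "q' \<le> p'" using \<open>1 < q'\<close> \<open>1 < p'\<close> by (simp add: field_simps)
qed

text \<open>The kernel with only \<open>av K i x\<close> is still at most \<open>K\<close>, so the
  testing condition for \<open>K\<close> passes to it.\<close>

lemma half_form_bound:
  assumes A: "finite A" "A \<subseteq> idx j"
    and fg: "f \<in> borel_measurable \<sigma>" "g \<in> borel_measurable \<omega>"
    and norms: "(\<integral>\<^sup>+x. epowr (f x) p \<partial>\<sigma>) \<le> 1" "(\<integral>\<^sup>+x. epowr (g x) q' \<partial>\<omega>) \<le> 1"
    and dom: "\<And>i. i \<in> A \<Longrightarrow>
       (enn2real (\<integral>\<^sup>+y. g y * indicator (cube i) y \<partial>\<omega>) / measure \<omega> (cube i)) powr q' * measure \<omega> (cube i)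
       \<le> (enn2real (\<integral>\<^sup>+y. f y * indicator (cube i) y \<partial>\<sigma>) / measure \<sigma> (cube i)) powr p * measure \<sigma> (cube i)"
  shows "(\<integral>\<^sup>+x. (\<integral>\<^sup>+y. (SUP i\<in>{i\<in>A. x \<in> cube i \<and> y \<in> cube i}. av K i x) * f y \<partial>\<sigma>) * g x \<partial>\<omega>)
     \<le> ennreal (form_const p q)"
proof -
  interpret D: dyadic_form \<sigma> \<omega> A cube fst "av K" p q q' f g
  proof
    fix i assume "i \<in> A"
    then have i: "i \<in> idx j" using A by auto
    show "cube i \<in> sets \<sigma>" "cube i \<in> sets \<omega>"
      using cube_sets[OF i] sets_sigma sets_omega by auto
    show "emeasure \<sigma> (cube i) \<noteq> top" "emeasure \<omega> (cube i) \<noteq> top"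
      using finite_sigma finite_omega i by (auto simp: idx_def cube_def)
    show "av K i \<in> borel_measurable \<omega>"
      using av_measurable sets_omega by auto
  next
    fix i i' :: "int \<times> nat" and x assume "i \<in> A" "i' \<in> A" "fst i = fst i'" "x \<in> cube i" "x \<in> cube i'"
    moreover from this have "i \<in> idx j" "i' \<in> idx j" using A by auto
    ultimately show "i = i'" using cube_unique[of "snd i" "fst i" "snd i'" x]
      by (simp add: idx_def cube_def prod_eq_iff)
  next
    fix i i' :: "int \<times> nat" and x
    assume i: "i \<in> A" "i' \<in> A"
    then have ij: "i \<in> idx j" "i' \<in> idx j" using A by auto
    show "fst i \<le> fst i' \<Longrightarrow> x \<in> cube i \<Longrightarrow> x \<in> cube i' \<Longrightarrow> cube i' \<subseteq> cube i"
      using idx_nested[OF ij] .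
    show "fst i < fst i' \<Longrightarrow> x \<in> cube i \<Longrightarrow> x \<in> cube i' \<Longrightarrow> av K i x \<le> av K i' x"
      using av_mono[OF ij] .
    show "fst i < fst i' \<Longrightarrow> x \<in> cube i' \<Longrightarrow> y \<in> cube i' \<Longrightarrow> av K i x = av K i y" for y
      using av_const[OF ij] .
  qed (use A fg norms exponents in simp_all)
  have "D.H x y \<le> K x y" for x y
    unfolding D.H_def using A by (intro SUP_least) (auto intro: av_le)
  then have H: "(\<integral>\<^sup>+x. epowr (indicator R x * (\<integral>\<^sup>+y. D.H x y * indicator R y \<partial>\<sigma>)) q \<partial>\<omega>)
     \<le> (\<integral>\<^sup>+x. epowr (indicator R x * (\<integral>\<^sup>+y. K x y * indicator R y \<partial>\<sigma>)) q \<partial>\<omega>)" for R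
    using exponents by (intro nn_integral_mono epowr_mono mult_left_mono mult_right_mono) auto
  have "(\<integral>\<^sup>+x. (\<integral>\<^sup>+y. D.H x y * f y \<partial>\<sigma>) * g x \<partial>\<omega>) \<le> ennreal (form_const p q)"
  proof (rule D.form_bound[unfolded D.\<theta>_def form_const_def[symmetric]])
    fix i assume i: "i \<in> A"
    show "(\<integral>\<^sup>+x. epowr (indicator (cube i) x * (\<integral>\<^sup>+y. D.H x y * indicator (cube i) y \<partial>\<sigma>)) q \<partial>\<omega>)
      \<le> epowr (emeasure \<sigma> (cube i)) (q / p)"
      using H[of "cube i"] testing[of "snd i" "fst i"] i A by (auto simp: cube_def idx_def)
    show "(D.Gi i / measure \<omega> (cube i)) powr q' * measure \<omega> (cube i)
       \<le> (D.Fi i / measure \<sigma> (cube i)) powr p * measure \<sigma> (cube i)"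
      using dom[OF i] by (simp add: D.Gi_def D.Fi_def)
  qed
  then show ?thesis by (simp add: D.H_def)
qed

end

text \<open>The kernel is at most \<open>H1 x y + H2 y x\<close>, where each summand keeps one entry
  of the minimum. The second one is brought into the form of the dual problem by Tonelli's theorem,
  which applies since it is a finite supremum of products of functions of one variable.\<close>

lemma finite_kernel_bound:
  assumes T1: "dyadic_testing X \<rho> A\<^sub>0 \<delta> x\<^sub>0 I Q z \<sigma> \<omega> K p q p' q'"
    and T2: "dyadic_testing X \<rho> A\<^sub>0 \<delta> x\<^sub>0 I Q z \<omega> \<sigma> (\<lambda>x y. K y x) q' p' q p"
    and A: "finite A" "A \<subseteq> dyadic_system.idx I j"
    and f [measurable]: "f \<in> borel_measurable \<sigma>" and g [measurable]: "g \<in> borel_measurable \<omega>"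
    and norms: "(\<integral>\<^sup>+x. epowr (f x) p \<partial>\<sigma>) \<le> 1" "(\<integral>\<^sup>+x. epowr (g x) q' \<partial>\<omega>) \<le> 1"
  shows "(\<integral>\<^sup>+x. (\<integral>\<^sup>+y. dyadic_system.dyadic_kernel I Q K A x y * f y \<partial>\<sigma>) * g x \<partial>\<omega>)
     \<le> ennreal (form_const p q + form_const q' p')"
proof -
  interpret T1: dyadic_testing X \<rho> A\<^sub>0 \<delta> x\<^sub>0 I Q z \<sigma> \<omega> K p q p' q' by (rule T1)
  interpret T2: dyadic_testing X \<rho> A\<^sub>0 \<delta> x\<^sub>0 I Q z \<omega> \<sigma> "\<lambda>x y. K y x" q' p' q p by (rule T2)
  interpret \<sigma>: sigma_finite_measure \<sigma> by (rule T1.sigma_finite_sigma)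
  interpret \<omega>: sigma_finite_measure \<omega> by (rule T1.sigma_finite_omega)
  interpret P: pair_sigma_finite \<omega> \<sigma> ..
  let ?F = "\<lambda>i. (enn2real (\<integral>\<^sup>+y. f y * indicator (T1.cube i) y \<partial>\<sigma>) / measure \<sigma> (T1.cube i)) powr p * measure \<sigma> (T1.cube i)"
  let ?G = "\<lambda>i. (enn2real (\<integral>\<^sup>+y. g y * indicator (T1.cube i) y \<partial>\<omega>) / measure \<omega> (T1.cube i)) powr q' * measure \<omega> (T1.cube i)"
  let ?K' = "\<lambda>x y. K y x"
  \<comment> \<open>Cubes with equal averages belong to both families, which is harmless for an
    upper bound.\<close>
  define A1 A2 where "A1 = {i\<in>A. ?G i \<le> ?F i}" and "A2 = {i\<in>A. ?F i \<le> ?G i}"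
  have A12: "finite A1" "finite A2" "A1 \<subseteq> T1.idx j" "A2 \<subseteq> T1.idx j"
    using A by (auto simp: A1_def A2_def)
  define H1 where "H1 x y = (SUP i\<in>{i\<in>A1. x \<in> T1.cube i \<and> y \<in> T1.cube i}. T1.av K i x)" for x y
  define H2 where "H2 y x = (SUP i\<in>{i\<in>A2. y \<in> T1.cube i \<and> x \<in> T1.cube i}. T1.av ?K' i y)" for x y
  note sets = T1.sets_sigma T1.sets_omega
  have eq: "(SUP i\<in>{i\<in>B. x \<in> T1.cube i \<and> y \<in> T1.cube i}. c i)
     = (SUP i\<in>B. indicator (T1.cube i) x * indicator (T1.cube i) y * c i)"
    for B and c :: "_ \<Rightarrow> ennreal" and x y
  proof (intro antisym SUP_least)
    fix i assume "i \<in> {i\<in>B. x \<in> T1.cube i \<and> y \<in> T1.cube i}"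
    then show "c i \<le> (SUP i\<in>B. indicator (T1.cube i) x * indicator (T1.cube i) y * c i)"
      by (intro SUP_upper2[of i]) auto
  next
    fix i assume i: "i \<in> B"
    show "indicator (T1.cube i) x * indicator (T1.cube i) y * c i
       \<le> (SUP i\<in>{i\<in>B. x \<in> T1.cube i \<and> y \<in> T1.cube i}. c i)"
    proof (cases "x \<in> T1.cube i \<and> y \<in> T1.cube i")
      case True
      then show ?thesis using i by (intro SUP_upper2[of i]) auto
    qed auto
  qed
  have meas: "i \<in> T1.idx j \<Longrightarrow> T1.cube i \<in> sets \<sigma>" "i \<in> T1.idx j \<Longrightarrow> T1.cube i \<in> sets \<omega>" for i
    using T1.cube_sets sets by auto
  have m1 [measurable]: "(\<lambda>z. H1 (fst z) (snd z)) \<in> borel_measurable (\<omega> \<Otimes>\<^sub>M \<sigma>)"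
    unfolding H1_def eq
  proof (intro borel_measurable_SUP)
    fix i assume "i \<in> A1"
    then have i: "i \<in> T1.idx j" using A12 by auto
    note [measurable] = meas[OF i] T1.av_measurable[OF T1.sets_omega]
    show "(\<lambda>z. indicator (T1.cube i) (fst z) * indicator (T1.cube i) (snd z) * T1.av K i (fst z))
       \<in> borel_measurable (\<omega> \<Otimes>\<^sub>M \<sigma>)" by measurable
  qed (use A12 in \<open>auto intro: countable_finite\<close>)
  have m2 [measurable]: "(\<lambda>z. H2 (snd z) (fst z)) \<in> borel_measurable (\<omega> \<Otimes>\<^sub>M \<sigma>)"
    unfolding H2_def eq
  proof (intro borel_measurable_SUP)
    fix i assume "i \<in> A2"
    then have i: "i \<in> T1.idx j" using A12 by auto
    note [measurable] = meas[OF i] T1.av_measurable[OF T1.sets_sigma]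
    show "(\<lambda>z. indicator (T1.cube i) (snd z) * indicator (T1.cube i) (fst z) * T1.av ?K' i (snd z))
       \<in> borel_measurable (\<omega> \<Otimes>\<^sub>M \<sigma>)" by measurable
  qed (use A12 in \<open>auto intro: countable_finite\<close>)
  have m1': "H1 x \<in> borel_measurable \<sigma>" if "x \<in> space \<omega>" for x
    using measurable_compose[OF measurable_Pair1'[OF that] m1] by simp
  have m2': "(\<lambda>y. H2 y x) \<in> borel_measurable \<sigma>" if "x \<in> space \<omega>" for x
    using measurable_compose[OF measurable_Pair1'[OF that] m2] by simp
  have m2'': "H2 y \<in> borel_measurable \<omega>" if "y \<in> space \<sigma>" for y
    using measurable_compose[OF measurable_Pair2'[OF that] m2] by simp
  have le: "T1.dyadic_kernel K A x y \<le> H1 x y + H2 y x" for x y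
    unfolding T1.dyadic_kernel_def
  proof (rule SUP_least)
    fix i assume i: "i \<in> A"
    show "indicator (T1.cube i) x * indicator (T1.cube i) y * min (T1.av K i x) (T1.av ?K' i y) \<le> H1 x y + H2 y x"
    proof (cases "x \<in> T1.cube i \<and> y \<in> T1.cube i")
      case True
      show ?thesis
      proof (cases "i \<in> A1")
        case i1: True
        have "T1.av K i x \<le> H1 x y"
          unfolding H1_def using i1 True by (intro SUP_upper) auto
        then show ?thesis using True by (simp add: min.coboundedI1 add_increasing2)
      next
        case False
        then have "i \<in> A2" using i by (auto simp: A1_def A2_def)
        then have "T1.av ?K' i y \<le> H2 y x"
          unfolding H2_def using True by (intro SUP_upper) auto
        then show ?thesis using True by (simp add: min.coboundedI2 add_increasing)
      qed
    qed auto
  qed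
  have "(\<integral>\<^sup>+x. (\<integral>\<^sup>+y. T1.dyadic_kernel K A x y * f y \<partial>\<sigma>) * g x \<partial>\<omega>)
     \<le> (\<integral>\<^sup>+x. (\<integral>\<^sup>+y. H1 x y * f y + H2 y x * f y \<partial>\<sigma>) * g x \<partial>\<omega>)"
    unfolding distrib_right[symmetric] using le by (intro nn_integral_mono mult_right_mono) auto
  also have "\<dots> = (\<integral>\<^sup>+x. (\<integral>\<^sup>+y. H1 x y * f y \<partial>\<sigma>) * g x + (\<integral>\<^sup>+y. H2 y x * f y \<partial>\<sigma>) * g x \<partial>\<omega>)"
    using m1' m2' by (intro nn_integral_cong) (simp add: nn_integral_add distrib_right)
  also have "\<dots> = (\<integral>\<^sup>+x. (\<integral>\<^sup>+y. H1 x y * f y \<partial>\<sigma>) * g x \<partial>\<omega>) + (\<integral>\<^sup>+x. (\<integral>\<^sup>+y. H2 y x * f y \<partial>\<sigma>) * g x \<partial>\<omega>)"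
  proof (rule nn_integral_add)
    have "(\<lambda>x. \<integral>\<^sup>+y. H1 (fst (x, y)) (snd (x, y)) * f (snd (x, y)) \<partial>\<sigma>) \<in> borel_measurable \<omega>"
      by (rule \<sigma>.borel_measurable_nn_integral_fst) measurable
    then show "(\<lambda>x. (\<integral>\<^sup>+y. H1 x y * f y \<partial>\<sigma>) * g x) \<in> borel_measurable \<omega>" by simp
    have "(\<lambda>x. \<integral>\<^sup>+y. H2 (snd (x, y)) (fst (x, y)) * f (snd (x, y)) \<partial>\<sigma>) \<in> borel_measurable \<omega>"
      by (rule \<sigma>.borel_measurable_nn_integral_fst) measurable
    then show "(\<lambda>x. (\<integral>\<^sup>+y. H2 y x * f y \<partial>\<sigma>) * g x) \<in> borel_measurable \<omega>" by simp
  qed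
  also have "(\<integral>\<^sup>+x. (\<integral>\<^sup>+y. H2 y x * f y \<partial>\<sigma>) * g x \<partial>\<omega>) = (\<integral>\<^sup>+x. (\<integral>\<^sup>+y. H2 y x * f y * g x \<partial>\<sigma>) \<partial>\<omega>)"
    using m2' by (intro nn_integral_cong nn_integral_multc[symmetric]) auto
  also have "\<dots> = (\<integral>\<^sup>+y. (\<integral>\<^sup>+x. H2 y x * f y * g x \<partial>\<omega>) \<partial>\<sigma>)"
  proof -
    have "(\<lambda>z. H2 (snd z) (fst z) * f (snd z) * g (fst z)) \<in> borel_measurable (\<omega> \<Otimes>\<^sub>M \<sigma>)" by measurable
    from P.Fubini[OF this] show ?thesis by simp
  qed
  also have "\<dots> = (\<integral>\<^sup>+y. (\<integral>\<^sup>+x. H2 y x * g x \<partial>\<omega>) * f y \<partial>\<sigma>)"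
  proof (intro nn_integral_cong)
    fix y assume y: "y \<in> space \<sigma>"
    note [measurable] = m2''[OF y]
    have "(\<integral>\<^sup>+x. H2 y x * f y * g x \<partial>\<omega>) = (\<integral>\<^sup>+x. (H2 y x * g x) * f y \<partial>\<omega>)"
      by (simp add: ac_simps)
    also have "\<dots> = (\<integral>\<^sup>+x. H2 y x * g x \<partial>\<omega>) * f y"
      by (rule nn_integral_multc) measurable
    finally show "(\<integral>\<^sup>+x. H2 y x * f y * g x \<partial>\<omega>) = (\<integral>\<^sup>+x. H2 y x * g x \<partial>\<omega>) * f y" .
  qed
  also have "(\<integral>\<^sup>+x. (\<integral>\<^sup>+y. H1 x y * f y \<partial>\<sigma>) * g x \<partial>\<omega>) \<le> ennreal (form_const p q)"
    unfolding H1_def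
    by (rule T1.half_form_bound[OF A12(1,3) f g norms]) (auto simp: A1_def)
  also have "(\<integral>\<^sup>+y. (\<integral>\<^sup>+x. H2 y x * g x \<partial>\<omega>) * f y \<partial>\<sigma>) \<le> ennreal (form_const q' p')"
    unfolding H2_def
    by (rule T2.half_form_bound[OF A12(2,4) g f norms(2,1)]) (auto simp: A2_def)
  also have "ennreal (form_const p q) + ennreal (form_const q' p') = ennreal (form_const p q + form_const q' p')"
    by (simp add: form_const_nonneg)
  finally show ?thesis by (simp add: add_left_mono add_right_mono)
qed

text \<open>The bound for finite families does not depend on the family, and the index set is
  countable; monotone convergence is applied in both integrals.\<close>

lemma dyadic_kernel_bound:
  assumes T1: "dyadic_testing X \<rho> A\<^sub>0 \<delta> x\<^sub>0 I Q z \<sigma> \<omega> K p q p' q'"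
    and T2: "dyadic_testing X \<rho> A\<^sub>0 \<delta> x\<^sub>0 I Q z \<omega> \<sigma> (\<lambda>x y. K y x) q' p' q p"
    and f [measurable]: "f \<in> borel_measurable \<sigma>" and g [measurable]: "g \<in> borel_measurable \<omega>"
    and norms: "(\<integral>\<^sup>+x. epowr (f x) p \<partial>\<sigma>) \<le> 1" "(\<integral>\<^sup>+x. epowr (g x) q' \<partial>\<omega>) \<le> 1"
  shows "(\<integral>\<^sup>+x. (\<integral>\<^sup>+y. dyadic_system.dyadic_kernel I Q K (dyadic_system.idx I j) x y * f y \<partial>\<sigma>) * g x \<partial>\<omega>)
     \<le> ennreal (form_const p q + form_const q' p')"
proof -
  interpret T1: dyadic_testing X \<rho> A\<^sub>0 \<delta> x\<^sub>0 I Q z \<sigma> \<omega> K p q p' q' by (rule T1)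
  interpret \<sigma>: sigma_finite_measure \<sigma> by (rule T1.sigma_finite_sigma)
  let ?A = "\<lambda>n::nat. {i\<in>T1.idx j. to_nat i < n}"
  have fin: "finite (?A n)" for n
    by (rule finite_subset[of _ "(to_nat :: int \<times> nat \<Rightarrow> nat) -` {..<n}"]) (auto intro: finite_vimageI)
  have m [measurable]: "(\<lambda>z. T1.dyadic_kernel K (?A n) (fst z) (snd z)) \<in> borel_measurable (\<omega> \<Otimes>\<^sub>M \<sigma>)" for n
    using T1.sets_sigma T1.sets_omega by (intro T1.dyadic_kernel_measurable[of _ j]) auto
  have m' [measurable]: "T1.dyadic_kernel K (?A n) x \<in> borel_measurable \<sigma>" if "x \<in> space \<omega>" for x n
    using measurable_compose[OF measurable_Pair1'[OF that] m] by simp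
  have inc: "T1.dyadic_kernel K (?A n) x y \<le> T1.dyadic_kernel K (?A n') x y" if "n \<le> n'" for x y n n'
    unfolding T1.dyadic_kernel_def using that by (intro SUP_subset_mono) auto
  have sup: "T1.dyadic_kernel K (T1.idx j) x y = (SUP n. T1.dyadic_kernel K (?A n) x y)" for x y
  proof (rule antisym)
    show "T1.dyadic_kernel K (T1.idx j) x y \<le> (SUP n. T1.dyadic_kernel K (?A n) x y)"
      unfolding T1.dyadic_kernel_def[of _ "T1.idx j"]
    proof (rule SUP_least)
      fix i assume "i \<in> T1.idx j"
      then show "indicator (T1.cube i) x * indicator (T1.cube i) y * min (T1.av K i x) (T1.av (\<lambda>x y. K y x) i y)
        \<le> (SUP n. T1.dyadic_kernel K (?A n) x y)"
        by (intro SUP_upper2[of "Suc (to_nat i)"]) (auto simp: T1.dyadic_kernel_def intro!: SUP_upper2[of i])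
    qed
    show "(SUP n. T1.dyadic_kernel K (?A n) x y) \<le> T1.dyadic_kernel K (T1.idx j) x y"
      unfolding T1.dyadic_kernel_def by (intro SUP_least SUP_subset_mono) auto
  qed
  have "(\<integral>\<^sup>+x. (\<integral>\<^sup>+y. T1.dyadic_kernel K (T1.idx j) x y * f y \<partial>\<sigma>) * g x \<partial>\<omega>)
     = (\<integral>\<^sup>+x. (SUP n. (\<integral>\<^sup>+y. T1.dyadic_kernel K (?A n) x y * f y \<partial>\<sigma>) * g x) \<partial>\<omega>)"
  proof (intro nn_integral_cong)
    fix x assume x: "x \<in> space \<omega>"
    have "(\<integral>\<^sup>+y. T1.dyadic_kernel K (T1.idx j) x y * f y \<partial>\<sigma>) = (\<integral>\<^sup>+y. (SUP n. T1.dyadic_kernel K (?A n) x y * f y) \<partial>\<sigma>)"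
      unfolding sup by (simp add: SUP_mult_right_ennreal)
    also have "\<dots> = (SUP n. (\<integral>\<^sup>+y. T1.dyadic_kernel K (?A n) x y * f y \<partial>\<sigma>))"
      using x inc
      by (intro nn_integral_monotone_convergence_SUP) (auto simp: incseq_def le_fun_def intro!: mult_right_mono)
    finally show "(\<integral>\<^sup>+y. T1.dyadic_kernel K (T1.idx j) x y * f y \<partial>\<sigma>) * g x
      = (SUP n. (\<integral>\<^sup>+y. T1.dyadic_kernel K (?A n) x y * f y \<partial>\<sigma>) * g x)"
      by (simp add: SUP_mult_right_ennreal)
  qed
  also have "\<dots> = (SUP n. (\<integral>\<^sup>+x. (\<integral>\<^sup>+y. T1.dyadic_kernel K (?A n) x y * f y \<partial>\<sigma>) * g x \<partial>\<omega>))"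
  proof (intro nn_integral_monotone_convergence_SUP)
    show "incseq (\<lambda>n x. (\<integral>\<^sup>+y. T1.dyadic_kernel K (?A n) x y * f y \<partial>\<sigma>) * g x)"
      using inc by (auto simp: incseq_def le_fun_def intro!: mult_right_mono nn_integral_mono)
    fix n
    have "(\<lambda>x. \<integral>\<^sup>+y. T1.dyadic_kernel K (?A n) (fst (x, y)) (snd (x, y)) * f (snd (x, y)) \<partial>\<sigma>) \<in> borel_measurable \<omega>"
      by (rule \<sigma>.borel_measurable_nn_integral_fst) measurable
    then show "(\<lambda>x. (\<integral>\<^sup>+y. T1.dyadic_kernel K (?A n) x y * f y \<partial>\<sigma>) * g x) \<in> borel_measurable \<omega>" by simp
  qed
  also have "\<dots> \<le> ennreal (form_const p q + form_const q' p')"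
    using fin by (intro SUP_least finite_kernel_bound[OF T1 T2 _ _ f g norms, of _ j]) auto
  finally show ?thesis .
qed

section \<open>Domination by dyadic kernels\<close>

text \<open>Allows a constant to be moved across an infimum, also where the values are
  infinite.\<close>

lemma le_ennreal_mult_iff:
  assumes "0 < c"
  shows "a \<le> ennreal c * b \<longleftrightarrow> a * ennreal (1 / c) \<le> b"
proof -
  have c: "ennreal c * ennreal (1 / c) = 1" using assms by (simp flip: ennreal_mult)
  show ?thesis
  proof
    assume "a \<le> ennreal c * b"
    then have "a * ennreal (1 / c) \<le> ennreal c * b * ennreal (1 / c)" by (rule mult_right_mono) simp
    also have "\<dots> = b" using c by (metis mult.commute mult.left_commute mult.right_neutral)
    finally show "a * ennreal (1 / c) \<le> b" .
  next
    assume "a * ennreal (1 / c) \<le> b"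
    then have "ennreal c * (a * ennreal (1 / c)) \<le> ennreal c * b" by (rule mult_left_mono) simp
    moreover have "ennreal c * (a * ennreal (1 / c)) = a"
      using c by (metis mult.commute mult.left_commute mult.right_neutral)
    ultimately show "a \<le> ennreal c * b" by simp
  qed
qed

lemma potential_kernel_transpose:
  assumes "potential_kernel X \<rho> \<kappa> K" "quasi_metric_space X \<rho> A\<^sub>0"
  shows "potential_kernel X \<rho> \<kappa> (\<lambda>x y. K y x)"
proof -
  interpret potential_kernel X \<rho> \<kappa> K by fact
  interpret quasi_metric_space X \<rho> A\<^sub>0 by fact
  show ?thesis
  proof
    fix k2 x x' y assume a: "1 < k2" "x \<in> X" "x' \<in> X" "y \<in> X" "\<rho> x' y \<le> k2 * \<rho> x y"
    show "K y x \<le> ennreal (\<kappa> k2) * K y x'"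
      using a commute by (intro kernel_right) auto
  next
    fix k2 x y y' assume a: "1 < k2" "x \<in> X" "y \<in> X" "y' \<in> X" "\<rho> x y' \<le> k2 * \<rho> x y"
    show "K y x \<le> ennreal (\<kappa> k2) * K y' x"
      using a commute by (intro kernel_left) auto
  qed (use kappa_gt_1 kernel_finite measurable_left measurable_right in auto)
qed

lemma potential_kernel_scale:
  assumes "potential_kernel X \<rho> \<kappa> K" "c \<noteq> top"
  shows "potential_kernel X \<rho> \<kappa> (\<lambda>x y. c * K x y)"
proof -
  interpret potential_kernel X \<rho> \<kappa> K by fact
  show ?thesis
  proof
    fix k2 x x' y assume a: "1 < k2" "x \<in> X" "x' \<in> X" "y \<in> X" "\<rho> x' y \<le> k2 * \<rho> x y"
    show "c * K x y \<le> ennreal (\<kappa> k2) * (c * K x' y)"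
      unfolding mult.left_commute[of _ c] using a by (intro mult_left_mono kernel_left) auto
  next
    fix k2 x y y' assume a: "1 < k2" "x \<in> X" "y \<in> X" "y' \<in> X" "\<rho> x y' \<le> k2 * \<rho> x y"
    show "c * K x y \<le> ennreal (\<kappa> k2) * (c * K x y')"
      unfolding mult.left_commute[of _ c] using a by (intro mult_left_mono kernel_right) auto
  next
    fix x y assume "x \<in> X" "y \<in> X" "x \<noteq> y"
    then show "c * K x y < \<infinity>"
      using kernel_finite assms(2) by (simp add: ennreal_mult_less_top less_top)
  qed (use kappa_gt_1 measurable_left measurable_right in auto)
qed

section \<open>Scales, null functions and point masses\<close>

lemma scale_exists:
  fixes \<delta> r :: real
  assumes "0 < \<delta>" "\<delta> < 1" "0 < r"
  shows "\<exists>k. \<delta> powi (k + 2) < r \<and> r \<le> \<delta> powi (k + 1)"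
proof -
  \<comment> \<open>The exponent with r = \<delta>^e. As \<delta> < 1 reverses the order, its floor
    corresponds to the generation k + 1.\<close>
  define e where "e = ln r / ln \<delta>"
  have "ln \<delta> < 0" using assms by simp
  then have r: "r = \<delta> powr e" using assms by (simp add: e_def powr_def)
  have "\<delta> powr real_of_int (\<lfloor>e\<rfloor> + 1) < \<delta> powr e"
    using assms by (intro powr_less_mono') linarith+
  moreover have "\<delta> powr e \<le> \<delta> powr real_of_int \<lfloor>e\<rfloor>"
    using assms by (intro powr_mono') auto
  moreover have "\<delta> powr real_of_int n = \<delta> powi n" for n
    using assms by (intro powr_real_of_int') auto
  ultimately have "\<delta> powi (\<lfloor>e\<rfloor> + 1) < r" "r \<le> \<delta> powi \<lfloor>e\<rfloor>" unfolding r by metis+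
  then show ?thesis by (intro exI[of _ "\<lfloor>e\<rfloor> - 1"]) (simp add: add.commute)
qed

lemma small_scale_exists:
  fixes \<delta> r :: real
  assumes "0 < \<delta>" "\<delta> < 1" "0 < r"
  shows "\<exists>k. \<delta> powi k < r"
  using scale_exists[OF assms] by blast

lemma epowr_le_self: "x \<le> 1 \<Longrightarrow> 1 \<le> r \<Longrightarrow> epowr x r \<le> x"
proof (cases x)
  case (real u)
  assume "x \<le> 1" "1 \<le> r"
  then have "u \<le> 1" using real by simp
  then have "u powr r \<le> u powr 1"
    using powr_mono'[of 1 r u] real \<open>1 \<le> r\<close> by (cases "u = 0") auto
  then show ?thesis using real by (simp add: epowr_ennreal ennreal_leI)
qed (auto simp: top_unique)

lemma Lp_norm_eq_0_AE:
  assumes "f \<in> borel_measurable \<mu>" "Lp_norm p \<mu> f = 0" "0 < p"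
  shows "AE x in \<mu>. f x = 0"
proof -
  have "(\<integral>\<^sup>+x. epowr (f x) p \<partial>\<mu>) = 0" using assms by (simp add: Lp_norm_def)
  then show ?thesis using assms by (subst (asm) nn_integral_0_iff_AE) auto
qed

lemma potential_op_AE_0:
  assumes "AE y in \<sigma>. f y = 0"
  shows "potential_op K \<sigma> f x = 0"
proof -
  have "(\<integral>\<^sup>+y. K x y * f y \<partial>\<sigma>) = (\<integral>\<^sup>+y. 0 \<partial>\<sigma>)"
    using assms by (intro nn_integral_cong_AE) auto
  then show ?thesis by (simp add: potential_op_def)
qed

lemma diagonal_le_integral:
  assumes "{x} \<in> sets \<mu>"
  shows "k x * f x * emeasure \<mu> {x} \<le> (\<integral>\<^sup>+y. k y * f y \<partial>\<mu>)"
proof -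
  have "k x * f x * emeasure \<mu> {x} = (\<integral>\<^sup>+y. k x * f x * indicator {x} y \<partial>\<mu>)"
    using assms by (simp add: nn_integral_cmult_indicator)
  also have "\<dots> \<le> (\<integral>\<^sup>+y. k y * f y \<partial>\<mu>)"
    by (intro nn_integral_mono) (auto split: split_indicator)
  finally show ?thesis .
qed

lemma nn_integral_sum_sum:
  assumes "\<And>t j. t \<in> A \<Longrightarrow> h t j \<in> borel_measurable M"
  shows "(\<integral>\<^sup>+x. (\<Sum>t\<in>A. \<Sum>j\<in>B. h t j x) \<partial>M) = (\<Sum>t\<in>A. \<Sum>j\<in>B. (\<integral>\<^sup>+x. h t j x \<partial>M))"
proof -
  have "(\<integral>\<^sup>+x. (\<Sum>t\<in>A. \<Sum>j\<in>B. h t j x) \<partial>M) = (\<Sum>t\<in>A. (\<integral>\<^sup>+x. (\<Sum>j\<in>B. h t j x) \<partial>M))"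
    using assms by (intro nn_integral_sum borel_measurable_sum) auto
  also have "\<dots> = (\<Sum>t\<in>A. \<Sum>j\<in>B. (\<integral>\<^sup>+x. h t j x \<partial>M))"
    using assms by (intro sum.cong refl nn_integral_sum) auto
  finally show ?thesis .
qed

text \<open>The testing condition with constant 1, in q-th powers and multiplied out, so that cubes
  of measure zero need no convention.\<close>

definition testing_le ::
  "nat \<Rightarrow> (nat \<Rightarrow> int \<Rightarrow> nat set) \<Rightarrow> (nat \<Rightarrow> int \<Rightarrow> nat \<Rightarrow> 'a set) \<Rightarrow> 'a measure \<Rightarrow> 'a measure \<Rightarrow>
   ('a \<Rightarrow> 'a \<Rightarrow> ennreal) \<Rightarrow> real \<Rightarrow> real \<Rightarrow> bool" where
  "testing_le L I Q \<mu> \<nu> K p q \<longleftrightarrow> (\<forall>R\<in>dyadic_cubes L I Q.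
     (\<integral>\<^sup>+x. epowr (indicator R x * (\<integral>\<^sup>+y. K x y * indicator R y \<partial>\<mu>)) q \<partial>\<nu>) \<le> epowr (emeasure \<mu> R) (q / p))"

section \<open>Cubes and weights in adjacent systems\<close>

locale adjacent_weights = doubling_space X \<rho> A\<^sub>0 A\<^sub>1 + adjacent_dyadic_systems X \<rho> A\<^sub>0 \<delta> x\<^sub>0 L I Q z
  for X :: "'a set" and \<rho> :: "'a \<Rightarrow> 'a \<Rightarrow> real" and A\<^sub>0 :: real and A\<^sub>1 :: nat
    and \<delta> :: real and x\<^sub>0 :: 'a and L :: nat
    and I :: "nat \<Rightarrow> int \<Rightarrow> nat set" and Q :: "nat \<Rightarrow> int \<Rightarrow> nat \<Rightarrow> 'a set"
    and z :: "nat \<Rightarrow> int \<Rightarrow> nat \<Rightarrow> 'a" +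
  fixes \<sigma> \<omega> :: "'a measure"
  assumes x0: "x\<^sub>0 \<in> X" and delta: "0 < \<delta>" "\<delta> < 1" "96 * A\<^sub>0 ^ 6 * \<delta> \<le> 1"
    and sigma: "locally_finite_borel_measure X \<rho> \<sigma>" and omega: "locally_finite_borel_measure X \<rho> \<omega>"
begin

text \<open>Through this symmetry every result for the pair of weights is also available for the
  adjoint.\<close>

lemma swap: "adjacent_weights X \<rho> A\<^sub>0 A\<^sub>1 \<delta> x\<^sub>0 L I Q z \<omega> \<sigma>"
  by unfold_locales (fact x0 delta sigma omega)+

lemma lf_sets: "locally_finite_borel_measure X \<rho> \<mu> \<Longrightarrow> sets \<mu> = sets (qborel X \<rho>)"
  and lf_space: "locally_finite_borel_measure X \<rho> \<mu> \<Longrightarrow> space \<mu> = X"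
  by (auto simp: locally_finite_borel_measure_def)

lemma cube_diam:
  assumes t: "t \<in> {1..L}" "\<alpha> \<in> I t k" and uv: "u \<in> Q t k \<alpha>" "v \<in> Q t k \<alpha>"
  shows "\<rho> u v \<le> 8 * A\<^sub>0 ^ 3 * \<delta> powi k"
proof -
  interpret dyadic_system X \<rho> A\<^sub>0 \<delta> x\<^sub>0 "I t" "Q t" "z t" by (rule system[OF t(1)])
  have b: "u \<in> X" "v \<in> X" "\<rho> u (z t k \<alpha>) < 4 * A\<^sub>0 ^ 2 * \<delta> powi k" "\<rho> v (z t k \<alpha>) < 4 * A\<^sub>0 ^ 2 * \<delta> powi k"
    using outer_ball[OF t(2)] uv by (auto simp: qball_def)
  have "\<rho> u v \<le> A\<^sub>0 * (\<rho> u (z t k \<alpha>) + \<rho> (z t k \<alpha>) v)"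
    using b center[OF t(2)] by (intro quasi_triangle)
  also have "\<dots> \<le> A\<^sub>0 * (4 * A\<^sub>0 ^ 2 * \<delta> powi k + 4 * A\<^sub>0 ^ 2 * \<delta> powi k)"
    using b(3,4) commute[OF center[OF t(2)] b(2)] A0_ge_1
    by (intro mult_left_mono add_mono) (auto simp only: less_imp_le)
  also have "\<dots> = 8 * A\<^sub>0 ^ 3 * \<delta> powi k" by (simp add: power3_eq_cube power2_eq_square)
  finally show ?thesis .
qed

lemma cube_finite:
  assumes \<mu>: "locally_finite_borel_measure X \<rho> \<mu>" and t: "t \<in> {1..L}" "\<alpha> \<in> I t k"
  shows "emeasure \<mu> (Q t k \<alpha>) \<noteq> top"
proof -
  interpret dyadic_system X \<rho> A\<^sub>0 \<delta> x\<^sub>0 "I t" "Q t" "z t" by (rule system[OF t(1)])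
  have pos: "0 < 4 * A\<^sub>0 ^ 2 * \<delta> powi k" using A0_ge_1 delta by simp
  have "emeasure \<mu> (Q t k \<alpha>) \<le> emeasure \<mu> (qball X \<rho> (z t k \<alpha>) (4 * A\<^sub>0 ^ 2 * \<delta> powi k))"
    using outer_ball[OF t(2)] ball_measurable[OF center[OF t(2)] pos] lf_sets[OF \<mu>]
    by (intro emeasure_mono) auto
  also have "\<dots> < top" using \<mu> center[OF t(2)] pos by (simp add: locally_finite_borel_measure_def)
  finally show ?thesis by simp
qed

lemma cube_sets: "locally_finite_borel_measure X \<rho> \<mu> \<Longrightarrow> t \<in> {1..L} \<Longrightarrow> \<alpha> \<in> I t k \<Longrightarrow> Q t k \<alpha> \<in> sets \<mu>"
  using dyadic_system.cube_borel[OF system] lf_sets by blast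

lemma lf_sigma_finite:
  assumes \<mu>: "locally_finite_borel_measure X \<rho> \<mu>"
  shows "sigma_finite_measure \<mu>"
proof
  let ?A = "range (\<lambda>n::nat. qball X \<rho> x\<^sub>0 (of_nat (Suc n)))"
  have "(\<Union>?A) = X"
  proof
    show "X \<subseteq> \<Union>?A"
    proof
      fix x assume x: "x \<in> X"
      obtain n :: nat where "\<rho> x x\<^sub>0 < of_nat n" using reals_Archimedean2 by blast
      then have "x \<in> qball X \<rho> x\<^sub>0 (of_nat (Suc n))" using x by (auto simp: qball_def)
      then show "x \<in> \<Union>?A" by blast
    qed
  qed (auto simp: qball_def)
  then show "\<exists>A. countable A \<and> A \<subseteq> sets \<mu> \<and> \<Union>A = space \<mu> \<and> (\<forall>a\<in>A. emeasure \<mu> a \<noteq> \<infinity>)"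
    using \<mu> ball_measurable[OF x0] x0
    by (intro exI[of _ ?A]) (auto simp: locally_finite_borel_measure_def less_top[symmetric])
qed

lemma weights: "pair_of_weights X \<rho> \<sigma> \<omega>"
  by (intro pair_of_weights.intro lf_sets lf_sigma_finite sigma omega)

lemma singleton_eq_Inter_balls:
  assumes x: "x \<in> X"
  shows "(\<Inter>n::nat. qball X \<rho> x (1 / of_nat (Suc n))) = {x}"
proof
  show "{x} \<subseteq> (\<Inter>n::nat. qball X \<rho> x (1 / of_nat (Suc n)))"
    using x zero_iff[of x x] by (auto simp: qball_def)
  show "(\<Inter>n::nat. qball X \<rho> x (1 / of_nat (Suc n))) \<subseteq> {x}"
  proof
    fix y assume y: "y \<in> (\<Inter>n::nat. qball X \<rho> x (1 / of_nat (Suc n)))"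
    then have yX: "y \<in> X" and lt: "\<rho> y x < 1 / of_nat (Suc n)" for n by (auto simp: qball_def)
    have "\<rho> y x \<le> 0"
    proof (rule ccontr)
      assume "\<not> \<rho> y x \<le> 0"
      then obtain n :: nat where "inverse (of_nat (Suc n)) < \<rho> y x" using reals_Archimedean by (metis not_le)
      then show False using lt[of n] by (simp add: inverse_eq_divide)
    qed
    then show "y \<in> {x}" using nonneg[OF yX x] zero_iff[OF yX x] by auto
  qed
qed

lemma ball_sets: "locally_finite_borel_measure X \<rho> \<mu> \<Longrightarrow> x \<in> X \<Longrightarrow> 0 < r \<Longrightarrow> qball X \<rho> x r \<in> sets \<mu>"
  using ball_measurable lf_sets by blast

lemma singleton_sets:
  assumes \<mu>: "locally_finite_borel_measure X \<rho> \<mu>" and x: "x \<in> X"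
  shows "{x} \<in> sets \<mu>"
  unfolding singleton_eq_Inter_balls[OF x, symmetric]
  using ball_sets[OF \<mu> x] by (intro sets.countable_INT) auto

text \<open>The measures of shrinking balls decrease to the mass of the point. As this mass is
  positive and finite, some ball has less than twice the mass, and it contains every cube around x
  of sufficiently small diameter.\<close>

lemma small_cube:
  assumes \<mu>: "locally_finite_borel_measure X \<rho> \<mu>" and x: "x \<in> X" and t: "t \<in> {1..L}"
    and pos: "emeasure \<mu> {x} \<noteq> 0"
  shows "\<exists>k. \<exists>\<alpha>\<in>I t k. x \<in> Q t k \<alpha> \<and> emeasure \<mu> (Q t k \<alpha>) \<le> 2 * emeasure \<mu> {x}"
proof -
  interpret dyadic_system X \<rho> A\<^sub>0 \<delta> x\<^sub>0 "I t" "Q t" "z t" by (rule system[OF t])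
  let ?B = "\<lambda>n::nat. qball X \<rho> x (1 / of_nat (Suc n))"
  have B: "?B n \<in> sets \<mu>" "emeasure \<mu> (?B n) \<noteq> \<infinity>" for n
    using ball_sets[OF \<mu> x] \<mu> x by (auto simp: locally_finite_borel_measure_def less_top[symmetric])
  have "decseq ?B"
  proof (intro decseq_SucI subsetI)
    fix n :: nat and y assume y: "y \<in> ?B (Suc n)"
    have "(1::real) / of_nat (Suc (Suc n)) \<le> 1 / of_nat (Suc n)" by (simp add: field_simps)
    then show "y \<in> ?B n" using y unfolding qball_def by auto
  qed
  then have "(INF n. emeasure \<mu> (?B n)) = emeasure \<mu> (\<Inter>n. ?B n)"
    using B by (intro INF_emeasure_decseq) auto
  also have "\<dots> = emeasure \<mu> {x}" by (simp only: singleton_eq_Inter_balls[OF x])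
  also have "\<dots> < 2 * emeasure \<mu> {x}"
  proof -
    have "emeasure \<mu> {x} \<le> emeasure \<mu> (?B 0)"
      using B(1)[of 0] singleton_eq_Inter_balls[OF x] by (intro emeasure_mono) blast+
    then have "emeasure \<mu> {x} \<noteq> top" using B(2)[of 0] by (auto simp: top_unique)
    then show ?thesis using pos
      by (cases "emeasure \<mu> {x}") (auto simp: ennreal_less_iff simp flip: ennreal_mult'' ennreal_numeral)
  qed
  finally obtain n where n: "emeasure \<mu> (?B n) < 2 * emeasure \<mu> {x}" by (auto simp: INF_less_iff)
  have "0 < 1 / of_nat (Suc n) / (8 * A\<^sub>0 ^ 3)" using A0_ge_1 by simp
  then obtain k where k0: "\<delta> powi k < 1 / of_nat (Suc n) / (8 * A\<^sub>0 ^ 3)"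
    using small_scale_exists[OF delta(1,2)] by blast
  have "0 < 8 * A\<^sub>0 ^ 3" using A0_ge_1 by simp
  from pos_less_divide_eq[THEN iffD1, OF this k0]
  have k: "8 * A\<^sub>0 ^ 3 * \<delta> powi k < 1 / of_nat (Suc n)"
    by (simp only: mult.commute)
  obtain \<alpha> where \<alpha>: "\<alpha> \<in> I t k" "x \<in> Q t k \<alpha>" using cube_exists[OF x] by blast
  have "Q t k \<alpha> \<subseteq> ?B n"
    using cube_diam[OF t \<alpha>(1) _ \<alpha>(2)] k cube_subset[OF \<alpha>(1)] unfolding qball_def by fastforce
  then have "emeasure \<mu> (Q t k \<alpha>) \<le> emeasure \<mu> (?B n)" using B by (intro emeasure_mono) auto
  then show ?thesis using n \<alpha> by (intro exI[of _ k] bexI[of _ \<alpha>]) auto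
qed

text \<open>The cube that must contain some ball around \<open>x\<^sub>0\<close> can only come from
  a nonempty collection of systems.\<close>

lemma L_pos: "1 \<in> {1..L}"
proof -
  obtain k where "\<delta> powi (k + 2) < 1" "1 \<le> \<delta> powi (k + 1)" using scale_exists[OF delta(1,2), of 1] by auto
  then show ?thesis using ball_in_cube[OF x0, of k 1] by auto
qed

text \<open>A cube of generation k has diameter at most 8 \<open>A\<^sub>0\<close>^3 \<delta>^k. If
  \<delta>^(k+2) < 2 \<open>\<rho> x y\<close>, this is at most \<open>D\<close> times
  \<open>\<rho> x y\<close>. The second ratio \<open>2 * A\<^sub>0 * D\<close> is what remains after
  x has been moved.\<close>

definition D :: real where "D = 16 * A\<^sub>0 ^ 3 / \<delta> ^ 2"

lemma D_gt_1: "1 < D" "1 < 2 * A\<^sub>0 * D"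
proof -
  have "1 \<le> A\<^sub>0 ^ 3" using A0_ge_1 by simp
  moreover have "\<delta> ^ 2 \<le> 1" "0 < \<delta> ^ 2" using delta by (auto intro: power_le_one)
  ultimately show "1 < D" unfolding D_def by (simp add: pos_less_divide_eq)
  then have "1 * 1 \<le> A\<^sub>0 * D" using A0_ge_1 by (intro mult_mono) auto
  then show "1 < 2 * A\<^sub>0 * D" by simp
qed

text \<open>The pair \<open>(x, y)\<close> may be moved to any \<open>(x', y')\<close> with \<open>x'\<close> in the cube of generation
  \<open>k + 3\<close> around \<open>x\<close>, since \<open>x'\<close> then stays away from \<open>y\<close>. It may not be moved to an arbitrary
  point of \<open>Q t k \<alpha> \<times> Q t k \<alpha>\<close>: \<open>K x y\<close> and \<open>K y x\<close> need not be comparable.\<close>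
lemma kernel_le_inf_kernel:
  assumes K: "potential_kernel X \<rho> \<kappa> K" and t: "t \<in> {1..L}" "\<alpha> \<in> I t k"
    and xy: "x \<in> Q t k \<alpha>" "y \<in> Q t k \<alpha>" "x \<noteq> y" and far: "\<delta> powi (k + 2) < 2 * \<rho> x y"
  shows "K x y \<le> ennreal (\<kappa> D * \<kappa> (2 * A\<^sub>0 * D)) * inf_kernel K (I t) (Q t) (k, \<alpha>) x"
proof -
  interpret dyadic_system X \<rho> A\<^sub>0 \<delta> x\<^sub>0 "I t" "Q t" "z t" by (rule system[OF t(1)])
  interpret potential_kernel X \<rho> \<kappa> K by (rule K)
  have X: "x \<in> X" "y \<in> X" using xy cube_subset[OF t(2)] by auto
  obtain \<beta> where \<beta>: "\<beta> \<in> I t (k + 3)" "x \<in> Q t (k + 3) \<beta>" using cube_exists[OF X(1)] by blast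
  have kpos: "1 < \<kappa> D" "1 < \<kappa> (2 * A\<^sub>0 * D)" using kappa_gt_1 D_gt_1 by auto
  let ?r = "\<rho> x y"
  have r: "0 < ?r" using nonneg[OF X] zero_iff[OF X] xy by auto
  have pk2: "\<delta> powi (k + 2) = \<delta> powi k * \<delta> ^ 2" using delta by (simp add: power_int_add power_int_numeral)
  have pk3: "\<delta> powi (k + 3) = \<delta> powi (k + 2) * \<delta>"
    using delta power_int_add_1[of \<delta> "k + 2"] by (simp add: add.assoc)
  have big: "\<rho> u v \<le> D * ?r" if "u \<in> Q t k \<alpha>" "v \<in> Q t k \<alpha>" for u v
  proof -
    have "\<delta> powi k \<le> 2 * ?r / \<delta> ^ 2"
      using far delta unfolding pk2 by (simp add: pos_le_divide_eq)
    then have "8 * A\<^sub>0 ^ 3 * \<delta> powi k \<le> 8 * A\<^sub>0 ^ 3 * (2 * ?r / \<delta> ^ 2)"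
      using A0_ge_1 by (intro mult_left_mono) auto
    also have "\<dots> = D * ?r" by (simp add: D_def)
    finally show ?thesis using cube_diam[OF t that] by simp
  qed
  \<comment> \<open>This needs one generation more than the scale of \<open>\<rho> x y\<close>: the
    additional factor \<delta> beats the powers of \<open>A\<^sub>0\<close> by the condition 96
    \<open>A\<^sub>0\<close>^6 \<delta> \<le> 1.\<close>
  have small: "A\<^sub>0 * \<rho> u v \<le> ?r / 2" if "u \<in> Q t (k + 3) \<beta>" "v \<in> Q t (k + 3) \<beta>" for u v
  proof -
    have "A\<^sub>0 * \<rho> u v \<le> A\<^sub>0 * (8 * A\<^sub>0 ^ 3 * (\<delta> powi (k + 2) * \<delta>))"
      using cube_diam[OF t(1) \<beta>(1) that] A0_ge_1 unfolding pk3 by (intro mult_left_mono) auto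
    also have "\<dots> = 8 * A\<^sub>0 ^ 4 * \<delta> * \<delta> powi (k + 2)" by (simp add: power4_eq_xxxx power3_eq_cube)
    also have "\<dots> \<le> 8 * A\<^sub>0 ^ 4 * \<delta> * (2 * ?r)"
      using far A0_ge_1 delta by (intro mult_left_mono) auto
    also have "\<dots> = (32 * A\<^sub>0 ^ 4 * \<delta>) * (?r / 2)" by simp
    also have "\<dots> \<le> 1 * (?r / 2)"
    proof (intro mult_right_mono)
      have "A\<^sub>0 ^ 4 \<le> A\<^sub>0 ^ 6" using A0_ge_1 by (intro power_increasing) auto
      moreover have "0 \<le> A\<^sub>0 ^ 6" using A0_ge_1 by simp
      ultimately have "32 * A\<^sub>0 ^ 4 \<le> 96 * A\<^sub>0 ^ 6" by linarith
      then have "32 * A\<^sub>0 ^ 4 * \<delta> \<le> 96 * A\<^sub>0 ^ 6 * \<delta>" using delta by (intro mult_right_mono) auto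
      then show "32 * A\<^sub>0 ^ 4 * \<delta> \<le> 1" using delta(3) by linarith
    qed (use r in auto)
    finally show ?thesis by simp
  qed
  have sub: "Q t (k + 3) \<beta> \<subseteq> Q t k \<alpha>"
    using cube_nested[of k "k + 3" \<alpha> \<beta> x] t \<beta> xy by auto
  have main: "K x y \<le> ennreal (\<kappa> D * \<kappa> (2 * A\<^sub>0 * D)) * K x' y'"
    if x': "x' \<in> Q t (k + 3) \<beta>" and y': "y' \<in> Q t k \<alpha>" for x' y'
  proof -
    have X': "x' \<in> X" "y' \<in> X" "x' \<in> Q t k \<alpha>" using x' y' sub cube_subset[OF t(2)] by auto
    have "K x y \<le> ennreal (\<kappa> D) * K x' y"
      using X X' D_gt_1 big[OF X'(3) xy(2)] by (intro kernel_left) auto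
    also have "\<dots> \<le> ennreal (\<kappa> D) * (ennreal (\<kappa> (2 * A\<^sub>0 * D)) * K x' y')"
    \<comment> \<open>Moving y requires a lower bound for \<open>\<rho> x' y\<close>. By the
      quasi-triangle inequality half of \<open>\<rho> x y\<close> is left over for it.\<close>
    proof (intro mult_left_mono kernel_right)
      have "?r \<le> A\<^sub>0 * \<rho> x x' + A\<^sub>0 * \<rho> x' y"
        using quasi_triangle[OF X X'(1)] by (simp add: distrib_left)
      then have "?r \<le> 2 * A\<^sub>0 * \<rho> x' y" using small[OF \<beta>(2) x'] by simp
      then have "D * ?r \<le> D * (2 * A\<^sub>0 * \<rho> x' y)" using D_gt_1 by (intro mult_left_mono) auto
      then show "\<rho> x' y' \<le> 2 * A\<^sub>0 * D * \<rho> x' y" using big[OF X'(3) y'] by (simp add: ac_simps)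
    qed (use X X' D_gt_1 in auto)
    finally show ?thesis using kpos by (simp add: ennreal_mult mult.assoc)
  qed
  have av: "inf_kernel K (I t) (Q t) (k, \<alpha>) x = (INF x'\<in>Q t (k + 3) \<beta>. INF y'\<in>Q t k \<alpha>. K x' y')"
    using av_eq[of \<beta> "(k, \<alpha>)" x K] \<beta> by simp
  have "K x y * ennreal (1 / (\<kappa> D * \<kappa> (2 * A\<^sub>0 * D))) \<le> inf_kernel K (I t) (Q t) (k, \<alpha>) x"
    unfolding av
    using main kpos by (intro INF_greatest) (simp add: le_ennreal_mult_iff[symmetric])
  then show ?thesis using kpos by (simp add: le_ennreal_mult_iff)
qed

definition DK :: "('a \<Rightarrow> 'a \<Rightarrow> ennreal) \<Rightarrow> nat \<Rightarrow> int \<Rightarrow> 'a \<Rightarrow> 'a \<Rightarrow> ennreal" where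
  "DK K t j = dyadic_system.dyadic_kernel (I t) (Q t) K (dyadic_system.idx (I t) j)"

lemma DK_le: "t \<in> {1..L} \<Longrightarrow> DK K t j x y \<le> K x y"
  unfolding DK_def by (rule dyadic_system.dyadic_kernel_le[OF system order.refl])

lemma DK_measurable [measurable]:
  assumes "t \<in> {1..L}" "locally_finite_borel_measure X \<rho> \<mu>" "locally_finite_borel_measure X \<rho> \<nu>"
  shows "(\<lambda>z. DK K t j (fst z) (snd z)) \<in> borel_measurable (\<mu> \<Otimes>\<^sub>M \<nu>)"
  unfolding DK_def using lf_sets assms
  by (intro dyadic_system.dyadic_kernel_measurable[OF system order.refl]) auto

text \<open>The ball around x of radius 2 \<open>\<rho> x y\<close> contains y, the factor 2 being
  due to the strict inequality in balls. A cube of comparable size contains this ball, and there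
  both entries of the minimum are comparable to \<open>K x y\<close>, the second one by
  transposition.\<close>

lemma kernel_le_sum_DK:
  assumes K: "potential_kernel X \<rho> \<kappa> K" and xy: "x \<in> X" "y \<in> X" "x \<noteq> y"
  shows "K x y \<le> ennreal (\<kappa> D * \<kappa> (2 * A\<^sub>0 * D)) * (\<Sum>t\<in>{1..L}. \<Sum>j\<in>{0..2}. DK K t j x y)"
proof -
  have r: "0 < \<rho> x y" using nonneg[OF xy(1,2)] zero_iff[OF xy(1,2)] xy by auto
  then obtain k where k: "\<delta> powi (k + 2) < 2 * \<rho> x y" "2 * \<rho> x y \<le> \<delta> powi (k + 1)"
    using scale_exists[OF delta(1,2), of "2 * \<rho> x y"] by auto
  obtain t \<alpha> where t: "t \<in> {1..L}" "\<alpha> \<in> I t k" and sub: "qball X \<rho> x (2 * \<rho> x y) \<subseteq> Q t k \<alpha>"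
    using ball_in_cube[OF xy(1) k] by blast
  have xyQ: "x \<in> Q t k \<alpha>" "y \<in> Q t k \<alpha>"
    using sub r xy zero_iff[of x x] commute[of x y] by (auto simp: qball_def)
  interpret dyadic_system X \<rho> A\<^sub>0 \<delta> x\<^sub>0 "I t" "Q t" "z t" by (rule system[OF t(1)])
  let ?c = "ennreal (\<kappa> D * \<kappa> (2 * A\<^sub>0 * D))"
  have 1: "K x y \<le> ?c * inf_kernel K (I t) (Q t) (k, \<alpha>) x"
    by (rule kernel_le_inf_kernel[OF K t xyQ xy(3) k(1)])
  have 2: "K x y \<le> ?c * inf_kernel (\<lambda>x y. K y x) (I t) (Q t) (k, \<alpha>) y"
    using kernel_le_inf_kernel[OF potential_kernel_transpose[OF K quasi_metric_space_axioms] t xyQ(2,1)] xy k(1)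
      commute[OF xy(1,2)] by auto
  have "K x y \<le> ?c * min (inf_kernel K (I t) (Q t) (k, \<alpha>) x) (inf_kernel (\<lambda>x y. K y x) (I t) (Q t) (k, \<alpha>) y)"
    using 1 2 by (simp add: min_def)
  also have "\<dots> \<le> ?c * DK K t (k mod 3) x y"
    unfolding DK_def dyadic_kernel_def using t(2) xyQ
    by (intro mult_left_mono SUP_upper2[of "(k, \<alpha>)"]) (auto simp: idx_def cube_def)
  also have "\<dots> \<le> ?c * (\<Sum>t\<in>{1..L}. \<Sum>j\<in>{0..2}. DK K t j x y)"
  proof (intro mult_left_mono)
    have "DK K t (k mod 3) x y \<le> (\<Sum>j\<in>{0..2}. DK K t j x y)"
      using pos_mod_bound[of 3 k] by (intro member_le_sum[of "k mod 3"]) auto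
    also have "\<dots> \<le> (\<Sum>t\<in>{1..L}. \<Sum>j\<in>{0..2}. DK K t j x y)"
      using t(1) by (intro member_le_sum[of t "{1..L}" "\<lambda>t. \<Sum>j\<in>{0..2}. DK K t j x y"]) auto
    finally show "DK K t (k mod 3) x y \<le> (\<Sum>t\<in>{1..L}. \<Sum>j\<in>{0..2}. DK K t j x y)" .
  qed simp
  finally show ?thesis .
qed

section \<open>Atoms and the diagonal\<close>

lemma countable_atoms:
  assumes \<mu>: "locally_finite_borel_measure X \<rho> \<mu>"
  shows "countable {x\<in>X. emeasure \<mu> {x} \<noteq> 0}"
  using sigma_finite_measure.countable_atoms[OF lf_sigma_finite[OF \<mu>]] singleton_sets[OF \<mu>] lf_space[OF \<mu>]
  by auto

text \<open>The function vanishes outside a countable set of measurable points, so h may be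
  arbitrary, in particular a diagonal value of \<open>K\<close>.\<close>

lemma atomic_measurable:
  assumes \<mu>: "locally_finite_borel_measure X \<rho> \<mu>" and \<nu>: "locally_finite_borel_measure X \<rho> \<nu>"
  shows "(\<lambda>x. h x * emeasure \<mu> {x} :: ennreal) \<in> borel_measurable \<nu>"
  by (rule measurable_discrete_difference[where f = "\<lambda>_. 0" and X = "{x\<in>X. emeasure \<mu> {x} \<noteq> 0}"])
     (use countable_atoms[OF \<mu>] singleton_sets[OF \<nu>] lf_space[OF \<nu>] in auto)

text \<open>Formulated for one section \<open>k\<close> of the kernel, so that it serves both
  \<open>K x\<close> as a function of y and \<open>K\<close> at fixed y as a function of x. The
  point x itself is charged by its mass.\<close>

lemma nn_integral_le_off_diagonal:
  fixes k :: "'a \<Rightarrow> ennreal" and d :: "nat \<Rightarrow> int \<Rightarrow> 'a \<Rightarrow> ennreal"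
  assumes \<mu>: "locally_finite_borel_measure X \<rho> \<mu>" and x: "x \<in> X"
    and f [measurable]: "f \<in> borel_measurable \<mu>"
    and d [measurable]: "\<And>t j. t \<in> {1..L} \<Longrightarrow> d t j \<in> borel_measurable \<mu>"
    and le: "\<And>y. y \<in> X \<Longrightarrow> y \<noteq> x \<Longrightarrow> k y \<le> c * (\<Sum>t\<in>{1..L}. \<Sum>j\<in>{0..2}. d t j y)"
  shows "(\<integral>\<^sup>+y. k y * f y \<partial>\<mu>) \<le> c * (\<Sum>t\<in>{1..L}. \<Sum>j\<in>{0..2}. (\<integral>\<^sup>+y. d t j y * f y \<partial>\<mu>)) + k x * f x * emeasure \<mu> {x}"
proof -
  note [measurable] = singleton_sets[OF \<mu> x]
  have "(\<integral>\<^sup>+y. k y * f y \<partial>\<mu>)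
     \<le> (\<integral>\<^sup>+y. c * (\<Sum>t\<in>{1..L}. \<Sum>j\<in>{0..2}. d t j y * f y) + k x * f x * indicator {x} y \<partial>\<mu>)"
  proof (intro nn_integral_mono)
    fix y assume "y \<in> space \<mu>"
    then have y: "y \<in> X" using lf_space[OF \<mu>] by simp
    show "k y * f y \<le> c * (\<Sum>t\<in>{1..L}. \<Sum>j\<in>{0..2}. d t j y * f y) + k x * f x * indicator {x} y"
    proof (cases "y = x")
      case False
      have "k y * f y \<le> c * (\<Sum>t\<in>{1..L}. \<Sum>j\<in>{0..2}. d t j y) * f y"
        using le[OF y False] by (rule mult_right_mono) simp
      also have "\<dots> = c * (\<Sum>t\<in>{1..L}. \<Sum>j\<in>{0..2}. d t j y * f y)"
        by (simp only: sum_distrib_right mult.assoc)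
      finally show ?thesis by (rule order.trans) simp
    qed (simp add: add_increasing)
  qed
  also have "\<dots> = (\<integral>\<^sup>+y. c * (\<Sum>t\<in>{1..L}. \<Sum>j\<in>{0..2}. d t j y * f y) \<partial>\<mu>) + k x * f x * emeasure \<mu> {x}"
    by (subst nn_integral_add) (auto simp: nn_integral_cmult_indicator)
  also have "(\<integral>\<^sup>+y. c * (\<Sum>t\<in>{1..L}. \<Sum>j\<in>{0..2}. d t j y * f y) \<partial>\<mu>)
     = c * (\<Sum>t\<in>{1..L}. \<Sum>j\<in>{0..2}. (\<integral>\<^sup>+y. d t j y * f y \<partial>\<mu>))"
    by (subst nn_integral_cmult, measurable) (subst nn_integral_sum_sum, auto)
  finally show ?thesis .
qed

section \<open>Measurability and exchange of integrals\<close>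

lemma DK_measurable_fst:
  assumes t: "t \<in> {1..L}" and \<mu>: "locally_finite_borel_measure X \<rho> \<mu>" and y: "y \<in> X"
  shows "(\<lambda>x. DK K t j x y) \<in> borel_measurable \<mu>"
proof -
  have "y \<in> space \<sigma>" using y lf_space[OF sigma] by simp
  from measurable_compose[OF measurable_Pair2'[OF this] DK_measurable[OF t \<mu> sigma]] show ?thesis by simp
qed

lemma DK_measurable_snd:
  assumes t: "t \<in> {1..L}" and \<mu>: "locally_finite_borel_measure X \<rho> \<mu>" and x: "x \<in> X"
  shows "DK K t j x \<in> borel_measurable \<mu>"
proof -
  have "x \<in> space \<omega>" using x lf_space[OF omega] by simp
  from measurable_compose[OF measurable_Pair1'[OF this] DK_measurable[OF t omega \<mu>]] show ?thesis by simp
qed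

lemma DK_integral_measurable:
  assumes t: "t \<in> {1..L}" and f [measurable]: "f \<in> borel_measurable \<sigma>"
  shows "(\<lambda>x. \<integral>\<^sup>+y. DK K t j x y * f y \<partial>\<sigma>) \<in> borel_measurable \<omega>"
proof -
  interpret sigma_finite_measure \<sigma> by (rule lf_sigma_finite[OF sigma])
  note [measurable] = DK_measurable[OF t omega sigma]
  have "(\<lambda>x. \<integral>\<^sup>+y. DK K t j (fst (x, y)) (snd (x, y)) * f (snd (x, y)) \<partial>\<sigma>) \<in> borel_measurable \<omega>"
    by (rule borel_measurable_nn_integral_fst) measurable
  then show ?thesis by simp
qed

lemma DK_fubini:
  assumes t: "t \<in> {1..L}" and f [measurable]: "f \<in> borel_measurable \<sigma>" and g [measurable]: "g \<in> borel_measurable \<omega>"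
  shows "(\<integral>\<^sup>+y. (\<integral>\<^sup>+x. DK K t j x y * g x \<partial>\<omega>) * f y \<partial>\<sigma>) = (\<integral>\<^sup>+x. (\<integral>\<^sup>+y. DK K t j x y * f y \<partial>\<sigma>) * g x \<partial>\<omega>)"
proof -
  interpret \<sigma>: sigma_finite_measure \<sigma> by (rule lf_sigma_finite[OF sigma])
  interpret \<omega>: sigma_finite_measure \<omega> by (rule lf_sigma_finite[OF omega])
  interpret P: pair_sigma_finite \<omega> \<sigma> ..
  note [measurable] = DK_measurable[OF t omega sigma]
  have "(\<lambda>z. DK K t j (fst z) (snd z) * f (snd z) * g (fst z)) \<in> borel_measurable (\<omega> \<Otimes>\<^sub>M \<sigma>)" by measurable
  from P.Fubini[OF this]
  have F: "(\<integral>\<^sup>+y. (\<integral>\<^sup>+x. DK K t j x y * f y * g x \<partial>\<omega>) \<partial>\<sigma>) = (\<integral>\<^sup>+x. (\<integral>\<^sup>+y. DK K t j x y * f y * g x \<partial>\<sigma>) \<partial>\<omega>)"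
    by simp
  have "(\<integral>\<^sup>+x. DK K t j x y * g x \<partial>\<omega>) * f y = (\<integral>\<^sup>+x. DK K t j x y * f y * g x \<partial>\<omega>)" if "y \<in> space \<sigma>" for y
  proof -
    have [measurable]: "(\<lambda>x. DK K t j x y) \<in> borel_measurable \<omega>"
      using that lf_space[OF sigma] by (intro DK_measurable_fst[OF t omega]) auto
    have "(\<integral>\<^sup>+x. DK K t j x y * g x \<partial>\<omega>) * f y = (\<integral>\<^sup>+x. DK K t j x y * g x * f y \<partial>\<omega>)"
      by (rule nn_integral_multc[symmetric]) measurable
    then show ?thesis by (simp only: ac_simps)
  qed
  moreover have "(\<integral>\<^sup>+y. DK K t j x y * f y \<partial>\<sigma>) * g x = (\<integral>\<^sup>+y. DK K t j x y * f y * g x \<partial>\<sigma>)" if "x \<in> space \<omega>" for x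
  proof -
    have [measurable]: "DK K t j x \<in> borel_measurable \<sigma>"
      using that lf_space[OF omega] by (intro DK_measurable_snd[OF t sigma]) auto
    show ?thesis by (rule nn_integral_multc[symmetric]) measurable
  qed
  ultimately show ?thesis using F by (simp cong: nn_integral_cong)
qed

lemma nn_integral_atomic:
  assumes \<mu>: "locally_finite_borel_measure X \<rho> \<mu>" and \<nu>: "locally_finite_borel_measure X \<rho> \<nu>"
    and h: "\<And>x. x \<in> X \<Longrightarrow> emeasure \<mu> {x} = 0 \<Longrightarrow> h x = (0::ennreal)"
  shows "(\<integral>\<^sup>+x. h x \<partial>\<nu>) = (\<integral>\<^sup>+a. h a * emeasure \<nu> {a} \<partial>count_space {x\<in>X. emeasure \<mu> {x} \<noteq> 0})"
proof -
  have "(\<integral>\<^sup>+x. h x \<partial>\<nu>) = (\<integral>\<^sup>+x. h x * indicator {x\<in>X. emeasure \<mu> {x} \<noteq> 0} x \<partial>\<nu>)"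
    using h lf_space[OF \<nu>] by (intro nn_integral_cong) (auto split: split_indicator)
  also have "\<dots> = (\<integral>\<^sup>+a. h a * emeasure \<nu> {a} \<partial>count_space {x\<in>X. emeasure \<mu> {x} \<noteq> 0})"
    using countable_atoms[OF \<mu>] singleton_sets[OF \<nu>] by (intro nn_integral_countable_indicator) auto
  finally show ?thesis .
qed

text \<open>Both sides are the sum of c(a) times the two masses of a over the atoms of
  \<sigma>.\<close>

lemma nn_integral_atomic_commute:
  "(\<integral>\<^sup>+x. c x * emeasure \<sigma> {x} \<partial>\<omega>) = (\<integral>\<^sup>+x. c x * emeasure \<omega> {x} \<partial>\<sigma>)"
proof -
  let ?A = "{x\<in>X. emeasure \<sigma> {x} \<noteq> 0}"
  have "(\<integral>\<^sup>+x. c x * emeasure \<sigma> {x} \<partial>\<omega>) = (\<integral>\<^sup>+a. c a * emeasure \<sigma> {a} * emeasure \<omega> {a} \<partial>count_space ?A)"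
    by (rule nn_integral_atomic[OF sigma omega]) simp
  also have "\<dots> = (\<integral>\<^sup>+a. c a * emeasure \<omega> {a} * emeasure \<sigma> {a} \<partial>count_space ?A)"
    by (simp only: ac_simps)
  also have "\<dots> = (\<integral>\<^sup>+x. c x * emeasure \<omega> {x} * indicator ?A x \<partial>\<sigma>)"
    using countable_atoms[OF sigma] singleton_sets[OF sigma]
    by (intro nn_integral_countable_indicator[symmetric]) auto
  also have "\<dots> = (\<integral>\<^sup>+x. c x * emeasure \<omega> {x} \<partial>\<sigma>)"
  proof (rule nn_integral_cong_AE)
    have A: "?A \<in> sets \<sigma>"
      by (rule sets.countable[OF _ countable_atoms[OF sigma]]) (auto intro: singleton_sets[OF sigma])
    let ?W = "{x\<in>X. emeasure \<omega> {x} \<noteq> 0}"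
    \<comment> \<open>The atoms of \<omega> that have no mass for \<sigma> form a countable union of
      \<sigma>-null points, so restricting to \<open>?A\<close> changes nothing almost
      everywhere.\<close>
    have W: "countable (?W - ?A)" by (rule countable_Diff[OF countable_atoms[OF omega]])
    have "(\<Union>x\<in>?W - ?A. {x}) \<in> null_sets \<sigma>"
      by (rule null_sets_UN'[OF W]) (auto simp: null_sets_def intro: singleton_sets[OF sigma])
    then have "AE x in \<sigma>. x \<notin> (\<Union>x\<in>?W - ?A. {x})" by (rule AE_not_in)
    then show "AE x in \<sigma>. c x * emeasure \<omega> {x} * indicator ?A x = c x * emeasure \<omega> {x}"
      by (rule AE_mp) (auto intro!: AE_I2 simp: lf_space[OF sigma] split: split_indicator)
  qed
  finally show ?thesis .
qed

text \<open>Tonelli's theorem is not available for \<open>K\<close>, which need not be jointly measurable.\<close>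
lemma quasi_tonelli:
  assumes K: "potential_kernel X \<rho> \<kappa> K" and f [measurable]: "f \<in> borel_measurable \<sigma>" and g [measurable]: "g \<in> borel_measurable \<omega>"
  shows "(\<integral>\<^sup>+y. (\<integral>\<^sup>+x. K x y * g x \<partial>\<omega>) * f y \<partial>\<sigma>)
     \<le> ennreal (\<kappa> D * \<kappa> (2 * A\<^sub>0 * D) * (3 * real L) + 1) * (\<integral>\<^sup>+x. (\<integral>\<^sup>+y. K x y * f y \<partial>\<sigma>) * g x \<partial>\<omega>)"
proof -
  interpret potential_kernel X \<rho> \<kappa> K by (rule K)
  let ?c = "\<kappa> D * \<kappa> (2 * A\<^sub>0 * D)"
  let ?J = "\<integral>\<^sup>+x. (\<integral>\<^sup>+y. K x y * f y \<partial>\<sigma>) * g x \<partial>\<omega>"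
  have c: "0 \<le> ?c" using kappa_gt_1[OF D_gt_1(1)] kappa_gt_1[OF D_gt_1(2)] by simp
  have m1: "(\<lambda>y. \<integral>\<^sup>+x. DK K t j x y * g x \<partial>\<omega>) \<in> borel_measurable \<sigma>" if "t \<in> {1..L}" for t j
  proof -
    interpret sigma_finite_measure \<omega> by (rule lf_sigma_finite[OF omega])
    note [measurable] = DK_measurable[OF that omega sigma]
    have "(\<lambda>y. \<integral>\<^sup>+x. DK K t j (fst (x, y)) (snd (x, y)) * g (fst (x, y)) \<partial>\<omega>) \<in> borel_measurable \<sigma>"
      by measurable
    then show ?thesis by simp
  qed
  note m2 = atomic_measurable[OF omega sigma]
  have "(\<integral>\<^sup>+y. (\<integral>\<^sup>+x. K x y * g x \<partial>\<omega>) * f y \<partial>\<sigma>)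
     \<le> (\<integral>\<^sup>+y. (ennreal ?c * (\<Sum>t\<in>{1..L}. \<Sum>j\<in>{0..2}. (\<integral>\<^sup>+x. DK K t j x y * g x \<partial>\<omega>)) + K y y * g y * emeasure \<omega> {y}) * f y \<partial>\<sigma>)"
  proof (intro nn_integral_mono mult_right_mono)
    fix y assume "y \<in> space \<sigma>"
    then have y: "y \<in> X" using lf_space[OF sigma] by simp
    show "(\<integral>\<^sup>+x. K x y * g x \<partial>\<omega>)
      \<le> ennreal ?c * (\<Sum>t\<in>{1..L}. \<Sum>j\<in>{0..2}. (\<integral>\<^sup>+x. DK K t j x y * g x \<partial>\<omega>)) + K y y * g y * emeasure \<omega> {y}"
      by (rule nn_integral_le_off_diagonal[OF omega y g, where d = "\<lambda>t j x. DK K t j x y" and k = "\<lambda>x. K x y"])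
         (use y kernel_le_sum_DK[OF K] DK_measurable_fst[OF _ omega y] in auto)
  qed simp
  also have "\<dots> = (\<integral>\<^sup>+y. ennreal ?c * (\<Sum>t\<in>{1..L}. \<Sum>j\<in>{0..2}. (\<integral>\<^sup>+x. DK K t j x y * g x \<partial>\<omega>) * f y) + K y y * g y * f y * emeasure \<omega> {y} \<partial>\<sigma>)"
  proof (intro nn_integral_cong)
    fix y
    show "(ennreal ?c * (\<Sum>t\<in>{1..L}. \<Sum>j\<in>{0..2}. (\<integral>\<^sup>+x. DK K t j x y * g x \<partial>\<omega>)) + K y y * g y * emeasure \<omega> {y}) * f y
      = ennreal ?c * (\<Sum>t\<in>{1..L}. \<Sum>j\<in>{0..2}. (\<integral>\<^sup>+x. DK K t j x y * g x \<partial>\<omega>) * f y) + K y y * g y * f y * emeasure \<omega> {y}"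
      unfolding distrib_right sum_distrib_right[symmetric] by (simp only: ac_simps)
  qed
  also have "\<dots> = ennreal ?c * (\<Sum>t\<in>{1..L}. \<Sum>j\<in>{0..2}. (\<integral>\<^sup>+y. (\<integral>\<^sup>+x. DK K t j x y * g x \<partial>\<omega>) * f y \<partial>\<sigma>))
      + (\<integral>\<^sup>+y. K y y * g y * f y * emeasure \<omega> {y} \<partial>\<sigma>)"
  proof -
    have m: "(\<lambda>y. (\<integral>\<^sup>+x. DK K t j x y * g x \<partial>\<omega>) * f y) \<in> borel_measurable \<sigma>" if "t \<in> {1..L}" for t j
      using m1[OF that] by measurable
    then have m': "(\<lambda>y. \<Sum>t\<in>{1..L}. \<Sum>j\<in>{0..2}. (\<integral>\<^sup>+x. DK K t j x y * g x \<partial>\<omega>) * f y) \<in> borel_measurable \<sigma>"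
      by (intro borel_measurable_sum) auto
    show ?thesis
      using m m' m2 by (simp only: nn_integral_add nn_integral_cmult nn_integral_sum_sum borel_measurable_times_ennreal borel_measurable_const)
  qed
  \<comment> \<open>The order of integration is exchanged for each \<open>DK\<close>, and only then
    \<open>DK\<close> \<le> \<open>K\<close> is used to return to \<open>K\<close>. The 3L dyadic
    kernels and the diagonal each cost one copy of \<open>?J\<close>.\<close>
  also have "\<dots> \<le> ennreal ?c * (\<Sum>t\<in>{1..L}. \<Sum>j\<in>{0..2::int}. ?J) + ?J"
  proof (intro add_mono mult_left_mono sum_mono)
    fix t j assume t: "t \<in> {1..L}"
    show "(\<integral>\<^sup>+y. (\<integral>\<^sup>+x. DK K t j x y * g x \<partial>\<omega>) * f y \<partial>\<sigma>) \<le> ?J"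
      unfolding DK_fubini[OF t f g] using DK_le[OF t]
      by (intro nn_integral_mono mult_right_mono) auto
  next
    have "(\<integral>\<^sup>+y. K y y * g y * f y * emeasure \<omega> {y} \<partial>\<sigma>) = (\<integral>\<^sup>+x. K x x * g x * f x * emeasure \<sigma> {x} \<partial>\<omega>)"
      by (rule nn_integral_atomic_commute[symmetric])
    also have "\<dots> = (\<integral>\<^sup>+x. (K x x * f x * emeasure \<sigma> {x}) * g x \<partial>\<omega>)"
      by (simp only: ac_simps)
    also have "\<dots> \<le> ?J"
      using singleton_sets[OF sigma] lf_space[OF omega]
      by (intro nn_integral_mono mult_right_mono diagonal_le_integral[where k = "K _"]) auto
    finally show "(\<integral>\<^sup>+y. K y y * g y * f y * emeasure \<omega> {y} \<partial>\<sigma>) \<le> ?J" .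
  qed auto
  also have "(\<Sum>t\<in>{1..L}. \<Sum>j\<in>{0..2::int}. ?J) = of_nat (3 * L) * ?J"
    by (simp add: ac_simps)
  also have "of_nat (3 * L) = ennreal (3 * real L)"
    unfolding ennreal_of_nat_eq_real_of_nat by simp
  also have "ennreal ?c * (ennreal (3 * real L) * ?J) + ?J = (ennreal ?c * ennreal (3 * real L) + 1) * ?J"
    by (simp only: distrib_right mult.assoc mult_1_left)
  also have "ennreal ?c * ennreal (3 * real L) + 1 = ennreal (?c * (3 * real L) + 1)"
    using c by (simp add: ennreal_mult'')
  finally show ?thesis .
qed

text \<open>Testing on a cube around an atom a of at most twice its mass bounds (K(a,a)
  \<sigma>{a})^q \<omega>{a} by (2 \<sigma>{a})^(q/p). Multiplying by f(a)^q gives the power q/p of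
  f(a)^p \<sigma>{a}; this number is at most 1, so the power may be dropped and the terms summed
  over all atoms.\<close>

lemma diagonal_bound:
  assumes ex: "1 < p" "p \<le> q" "1/q + 1/q' = 1"
    and test: "testing_le L I Q \<sigma> \<omega> K p q"
    and f [measurable]: "f \<in> borel_measurable \<sigma>" and g [measurable]: "g \<in> borel_measurable \<omega>"
    and norms: "(\<integral>\<^sup>+x. epowr (f x) p \<partial>\<sigma>) \<le> 1" "(\<integral>\<^sup>+x. epowr (g x) q' \<partial>\<omega>) \<le> 1"
  shows "(\<integral>\<^sup>+x. (K x x * f x * emeasure \<sigma> {x}) * g x \<partial>\<omega>) \<le> ennreal (2 powr (q / p) + 1)"
proof -
  have q: "1 < q" using ex by simp
  let ?A = "{x\<in>X. emeasure \<sigma> {x} \<noteq> 0}"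
  let ?d = "\<lambda>x. K x x * f x * emeasure \<sigma> {x}"
  have d [measurable]: "?d \<in> borel_measurable \<omega>" by (rule atomic_measurable[OF sigma omega])
  have atom: "epowr (?d a) q * emeasure \<omega> {a} \<le> ennreal (2 powr (q / p)) * (epowr (f a) p * emeasure \<sigma> {a})"
    if a: "a \<in> ?A" for a
  proof -
    have aX: "a \<in> X" and ne: "emeasure \<sigma> {a} \<noteq> 0" using a by auto
    obtain k \<alpha> where c: "\<alpha> \<in> I 1 k" "a \<in> Q 1 k \<alpha>" "emeasure \<sigma> (Q 1 k \<alpha>) \<le> 2 * emeasure \<sigma> {a}"
      using small_cube[OF sigma aX L_pos ne] by blast
    let ?R = "Q 1 k \<alpha>"
    have R: "?R \<in> dyadic_cubes L I Q" using c(1) L_pos by (auto simp: dyadic_cubes_def)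
    have "epowr (K a a * emeasure \<sigma> {a}) q * emeasure \<omega> {a}
        = (\<integral>\<^sup>+x. epowr (K a a * emeasure \<sigma> {a}) q * indicator {a} x \<partial>\<omega>)"
      using singleton_sets[OF omega aX] by (simp add: nn_integral_cmult_indicator)
    also have "\<dots> \<le> (\<integral>\<^sup>+x. epowr (indicator ?R x * (\<integral>\<^sup>+y. K x y * indicator ?R y \<partial>\<sigma>)) q \<partial>\<omega>)"
    proof (intro nn_integral_mono)
      fix x
      have "K a a * emeasure \<sigma> {a} \<le> (\<integral>\<^sup>+y. K a y * indicator ?R y \<partial>\<sigma>)"
        using diagonal_le_integral[OF singleton_sets[OF sigma aX], of "K a" "indicator ?R"] c(2) by simp
      then show "epowr (K a a * emeasure \<sigma> {a}) q * indicator {a} x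
         \<le> epowr (indicator ?R x * (\<integral>\<^sup>+y. K x y * indicator ?R y \<partial>\<sigma>)) q"
        using c(2) q by (cases "x = a") (auto intro: epowr_mono)
    qed
    also have "\<dots> \<le> epowr (emeasure \<sigma> ?R) (q / p)"
      using test R by (simp add: testing_le_def)
    also have "\<dots> \<le> epowr (2 * emeasure \<sigma> {a}) (q / p)"
      using c(3) ex by (intro epowr_mono) auto
    also have "\<dots> = ennreal (2 powr (q / p)) * epowr (emeasure \<sigma> {a}) (q / p)"
      unfolding epowr_mult using epowr_ennreal[of 2 "q / p"] by simp
    finally have K: "epowr (K a a * emeasure \<sigma> {a}) q * emeasure \<omega> {a}
       \<le> ennreal (2 powr (q / p)) * epowr (emeasure \<sigma> {a}) (q / p)" .
    have "epowr (f a) p * emeasure \<sigma> {a} \<le> (\<integral>\<^sup>+x. 1 * epowr (f x) p \<partial>\<sigma>)"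
      using diagonal_le_integral[OF singleton_sets[OF sigma aX], of "\<lambda>_. 1" "\<lambda>x. epowr (f x) p"] by simp
    then have le1: "epowr (f a) p * emeasure \<sigma> {a} \<le> 1" using norms(1) by simp
    have "epowr (?d a) q * emeasure \<omega> {a} = epowr (f a) q * (epowr (K a a * emeasure \<sigma> {a}) q * emeasure \<omega> {a})"
      by (simp add: epowr_mult ac_simps)
    also have "\<dots> \<le> epowr (f a) q * (ennreal (2 powr (q / p)) * epowr (emeasure \<sigma> {a}) (q / p))"
      using K by (intro mult_left_mono) auto
    also have "\<dots> = ennreal (2 powr (q / p)) * epowr (epowr (f a) p * emeasure \<sigma> {a}) (q / p)"
      using ex by (simp add: epowr_mult epowr_epowr ac_simps)
    also have "\<dots> \<le> ennreal (2 powr (q / p)) * (epowr (f a) p * emeasure \<sigma> {a})"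
      using le1 ex by (intro mult_left_mono epowr_le_self) auto
    finally show ?thesis .
  qed
  have "(\<integral>\<^sup>+x. ?d x * g x \<partial>\<omega>) \<le> (\<integral>\<^sup>+x. epowr (?d x) q + epowr (g x) q' \<partial>\<omega>)"
    using young_ennreal[OF q ex(3)] by (intro nn_integral_mono) auto
  also have "\<dots> = (\<integral>\<^sup>+x. epowr (?d x) q \<partial>\<omega>) + (\<integral>\<^sup>+x. epowr (g x) q' \<partial>\<omega>)"
    by (rule nn_integral_add) measurable
  also have "(\<integral>\<^sup>+x. epowr (?d x) q \<partial>\<omega>) = (\<integral>\<^sup>+a. epowr (?d a) q * emeasure \<omega> {a} \<partial>count_space ?A)"
    by (rule nn_integral_atomic[OF sigma omega]) simp
  also have "\<dots> \<le> (\<integral>\<^sup>+a. ennreal (2 powr (q / p)) * (epowr (f a) p * emeasure \<sigma> {a}) \<partial>count_space ?A)"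
    using atom by (intro nn_integral_mono) auto
  also have "\<dots> = ennreal (2 powr (q / p)) * (\<integral>\<^sup>+a. epowr (f a) p * emeasure \<sigma> {a} \<partial>count_space ?A)"
    by (rule nn_integral_cmult) simp
  also have "(\<integral>\<^sup>+a. epowr (f a) p * emeasure \<sigma> {a} \<partial>count_space ?A) = (\<integral>\<^sup>+x. epowr (f x) p * indicator ?A x \<partial>\<sigma>)"
    using countable_atoms[OF sigma] singleton_sets[OF sigma]
    by (intro nn_integral_countable_indicator[symmetric]) auto
  also have "\<dots> \<le> (\<integral>\<^sup>+x. epowr (f x) p \<partial>\<sigma>)"
    by (intro nn_integral_mono) (auto split: split_indicator)
  finally have "(\<integral>\<^sup>+x. ?d x * g x \<partial>\<omega>)
     \<le> ennreal (2 powr (q / p)) * (\<integral>\<^sup>+x. epowr (f x) p \<partial>\<sigma>) + (\<integral>\<^sup>+x. epowr (g x) q' \<partial>\<omega>)"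
    by (simp add: add_right_mono mult_left_mono)
  also have "\<dots> \<le> ennreal (2 powr (q / p)) * 1 + 1"
    using norms by (intro add_mono mult_left_mono) auto
  also have "\<dots> = ennreal (2 powr (q / p) + 1)" by simp
  finally show ?thesis .
qed

section \<open>The bilinear form under normalised testing\<close>

lemma lf_borel_measurable:
  "locally_finite_borel_measure X \<rho> \<mu> \<Longrightarrow> borel_measurable \<mu> = borel_measurable (qborel X \<rho>)"
  by (rule measurable_cong_sets[OF lf_sets refl])

lemma dyadic_testing_system:
  assumes t: "t \<in> {1..L}" and ex: "1 < p" "p \<le> q" "1/p + 1/p' = 1" "1/q + 1/q' = 1"
    and test: "testing_le L I Q \<sigma> \<omega> K p q"
  shows "dyadic_testing X \<rho> A\<^sub>0 \<delta> x\<^sub>0 (I t) (Q t) (z t) \<sigma> \<omega> K p q p' q'"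
proof (intro dyadic_testing.intro system[OF t] weights dyadic_testing_axioms.intro ex)
  fix \<alpha> k assume a: "\<alpha> \<in> I t k"
  show "emeasure \<sigma> (Q t k \<alpha>) \<noteq> top" "emeasure \<omega> (Q t k \<alpha>) \<noteq> top"
    using cube_finite[OF sigma t a] cube_finite[OF omega t a] by auto
  have "Q t k \<alpha> \<in> dyadic_cubes L I Q" using t a by (auto simp: dyadic_cubes_def)
  then show "(\<integral>\<^sup>+x. epowr (indicator (Q t k \<alpha>) x * (\<integral>\<^sup>+y. K x y * indicator (Q t k \<alpha>) y \<partial>\<sigma>)) q \<partial>\<omega>)
     \<le> epowr (emeasure \<sigma> (Q t k \<alpha>)) (q / p)"
    using test by (simp add: testing_le_def)
qed

text \<open>The 3L dyadic kernels contribute one bound each, multiplied by the comparison constant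
  of the kernel; the last summand of the constant is the diagonal.\<close>

lemma normalized_bound:
  assumes K: "potential_kernel X \<rho> \<kappa> K"
    and ex: "1 < p" "p \<le> q" "1/p + 1/p' = 1" "1/q + 1/q' = 1"
    and test: "testing_le L I Q \<sigma> \<omega> K p q" and test': "testing_le L I Q \<omega> \<sigma> (\<lambda>x y. K y x) q' p'"
    and f [measurable]: "f \<in> borel_measurable \<sigma>" and g [measurable]: "g \<in> borel_measurable \<omega>"
    and norms: "(\<integral>\<^sup>+x. epowr (f x) p \<partial>\<sigma>) \<le> 1" "(\<integral>\<^sup>+x. epowr (g x) q' \<partial>\<omega>) \<le> 1"
  shows "(\<integral>\<^sup>+x. (\<integral>\<^sup>+y. K x y * f y \<partial>\<sigma>) * g x \<partial>\<omega>)
    \<le> ennreal (\<kappa> D * \<kappa> (2 * A\<^sub>0 * D) * (3 * real L) * (form_const p q + form_const q' p') + (2 powr (q / p) + 1))"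
proof -
  interpret potential_kernel X \<rho> \<kappa> K by (rule K)
  let ?c = "\<kappa> D * \<kappa> (2 * A\<^sub>0 * D)" and ?C = "form_const p q + form_const q' p'"
  have c: "0 \<le> ?c" using kappa_gt_1[OF D_gt_1(1)] kappa_gt_1[OF D_gt_1(2)] by simp
  have C: "0 \<le> ?C" using form_const_nonneg by simp
  have q': "1 < q'" "q' \<le> p'" "1/q' + 1/q = 1" "1/p' + 1/p = 1"
    using dyadic_testing.q'_bounds[OF dyadic_testing_system[OF L_pos ex test]] ex by (auto simp: add.commute)
  have DK: "(\<integral>\<^sup>+x. (\<integral>\<^sup>+y. DK K t j x y * f y \<partial>\<sigma>) * g x \<partial>\<omega>) \<le> ennreal ?C" if t: "t \<in> {1..L}" for t j
    unfolding DK_def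
    by (rule dyadic_kernel_bound[OF dyadic_testing_system[OF t ex test]
          adjacent_weights.dyadic_testing_system[OF swap t q' test'] f g norms])
  have "(\<integral>\<^sup>+x. (\<integral>\<^sup>+y. K x y * f y \<partial>\<sigma>) * g x \<partial>\<omega>)
     \<le> (\<integral>\<^sup>+x. (ennreal ?c * (\<Sum>t\<in>{1..L}. \<Sum>j\<in>{0..2}. (\<integral>\<^sup>+y. DK K t j x y * f y \<partial>\<sigma>)) + K x x * f x * emeasure \<sigma> {x}) * g x \<partial>\<omega>)"
  proof (intro nn_integral_mono mult_right_mono)
    fix x assume "x \<in> space \<omega>"
    then have x: "x \<in> X" using lf_space[OF omega] by simp
    show "(\<integral>\<^sup>+y. K x y * f y \<partial>\<sigma>)
      \<le> ennreal ?c * (\<Sum>t\<in>{1..L}. \<Sum>j\<in>{0..2}. (\<integral>\<^sup>+y. DK K t j x y * f y \<partial>\<sigma>)) + K x x * f x * emeasure \<sigma> {x}"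
      by (rule nn_integral_le_off_diagonal[OF sigma x f, where d = "\<lambda>t j y. DK K t j x y" and k = "K x"])
         (use x kernel_le_sum_DK[OF K] DK_measurable_snd[OF _ sigma x] in auto)
  qed simp
  also have "\<dots> = (\<integral>\<^sup>+x. ennreal ?c * (\<Sum>t\<in>{1..L}. \<Sum>j\<in>{0..2}. (\<integral>\<^sup>+y. DK K t j x y * f y \<partial>\<sigma>) * g x)
      + (K x x * f x * emeasure \<sigma> {x}) * g x \<partial>\<omega>)"
    unfolding distrib_right sum_distrib_right[symmetric] by (simp only: ac_simps)
  also have "\<dots> = ennreal ?c * (\<Sum>t\<in>{1..L}. \<Sum>j\<in>{0..2}. (\<integral>\<^sup>+x. (\<integral>\<^sup>+y. DK K t j x y * f y \<partial>\<sigma>) * g x \<partial>\<omega>))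
      + (\<integral>\<^sup>+x. (K x x * f x * emeasure \<sigma> {x}) * g x \<partial>\<omega>)"
  proof -
    have m: "(\<lambda>x. (\<integral>\<^sup>+y. DK K t j x y * f y \<partial>\<sigma>) * g x) \<in> borel_measurable \<omega>" if "t \<in> {1..L}" for t j
      using DK_integral_measurable[OF that f] by measurable
    then have m': "(\<lambda>x. \<Sum>t\<in>{1..L}. \<Sum>j\<in>{0..2}. (\<integral>\<^sup>+y. DK K t j x y * f y \<partial>\<sigma>) * g x) \<in> borel_measurable \<omega>"
      by (intro borel_measurable_sum) auto
    have m2: "(\<lambda>x. (K x x * f x * emeasure \<sigma> {x}) * g x) \<in> borel_measurable \<omega>"
      using atomic_measurable[OF sigma omega] by measurable
    show ?thesis
      using m m' m2 by (simp only: nn_integral_add nn_integral_cmult nn_integral_sum_sum borel_measurable_times_ennreal borel_measurable_const)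
  qed
  also have "\<dots> \<le> ennreal ?c * (\<Sum>t\<in>{1..L}. \<Sum>j\<in>{0..2::int}. ennreal ?C) + ennreal (2 powr (q / p) + 1)"
    by (intro add_mono mult_left_mono sum_mono DK diagonal_bound[OF ex(1,2,4) test f g norms]) auto
  also have "(\<Sum>t\<in>{1..L}. \<Sum>j\<in>{0..2::int}. ennreal ?C) = of_nat (3 * L) * ennreal ?C"
    by (simp add: ac_simps)
  also have "of_nat (3 * L) = ennreal (3 * real L)"
    unfolding ennreal_of_nat_eq_real_of_nat by simp
  also have "ennreal ?c * (ennreal (3 * real L) * ennreal ?C) + ennreal (2 powr (q / p) + 1)
     = ennreal (?c * (3 * real L) * ?C + (2 powr (q / p) + 1))"
  proof -
    have c3: "0 \<le> ?c * (3 * real L)" using c by (rule mult_nonneg_nonneg) simp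
    have "ennreal (?c * (3 * real L) * ?C) = ennreal (?c * (3 * real L)) * ennreal ?C"
      by (rule ennreal_mult[OF c3 C])
    also have "ennreal (?c * (3 * real L)) = ennreal ?c * ennreal (3 * real L)"
      by (rule ennreal_mult[OF c]) simp
    finally show ?thesis
      using ennreal_plus[OF mult_nonneg_nonneg[OF c3 C], of "2 powr (q / p) + 1"] by (simp add: mult.assoc)
  qed
  finally show ?thesis .
qed

section \<open>Rescaling, operator norm and testing constants\<close>

lemma potential_op_cmult:
  assumes "potential_kernel X \<rho> \<kappa> K" "x \<in> X" "f \<in> borel_measurable \<sigma>"
  shows "potential_op (\<lambda>x y. c * K x y) \<sigma> f x = c * potential_op K \<sigma> f x"
    and "potential_op K \<sigma> (\<lambda>y. f y * c) x = c * potential_op K \<sigma> f x"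
proof -
  have [measurable]: "K x \<in> borel_measurable \<sigma>"
    unfolding lf_borel_measurable[OF sigma] by (rule potential_kernel.measurable_right[OF assms(1,2)])
  note assms(3) [measurable]
  have "(\<integral>\<^sup>+y. c * K x y * f y \<partial>\<sigma>) = (\<integral>\<^sup>+y. c * (K x y * f y) \<partial>\<sigma>)"
    "(\<integral>\<^sup>+y. K x y * (f y * c) \<partial>\<sigma>) = (\<integral>\<^sup>+y. c * (K x y * f y) \<partial>\<sigma>)"
    by (simp_all only: ac_simps)
  then show "potential_op (\<lambda>x y. c * K x y) \<sigma> f x = c * potential_op K \<sigma> f x"
    "potential_op K \<sigma> (\<lambda>y. f y * c) x = c * potential_op K \<sigma> f x"
    by (simp_all add: potential_op_def nn_integral_cmult)
qed

lemma testing_le_scaled: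
  assumes K: "potential_kernel X \<rho> \<kappa> K"
    and meas: "\<And>f. f \<in> borel_measurable (qborel X \<rho>) \<Longrightarrow> potential_op K \<sigma> f \<in> borel_measurable (qborel X \<rho>)"
    and s: "testing_const (dyadic_cubes L I Q) p \<sigma> q \<omega> (potential_op K \<sigma>) \<le> ennreal s" "0 < s"
    and pq: "1 < p" "1 < q"
  shows "testing_le L I Q \<sigma> \<omega> (\<lambda>x y. ennreal (1 / s) * K x y) p q"
  unfolding testing_le_def
proof
  fix R assume R: "R \<in> dyadic_cubes L I Q"
  then obtain t k \<alpha> where t: "t \<in> {1..L}" "\<alpha> \<in> I t k" "R = Q t k \<alpha>" by (auto simp: dyadic_cubes_def)
  have RS: "R \<in> sets \<sigma>" "R \<in> sets \<omega>" "R \<in> sets (qborel X \<rho>)"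
    using cube_sets[OF sigma t(1,2)] cube_sets[OF omega t(1,2)] lf_sets[OF sigma] t(3) by auto
  have fin: "emeasure \<sigma> R \<noteq> top" using cube_finite[OF sigma t(1,2)] t(3) by simp
  let ?h = "\<lambda>x. indicator R x * potential_op K \<sigma> (indicator R) x"
  have Tm: "potential_op K \<sigma> (indicator R) \<in> borel_measurable \<omega>"
    unfolding lf_borel_measurable[OF omega] using RS(3) by (intro meas borel_measurable_indicator)
  note [measurable] = RS Tm
  let ?e = "epowr (emeasure \<sigma> R) (1 / p)"
  have h: "Lp_norm q \<omega> ?h \<le> ennreal s * ?e"
  proof (cases "emeasure \<sigma> R = 0")
    \<comment> \<open>The quotient in \<open>testing_const\<close> cannot be multiplied out for a
      null cube, but there the operator applied to the indicator vanishes identically.\<close>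
    case True
    then have "AE y in \<sigma>. indicator R y = (0::ennreal)"
      using RS(1) AE_not_in[of R \<sigma>] by (auto simp: null_sets_def indicator_def)
    then have "?h = (\<lambda>x. 0)" by (simp add: potential_op_AE_0)
    then show ?thesis by (simp add: Lp_norm_def)
  next
    case False
    then have e: "?e \<noteq> 0" "?e \<noteq> top" using fin by auto
    have "inverse ?e * Lp_norm q \<omega> ?h \<le> testing_const (dyadic_cubes L I Q) p \<sigma> q \<omega> (potential_op K \<sigma>)"
      unfolding testing_const_def by (rule SUP_upper[OF R])
    then have "?e * (inverse ?e * Lp_norm q \<omega> ?h) \<le> ?e * ennreal s"
      using s(1) by (intro mult_left_mono) auto
    then show ?thesis
      using ennreal_mult_inverse[OF e] by (simp add: mult.assoc[symmetric] mult.commute)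
  qed
  have "(\<integral>\<^sup>+x. epowr (indicator R x * (\<integral>\<^sup>+y. ennreal (1 / s) * K x y * indicator R y \<partial>\<sigma>)) q \<partial>\<omega>)
      = (\<integral>\<^sup>+x. epowr (ennreal (1 / s) * ?h x) q \<partial>\<omega>)"
  proof (intro nn_integral_cong)
    fix x assume "x \<in> space \<omega>"
    then have "potential_op (\<lambda>x y. ennreal (1 / s) * K x y) \<sigma> (indicator R) x = ennreal (1 / s) * potential_op K \<sigma> (indicator R) x"
      using lf_space[OF omega] RS by (intro potential_op_cmult[OF K]) auto
    then show "epowr (indicator R x * (\<integral>\<^sup>+y. ennreal (1 / s) * K x y * indicator R y \<partial>\<sigma>)) q
        = epowr (ennreal (1 / s) * ?h x) q"
      by (simp only: potential_op_def mult.left_commute)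
  qed
  also have "\<dots> \<le> epowr ?e q"
  proof -
    have "Lp_norm q \<omega> (\<lambda>x. ennreal (1 / s) * ?h x) = ennreal (1 / s) * Lp_norm q \<omega> ?h"
      using pq by (intro Lp_norm_cmult) auto
    also have "\<dots> \<le> ennreal (1 / s) * (ennreal s * ?e)" using h by (rule mult_left_mono) simp
    also have "\<dots> = ?e"
    proof -
      have "ennreal (1 / s) * ennreal s = 1" using s(2) by (simp flip: ennreal_mult)
      then show ?thesis by (simp only: mult.assoc[symmetric] mult_1_left)
    qed
    finally show ?thesis using pq by (subst (asm) Lp_norm_le_iff) auto
  qed
  also have "epowr ?e q = epowr (emeasure \<sigma> R) (q / p)" by (simp add: epowr_epowr)
  finally show "(\<integral>\<^sup>+x. epowr (indicator R x * (\<integral>\<^sup>+y. ennreal (1 / s) * K x y * indicator R y \<partial>\<sigma>)) q \<partial>\<omega>)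
    \<le> epowr (emeasure \<sigma> R) (q / p)" .
qed

text \<open>The infimum defining the norm is itself an admissible constant: divide by the norm of f.
  If this norm is 0, the image of f is identically 0, so an infinite operator norm does no
  harm.\<close>

lemma op_norm_bound:
  assumes f: "f \<in> borel_measurable \<sigma>" "Lp_norm p \<sigma> f < \<infinity>" and pq: "1 < p" "1 < q"
  shows "Lp_norm q \<omega> (potential_op K \<sigma> f) \<le> op_norm p \<sigma> q \<omega> (potential_op K \<sigma>) * Lp_norm p \<sigma> f"
proof (cases "Lp_norm p \<sigma> f = 0")
  case True
  have "AE y in \<sigma>. f y = 0" using Lp_norm_eq_0_AE[OF f(1) True] pq by simp
  then have "potential_op K \<sigma> f = (\<lambda>x. 0)" by (auto intro: potential_op_AE_0)
  then show ?thesis by (simp add: Lp_norm_def)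
next
  case False
  let ?n = "Lp_norm p \<sigma> f" and ?l = "Lp_norm q \<omega> (potential_op K \<sigma> f)"
  have n: "?n * inverse ?n = 1" using False f by (intro ennreal_mult_inverse) auto
  have "?l * inverse ?n \<le> op_norm p \<sigma> q \<omega> (potential_op K \<sigma>)"
    unfolding op_norm_def
  proof (rule Inf_greatest)
    fix C assume "C \<in> {C. \<forall>f\<in>borel_measurable \<sigma>. Lp_norm p \<sigma> f < \<infinity> \<longrightarrow> Lp_norm q \<omega> (potential_op K \<sigma> f) \<le> C * Lp_norm p \<sigma> f}"
    then have "?l \<le> C * ?n" using f by auto
    then have "?l * inverse ?n \<le> C * ?n * inverse ?n" by (rule mult_right_mono) simp
    then show "?l * inverse ?n \<le> C" using n by (simp add: mult.assoc)
  qed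
  then have "?l * inverse ?n * ?n \<le> op_norm p \<sigma> q \<omega> (potential_op K \<sigma>) * ?n" by (rule mult_right_mono) simp
  then show ?thesis using n by (simp add: mult.assoc mult.commute[of "inverse ?n"])
qed

lemma testing_const_le:
  assumes pq: "1 < p"
    and le: "\<And>R. R \<in> dyadic_cubes L I Q \<Longrightarrow> R \<in> sets \<sigma> \<Longrightarrow> R \<in> sets \<omega> \<Longrightarrow> emeasure \<sigma> R \<noteq> 0 \<Longrightarrow> emeasure \<sigma> R \<noteq> top \<Longrightarrow>
      Lp_norm q \<omega> (\<lambda>x. indicator R x * potential_op K \<sigma> (indicator R) x) \<le> B * epowr (emeasure \<sigma> R) (1 / p)"
  shows "testing_const (dyadic_cubes L I Q) p \<sigma> q \<omega> (potential_op K \<sigma>) \<le> B"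
  unfolding testing_const_def
proof (rule SUP_least)
  fix R assume R: "R \<in> dyadic_cubes L I Q"
  then obtain t k \<alpha> where t: "t \<in> {1..L}" "\<alpha> \<in> I t k" "R = Q t k \<alpha>" by (auto simp: dyadic_cubes_def)
  have RS: "R \<in> sets \<sigma>" "R \<in> sets \<omega>"
    using cube_sets[OF sigma t(1,2)] cube_sets[OF omega t(1,2)] t(3) by auto
  have fin: "emeasure \<sigma> R \<noteq> top" using cube_finite[OF sigma t(1,2)] t(3) by simp
  let ?h = "\<lambda>x. indicator R x * potential_op K \<sigma> (indicator R) x"
  let ?e = "epowr (emeasure \<sigma> R) (1 / p)"
  show "inverse ?e * Lp_norm q \<omega> ?h \<le> B"
  proof (cases "emeasure \<sigma> R = 0")
    case True
    then have "AE y in \<sigma>. indicator R y = (0::ennreal)"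
      using RS(1) AE_not_in[of R \<sigma>] by (auto simp: null_sets_def indicator_def)
    then have "?h = (\<lambda>x. 0)" by (simp add: potential_op_AE_0)
    then show ?thesis by (simp add: Lp_norm_def)
  next
    case False
    then have e: "?e \<noteq> 0" "?e \<noteq> top" using fin by auto
    have "inverse ?e * Lp_norm q \<omega> ?h \<le> inverse ?e * (B * ?e)"
      using le[OF R RS False fin] by (rule mult_left_mono) simp
    also have "\<dots> = B * (?e * inverse ?e)" by (simp only: ac_simps)
    finally show ?thesis using ennreal_mult_inverse[OF e] by simp
  qed
qed

end

lemma adjoint_op_eq: "adjoint_op K \<omega> = potential_op (\<lambda>x y. K y x) \<omega>"
  by (simp add: fun_eq_iff adjoint_op_def potential_op_def)

section \<open>The two inequalities\<close>

locale two_weight = adjacent_weights + potential_operator X \<rho> \<kappa> K \<sigma> \<omega> for \<kappa> K +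
  fixes p q p' q' :: real
  assumes ex: "1 < p" "p \<le> q" "1/p + 1/p' = 1" "1/q + 1/q' = 1"
begin

abbreviation (input) "cubes \<equiv> dyadic_cubes L I Q"
abbreviation (input) "N \<equiv> op_norm p \<sigma> q \<omega> (potential_op K \<sigma>)"
abbreviation (input) "S \<equiv> testing_const cubes p \<sigma> q \<omega> (potential_op K \<sigma>)"
abbreviation (input) "S' \<equiv> testing_const cubes q' \<omega> p' \<sigma> (adjoint_op K \<omega>)"
abbreviation (input) "ck \<equiv> \<kappa> D * \<kappa> (2 * A\<^sub>0 * D) * (3 * real L)"

lemma ck_nonneg: "0 \<le> ck"
  using kappa_gt_1[OF D_gt_1(1)] kappa_gt_1[OF D_gt_1(2)] by simp

lemma gt_1: "1 < q" "1 < p'" "1 < q'"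
  using ex conjugate_exponent_gt_1[of p p'] conjugate_exponent_gt_1[of q q'] by auto

lemma kernel: "potential_kernel X \<rho> \<kappa> K" by unfold_locales

lemma kernel_transpose: "potential_kernel X \<rho> \<kappa> (\<lambda>x y. K y x)"
  by (rule potential_kernel_transpose[OF kernel quasi_metric_space_axioms])

lemma op_measurable_omega: "f \<in> borel_measurable \<sigma> \<Longrightarrow> potential_op K \<sigma> f \<in> borel_measurable \<omega>"
  unfolding lf_borel_measurable[OF sigma] lf_borel_measurable[OF omega] by (rule op_measurable)

lemma adjoint_measurable_sigma: "g \<in> borel_measurable \<omega> \<Longrightarrow> adjoint_op K \<omega> g \<in> borel_measurable \<sigma>"
  unfolding lf_borel_measurable[OF sigma] lf_borel_measurable[OF omega] by (rule adjoint_measurable)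

lemma testing_le_norm: "S \<le> N"
proof (rule testing_const_le)
  fix R assume R: "R \<in> sets \<sigma>" "R \<in> sets \<omega>" "emeasure \<sigma> R \<noteq> 0" "emeasure \<sigma> R \<noteq> top"
  have n: "Lp_norm p \<sigma> (indicator R) = epowr (emeasure \<sigma> R) (1 / p)"
    using R ex by (intro Lp_norm_indicator) auto
  have "Lp_norm q \<omega> (\<lambda>x. indicator R x * potential_op K \<sigma> (indicator R) x) \<le> Lp_norm q \<omega> (potential_op K \<sigma> (indicator R))"
    using gt_1 by (intro Lp_norm_mono) (auto split: split_indicator)
  also have "\<dots> \<le> N * Lp_norm p \<sigma> (indicator R)"
    using R ex gt_1 n by (intro op_norm_bound) (auto simp: less_top[symmetric])
  finally show "Lp_norm q \<omega> (\<lambda>x. indicator R x * potential_op K \<sigma> (indicator R) x) \<le> N * epowr (emeasure \<sigma> R) (1 / p)"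
    by (simp add: n)
qed (use ex in auto)

text \<open>The adjoint is paired with a function f of norm at most 1, the order of integration is
  exchanged by \<open>quasi_tonelli\<close>, and Hoelder's inequality on the other side brings in
  the norm of the operator. The factors come from \<open>quasi_tonelli\<close> and
  \<open>holder_2\<close>.\<close>

lemma dual_testing_le_norm: "S' \<le> ennreal (ck + 1) * 2 * N"
  unfolding adjoint_op_eq
proof (rule adjacent_weights.testing_const_le[OF swap])
  fix R assume R: "R \<in> sets \<omega>" "R \<in> sets \<sigma>" "emeasure \<omega> R \<noteq> 0" "emeasure \<omega> R \<noteq> top"
  note [measurable] = R(1,2) adjoint_measurable_sigma
  let ?h = "\<lambda>y. indicator R y * potential_op (\<lambda>x y. K y x) \<omega> (indicator R) y"
  have hm: "?h \<in> borel_measurable \<sigma>"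
    unfolding adjoint_op_eq[symmetric] by measurable
  have n: "Lp_norm q' \<omega> (indicator R) = epowr (emeasure \<omega> R) (1 / q')"
    using R gt_1 by (intro Lp_norm_indicator) auto
  show "Lp_norm p' \<sigma> ?h \<le> ennreal (ck + 1) * 2 * N * epowr (emeasure \<omega> R) (1 / q')"
  proof (rule Lp_norm_le_by_duality[OF gt_1(2) _ hm lf_sigma_finite[OF sigma]])
    fix f assume f: "f \<in> borel_measurable \<sigma>" "(\<integral>\<^sup>+x. epowr (f x) p \<partial>\<sigma>) \<le> 1"
    have f1: "Lp_norm p \<sigma> f \<le> 1" using f ex by (subst Lp_norm_le_iff) auto
    have "(\<integral>\<^sup>+y. ?h y * f y \<partial>\<sigma>) \<le> (\<integral>\<^sup>+y. (\<integral>\<^sup>+x. K x y * indicator R x \<partial>\<omega>) * f y \<partial>\<sigma>)"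
      by (intro nn_integral_mono mult_right_mono) (auto simp: potential_op_def split: split_indicator)
    also have "\<dots> \<le> ennreal (ck + 1) * (\<integral>\<^sup>+x. (\<integral>\<^sup>+y. K x y * f y \<partial>\<sigma>) * indicator R x \<partial>\<omega>)"
      using R by (intro quasi_tonelli[OF kernel f(1)]) auto
    also have "(\<integral>\<^sup>+x. (\<integral>\<^sup>+y. K x y * f y \<partial>\<sigma>) * indicator R x \<partial>\<omega>) = (\<integral>\<^sup>+x. potential_op K \<sigma> f x * indicator R x \<partial>\<omega>)"
      by (simp add: potential_op_def)
    also have "\<dots> \<le> 2 * Lp_norm q \<omega> (potential_op K \<sigma> f) * Lp_norm q' \<omega> (indicator R)"
      using R n gt_1 ex op_measurable_omega[OF f(1)] by (intro holder_2) auto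
    also have "Lp_norm q \<omega> (potential_op K \<sigma> f) \<le> N * Lp_norm p \<sigma> f"
      using f f1 ex gt_1 by (intro op_norm_bound) (auto simp: less_top[symmetric] top_unique)
    also have "\<dots> \<le> N * 1" using f1 by (rule mult_left_mono) simp
    finally show "(\<integral>\<^sup>+y. ?h y * f y \<partial>\<sigma>) \<le> ennreal (ck + 1) * 2 * N * epowr (emeasure \<omega> R) (1 / q')"
      by (simp add: n mult.assoc mult_left_mono mult_right_mono)
  qed (use ex in auto)
qed (rule gt_1)

text \<open>By homogeneity the kernel is divided by a positive real s \<ge> \<open>S + S'\<close>,
  so that both testing constants become at most 1. The bilinear bound and duality then give the norm
  bound with constant \<open>C * s\<close>.\<close>

lemma norm_le_testing:
  defines "C \<equiv> ck * (form_const p q + form_const q' p') + (2 powr (q / p) + 1)"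
  shows "N \<le> ennreal C * (S + S')"
proof -
  have C: "0 < C"
    unfolding C_def
    by (intro add_nonneg_pos mult_nonneg_nonneg[OF ck_nonneg] add_nonneg_nonneg form_const_nonneg) simp_all
  have main: "N \<le> ennreal C * ennreal s" if s: "0 < s" "S + S' \<le> ennreal s" for s
  proof -
    let ?K = "\<lambda>x y. ennreal (1 / s) * K x y"
    have Ss: "S \<le> ennreal s" "S' \<le> ennreal s"
      using s(2) by (auto intro: order.trans[rotated])
    have T1: "testing_le L I Q \<sigma> \<omega> ?K p q"
      by (rule testing_le_scaled[OF kernel op_measurable Ss(1) s(1) ex(1) gt_1(1)])
    have T2: "testing_le L I Q \<omega> \<sigma> (\<lambda>x y. ennreal (1 / s) * K y x) q' p'"
      using adjacent_weights.testing_le_scaled[OF swap kernel_transpose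
          adjoint_measurable[unfolded adjoint_op_eq] Ss(2)[unfolded adjoint_op_eq] s(1) gt_1(3,2)] .
    have bound: "Lp_norm q \<omega> (potential_op K \<sigma> f) \<le> ennreal C * ennreal s * Lp_norm p \<sigma> f"
      if f [measurable]: "f \<in> borel_measurable \<sigma>" and fin: "Lp_norm p \<sigma> f < \<infinity>" for f
    proof (cases "Lp_norm p \<sigma> f = 0")
      case True
      have "AE y in \<sigma>. f y = 0" using Lp_norm_eq_0_AE[OF f True] ex by simp
      then have "potential_op K \<sigma> f = (\<lambda>x. 0)" by (auto intro: potential_op_AE_0)
      then show ?thesis by (simp add: Lp_norm_def)
    next
      case False
      let ?n = "Lp_norm p \<sigma> f"
      have n: "?n * inverse ?n = 1" using False fin by (intro ennreal_mult_inverse) auto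
      let ?f = "\<lambda>y. f y * inverse ?n"
      have "(\<integral>\<^sup>+y. epowr (?f y) p \<partial>\<sigma>) = (\<integral>\<^sup>+y. epowr (f y) p \<partial>\<sigma>) * epowr (inverse ?n) p"
        by (simp add: epowr_mult nn_integral_multc)
      also have "(\<integral>\<^sup>+y. epowr (f y) p \<partial>\<sigma>) = epowr ?n p"
        using ex by (simp add: Lp_norm_def epowr_epowr)
      also have "epowr ?n p * epowr (inverse ?n) p = 1" by (simp add: n flip: epowr_mult)
      finally have f1: "(\<integral>\<^sup>+y. epowr (?f y) p \<partial>\<sigma>) \<le> 1" by simp
      have "Lp_norm q \<omega> (potential_op K \<sigma> ?f) \<le> ennreal C * ennreal s"
      proof (rule Lp_norm_le_by_duality[OF gt_1(1) ex(4) _ lf_sigma_finite[OF omega]])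
        show m: "potential_op K \<sigma> ?f \<in> borel_measurable \<omega>" by (rule op_measurable_omega) measurable
        fix g assume g [measurable]: "g \<in> borel_measurable \<omega>" and g1: "(\<integral>\<^sup>+x. epowr (g x) q' \<partial>\<omega>) \<le> 1"
        note [measurable] = m
        have "ennreal (1 / s) * (\<integral>\<^sup>+x. potential_op K \<sigma> ?f x * g x \<partial>\<omega>)
           = (\<integral>\<^sup>+x. ennreal (1 / s) * (potential_op K \<sigma> ?f x * g x) \<partial>\<omega>)"
          by (rule nn_integral_cmult[symmetric]) measurable
        also have "\<dots> = (\<integral>\<^sup>+x. (\<integral>\<^sup>+y. ?K x y * ?f y \<partial>\<sigma>) * g x \<partial>\<omega>)"
        proof (intro nn_integral_cong)
          fix x assume "x \<in> space \<omega>"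
          then have "potential_op ?K \<sigma> ?f x = ennreal (1 / s) * potential_op K \<sigma> ?f x"
            using lf_space[OF omega] by (intro potential_op_cmult[OF kernel]) auto
          then show "ennreal (1 / s) * (potential_op K \<sigma> ?f x * g x) = (\<integral>\<^sup>+y. ?K x y * ?f y \<partial>\<sigma>) * g x"
            by (simp only: potential_op_def[of ?K] mult.assoc[symmetric])
        qed
        also have "\<dots> \<le> ennreal C"
          unfolding C_def
          by (rule normalized_bound[OF potential_kernel_scale[OF kernel] ex T1 T2 _ g f1 g1]) auto
        finally have "ennreal s * (ennreal (1 / s) * (\<integral>\<^sup>+x. potential_op K \<sigma> ?f x * g x \<partial>\<omega>)) \<le> ennreal s * ennreal C"
          by (rule mult_left_mono) simp
        moreover have "ennreal s * ennreal (1 / s) = 1" using s(1) by (simp flip: ennreal_mult)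
        ultimately show "(\<integral>\<^sup>+x. potential_op K \<sigma> ?f x * g x \<partial>\<omega>) \<le> ennreal C * ennreal s"
          by (simp only: mult.assoc[symmetric] mult_1_left mult.commute[of "ennreal C"])
      qed
      moreover have "Lp_norm q \<omega> (potential_op K \<sigma> ?f) = inverse ?n * Lp_norm q \<omega> (potential_op K \<sigma> f)"
      proof -
        have "Lp_norm q \<omega> (potential_op K \<sigma> ?f) = Lp_norm q \<omega> (\<lambda>x. inverse ?n * potential_op K \<sigma> f x)"
          using lf_space[OF omega] by (intro Lp_norm_cong potential_op_cmult[OF kernel]) auto
        also have "\<dots> = inverse ?n * Lp_norm q \<omega> (potential_op K \<sigma> f)"
          using gt_1 op_measurable_omega[OF f] by (intro Lp_norm_cmult) auto
        finally show ?thesis .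
      qed
      ultimately have "?n * (inverse ?n * Lp_norm q \<omega> (potential_op K \<sigma> f)) \<le> ?n * (ennreal C * ennreal s)"
        by (intro mult_left_mono) auto
      then show ?thesis
        by (simp only: mult.assoc[symmetric] n mult_1_left) (simp only: ac_simps)
    qed
    show ?thesis unfolding op_norm_def using bound by (intro Inf_lower) auto
  qed
  \<comment> \<open>The sum \<open>S + S'\<close> may be 0, which is no admissible divisor; so the
    bound is proved for every larger value and s descends to the sum.\<close>
  have "N * ennreal (1 / C) \<le> S + S'"
  proof (rule dense_ge)
    fix u assume u: "S + S' < u"
    show "N * ennreal (1 / C) \<le> u"
    proof (cases u)
      case (real s)
      then have "0 < s" using u by (metis ennreal_0 less_eq_real_def not_less_zero)
      then have "N \<le> ennreal C * ennreal s" using u real by (intro main) auto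
      then show ?thesis using le_ennreal_mult_iff[OF C] real by simp
    qed simp
  qed
  then show ?thesis using le_ennreal_mult_iff[OF C] by simp
qed

end

theorem theorem1p12:
  fixes A\<^sub>0 \<delta> p q p' q' :: real and A\<^sub>1 L :: nat and \<kappa> :: "real \<Rightarrow> real"
  assumes "1 \<le> A\<^sub>0" and "1 \<le> A\<^sub>1"
    and "0 < \<delta>" and "\<delta> < 1" and "96 * A\<^sub>0 ^ 6 * \<delta> \<le> 1"
    and "1 < p" and "p \<le> q"
    and "1 / p + 1 / p' = 1" and "1 / q + 1 / q' = 1"
  shows "\<exists>C>0::real.
    \<forall>(X :: 'a set) (\<rho> :: 'a \<Rightarrow> 'a \<Rightarrow> real) (x\<^sub>0 :: 'a)
      (I :: nat \<Rightarrow> int \<Rightarrow> nat set) (Q :: nat \<Rightarrow> int \<Rightarrow> nat \<Rightarrow> 'a set) (z :: nat \<Rightarrow> int \<Rightarrow> nat \<Rightarrow> 'a)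
      (\<sigma> :: 'a measure) (\<omega> :: 'a measure) (K :: 'a \<Rightarrow> 'a \<Rightarrow> ennreal).
      doubling_space X \<rho> A\<^sub>0 A\<^sub>1 \<longrightarrow>
      x\<^sub>0 \<in> X \<longrightarrow>
      adjacent_dyadic_systems X \<rho> A\<^sub>0 \<delta> x\<^sub>0 L I Q z \<longrightarrow>
      locally_finite_borel_measure X \<rho> \<sigma> \<longrightarrow>
      locally_finite_borel_measure X \<rho> \<omega> \<longrightarrow>
      potential_operator X \<rho> \<kappa> K \<sigma> \<omega> \<longrightarrow>
      (let \<D> = dyadic_cubes L I Q;
           N = op_norm p \<sigma> q \<omega> (potential_op K \<sigma>);
           S = testing_const \<D> p \<sigma> q \<omega> (potential_op K \<sigma>);
           S' = testing_const \<D> q' \<omega> p' \<sigma> (adjoint_op K \<omega>)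
       in S + S' \<le> ennreal C * N \<and> N \<le> ennreal C * (S + S'))"
proof -
  \<comment> \<open>The constants have to be named before the space and the weights are introduced;
    \<open>d\<close> and \<open>c\<close> repeat \<open>D\<close> and \<open>ck\<close>, which are
    available only inside the locale.\<close>
  define d where "d = 16 * A\<^sub>0 ^ 3 / \<delta> ^ 2"
  define c where "c = \<kappa> d * \<kappa> (2 * A\<^sub>0 * d) * (3 * real L)"
  define C1 where "C1 = c * (form_const p q + form_const q' p') + (2 powr (q / p) + 1)"
  define C2 where "C2 = 1 + (c + 1) * 2"
  define C where "C = max 1 (max C1 C2)"
  show ?thesis
  proof (intro exI[of _ C] conjI allI impI)
    show "0 < C" by (simp add: C_def)
    fix X :: "'a set" and \<rho> :: "'a \<Rightarrow> 'a \<Rightarrow> real" and x\<^sub>0 :: 'a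
      and I :: "nat \<Rightarrow> int \<Rightarrow> nat set" and Q :: "nat \<Rightarrow> int \<Rightarrow> nat \<Rightarrow> 'a set" and z :: "nat \<Rightarrow> int \<Rightarrow> nat \<Rightarrow> 'a"
      and \<sigma> \<omega> :: "'a measure" and K :: "'a \<Rightarrow> 'a \<Rightarrow> ennreal"
    assume "doubling_space X \<rho> A\<^sub>0 A\<^sub>1" "x\<^sub>0 \<in> X" "adjacent_dyadic_systems X \<rho> A\<^sub>0 \<delta> x\<^sub>0 L I Q z"
      "locally_finite_borel_measure X \<rho> \<sigma>" "locally_finite_borel_measure X \<rho> \<omega>"
      "potential_operator X \<rho> \<kappa> K \<sigma> \<omega>"
    then interpret two_weight X \<rho> A\<^sub>0 A\<^sub>1 \<delta> x\<^sub>0 L I Q z \<sigma> \<omega> \<kappa> K p q p' q'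
      using assms by (intro two_weight.intro adjacent_weights.intro adjacent_weights_axioms.intro two_weight_axioms.intro)
    have c: "c = ck" by (simp only: c_def d_def D_def)
    have c_nonneg: "0 \<le> c" unfolding c by (rule ck_nonneg)
    have "S + S' \<le> N + ennreal (ck + 1) * 2 * N"
      using testing_le_norm dual_testing_le_norm by (rule add_mono)
    also have "\<dots> = (1 + ennreal (ck + 1) * 2) * N"
      by (simp only: distrib_right mult_1_left)
    also have "1 + ennreal (ck + 1) * 2 = ennreal C2"
    proof -
      have "ennreal C2 = ennreal 1 + ennreal ((c + 1) * 2)"
        unfolding C2_def using c_nonneg by (intro ennreal_plus) auto
      also have "ennreal ((c + 1) * 2) = ennreal (c + 1) * ennreal 2"
        using c_nonneg by (intro ennreal_mult) auto
      finally show ?thesis by (simp add: c)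
    qed
    also have "ennreal C2 * N \<le> ennreal C * N"
      by (intro mult_right_mono ennreal_leI) (auto simp: C_def)
    finally have lower: "S + S' \<le> ennreal C * N" .
    have "N \<le> ennreal C1 * (S + S')"
      unfolding C1_def c by (rule norm_le_testing)
    also have "\<dots> \<le> ennreal C * (S + S')"
      by (intro mult_right_mono ennreal_leI) (auto simp: C_def)
    finally have upper: "N \<le> ennreal C * (S + S')" .
    from lower upper show "let \<D> = dyadic_cubes L I Q;
           N = op_norm p \<sigma> q \<omega> (potential_op K \<sigma>);
           S = testing_const \<D> p \<sigma> q \<omega> (potential_op K \<sigma>);
           S' = testing_const \<D> q' \<omega> p' \<sigma> (adjoint_op K \<omega>)
       in S + S' \<le> ennreal C * N \<and> N \<le> ennreal C * (S + S')"
      by (simp add: Let_def)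
  qed
qed

end
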